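(* Let $(Y,D)$ be a Looijenga pair with $D$ having $n\ge3$ irreducible components and tropicalization $(B,\Sigma)$; let $P$ be a toric monoid, $J\subset P$ a radical ideal, $\varphi$ a multivalued piecewise linear function with $\kappa_{\rho_i,\varphi}\in J$ for all $i$, $\mathfrak D$ a consistent scattering diagram for this data, and $I\subset P$ an ideal with $\sqrt I=J$. Let $A_I=\Gamma(X^o_{I,\mathfrak D},\mathcal O_{X^o_{I,\mathfrak D}})$, with its $R_I$-module basis of theta functions $\{\vartheta_q\mid q\in B(\mathbb Z)\}$. Let $q_1,q_2\in B(\mathbb Z)$. In the canonical expansion $$\vartheta_{q_1}\cdot\vartheta_{q_2}=\sum_{q\in B(\mathbb Z)}\alpha_q\vartheta_q,\qquad\alpha_q\in R_I,$$ we have $$\alpha_q=\sum_{\substack{(\gamma_1,\gamma_2)\\ \mathrm{Limits}(\gamma_i)=(q_i,z)\\ s(\gamma_1)+s(\gamma_2)=q}}c(\gamma_1)c(\gamma_2).$$ Here $z\in B_0$ is a (general) point very close to $q$ contained in a cell $\tau$, and $q$ is identified with a point of $\Lambda_\tau$ using the linear structure of $B_0$.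
   Context: $\Bbbk$ is an algebraically closed field of characteristic $0$. A *Looijenga pair* $(Y,D)$ is a smooth rational projective surface $Y$ with a reduced nodal $D\in|-K_Y|$ having at least one singular point; for $n\ge3$, $D=D_1+\cdots+D_n$ is a cycle of smooth rational curves, indices mod $n$. A *toric monoid* is $P=P^{gp}\cap\sigma_P$ with $P^{gp}$ a finitely generated free abelian group and $\sigma_P\subset P^{gp}_{\mathbb R}$ a convex rational polyhedral cone. Monoid ideals $I\subset P$ are identified with monomial ideals of $\Bbbk[P]$; $R_I=\Bbbk[P]/I$. *Tropicalization.* For each node $D_i\cap D_{i+1}$ take the cone $\sigma_{i,i+1}=\mathbb R_{\ge0}v_i+\mathbb R_{\ge0}v_{i+1}$ in $(\mathbb Zv_i\oplus\mathbb Zv_{i+1})\otimes\mathbb R$; glue along $\rho_i=\mathbb R_{\ge0}v_i$ to get $B\cong\mathbb R^2$ with cone decomposition $\Sigma$; $B_0=B\setminus\{0\}$ has an integral linear structure with charts on $\operatorname{Int}(\sigma_{i-1,i}\cup\sigma_{i,i+1})$, linear on cones, $v_{i-1}\mapsto(1,0)$, $v_i\mapsto(0,1)$, $v_{i+1}\mapsto(-1,-D_i^2)$. $\Lambda$ = local system of integral tangent vectors; $B_0(\mathbb Z)$ = integral points, $B(\mathbb Z)=B_0(\mathbb Z)\cup\{0\}$; points are identified with tangent vectors via the linear structure. *Monomials.* $\varphi$ is determined up to equivalence by its bending parameters $\kappa_i=\kappa_{\rho_i,\varphi}\in P$. Over the interior of a maximal cone $\sigma$, monomials are $cz^pX^m$,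 $c\in\Bbbk$, $p\in P^{gp}$, $m\in\Lambda_\sigma$. If $\sigma_\pm$ meet along $\rho_i$ and $n_\rho$ is the primitive covector vanishing on $\rho_i$, positive on $\sigma_+$, then $z^pX^m$ over $\sigma_-$ is identified with $z^{p-\langle n_\rho,m\rangle\kappa_i}X^m$ over $\sigma_+$. (Here $X^m$ denotes what is usually written $z^{\varphi_\sigma(m)}$.) *Scattering diagram*: a set $\mathfrak D=\{(\mathfrak d,f_{\mathfrak d})\}$ where $\mathfrak d\subset B$ is a ray from $0$ of rational slope, with primitive tangent vector $m_{\mathfrak d}$ pointing away from $0$ and $\tau_{\mathfrak d}$ the smallest cone of $\Sigma$ containing it; $f_{\mathfrak d}=1+\sum c_{p,k}z^pX^{km_{\mathfrak d}}$ ($p\in P$, $k\in\mathbb Z\setminus\{0\}$) lies in the $J$-adic completion of $\Bbbk[P][X^{\pm m_{\mathfrak d}}]$, and either all $k<0$ or all $k>0$; if $\dim\tau_{\mathfrak d}=2$ then $f_{\mathfrak d}\equiv1$ mod $J$ (the same is required if $\tau_{\mathfrak d}=\rho_i$ with $\kappa_i\notin J$); for every $I$ with $\sqrt I=J$ only finitely many $f_{\mathfrak d}\not\equiv1$ mod $I$. $\operatorname{Supp}_I(\mathfrak D)$ is the union of the $\mathfrak d$ with $f_{\mathfrak d}\not\equiv1$ mod $I$. *Gluing.* $R_{\sigma,I}=R_I[\Lambda_\sigma]$ for $\sigma$ maximal; $R_{\rho_i,I}=R_I[X_{i-1},X_i^{\pm1},X_{i+1}]/(X_{i-1}X_{i+1}-z^{\kappa_i}X_i^{-D_i^2}f_{\rho_i})$,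 $f_{\rho_i}=\prod_{\mathfrak d=\rho_i}f_{\mathfrak d}$ mod $I$ with $X_i=X^{v_i}$. Maps $\psi_{\rho_i,-}:R_{\rho_i,I}\to R_{\sigma_{i-1,i},I}$, $X_i\mapsto X^{v_i}$, $X_{i-1}\mapsto X^{v_{i-1}}$, $X_{i+1}\mapsto f_{\rho_i}z^{\kappa_i}X^{-v_{i-1}-D_i^2v_i}$, and $\psi_{\rho_i,+}:R_{\rho_i,I}\to R_{\sigma_{i,i+1},I}$, $X_i\mapsto X^{v_i}$, $X_{i+1}\mapsto X^{v_{i+1}}$, $X_{i-1}\mapsto f_{\rho_i}z^{\kappa_i}X^{-v_{i+1}-D_i^2v_i}$, identify $R_{\sigma_{i-1,i},I}$, $R_{\sigma_{i,i+1},I}$ with the localizations at $X_{i-1}$, $X_{i+1}$. For a path $\gamma$ in $\operatorname{Int}\sigma$ crossing rays transversally, $\theta_{\gamma,\mathfrak D}$ is the composition, in order of crossing, of the automorphisms $z^pX^m\mapsto z^pX^mf_{\mathfrak d}^{\langle n_{\mathfrak d},m\rangle}$ of $R_{\sigma,I}$, $n_{\mathfrak d}$ the primitive covector vanishing on $\mathfrak d$ and negative on $\gamma'$. $X^o_{I,\mathfrak D}$ is the $\operatorname{Spec}R_I$-scheme obtained by gluing the $\operatorname{Spec}R_{\rho_i,I}$ along the open subsets $\operatorname{Spec}R_{\sigma_{i,i+1},I}$ so that functions $g_i\in R_{\rho_i,I}$, $g_{i+1}\in R_{\rho_{i+1},I}$ agree on the overlap iff $\psi_{\rho_{i+1},-}(g_{i+1})=\theta_{\gamma_i,\mathfrak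 D}(\psi_{\rho_i,+}(g_i))$, where $\gamma_i$ is a path in $\operatorname{Int}\sigma_{i,i+1}$ from near $\rho_i$ to near $\rho_{i+1}$ crossing each ray of $\operatorname{Supp}_I(\mathfrak D)$ in $\operatorname{Int}\sigma_{i,i+1}$ once. *Broken lines.* A broken line for $q\in B_0(\mathbb Z)$ with endpoint $Q\in B_0$ is a proper continuous piecewise integral affine map $\gamma:(-\infty,0]\to B_0$, $\gamma(0)=Q$, with finitely many domains of linearity $L$, each carrying a monomial $m_L=c_Lz^pX^m$, $c_L\in\Bbbk^\times$ (transported along $\gamma|_L$ by parallel transport of $m$, with $z^pX^m$ replaced by $z^{p-\langle n_\rho,m\rangle\kappa_i}X^m$ whenever $\gamma$ crosses a ray $\rho_i$ from $\sigma_-$ to $\sigma_+$) with $\gamma'=-m$ on $L$; the unbounded domain goes to infinity in a maximal cone $\sigma\ni q$ with monomial $X^q$ there; when passing from $L$ to $L'$ at $t$, $\gamma$ crosses from one side to the other of the rays of $\mathfrak D$ containing $\gamma(t)$ and $m_{L'}=m_L\cdot(\text{a monomial term of }\prod_{\mathfrak d\ni\gamma(t)}f_{\mathfrak d}^{\langle n,m\rangle})$, $n$ the primitive covector vanishing on $\mathfrak d$ with $\langle n,m\rangle>0$. $\mathrm{Mono}(\gamma)$ is the last monomial; if over the cone containing $Q$ it is $cz^pX^m$, put $c(\gamma)=cz^p\in\Bbbk[P]$, $s(\gamma)=m$. Write $\mathrm{Limits}(\gamma)=(q,Q)$. For $q_i=0$ use $\vartheta_0=1$ (i.e. the only "broken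 line" for $0$ has $c=1$, $s=0$). For $Q\notin\operatorname{Supp}_I(\mathfrak D)$ in a maximal cone $\sigma$, $\mathrm{Lift}_Q(q)=\sum_\gamma\mathrm{Mono}(\gamma)\in R_{\sigma,I}$. *Consistency and theta functions.* $\mathfrak D$ is consistent if for all $I$ with $\sqrt I=J$, all $q\in B_0(\mathbb Z)$, and points on no ray of rational slope: (1) if $Q,Q'$ lie in the same maximal $\sigma$ then $\mathrm{Lift}_{Q'}(q)=\theta_{\gamma,\mathfrak D}(\mathrm{Lift}_Q(q))$ for a path $\gamma$ in $\operatorname{Int}\sigma$ from $Q$ to $Q'$; (2) if $Q_\pm\in\sigma_\pm$, $\rho=\sigma_+\cap\sigma_-$ a ray of $\Sigma$, and $Q_\pm$ lie in components of $B\setminus\operatorname{Supp}_I(\mathfrak D)$ whose closures contain $\rho$, then there is $\mathrm{Lift}_\rho(q)\in R_{\rho,I}$ with $\psi_{\rho,\pm}(\mathrm{Lift}_\rho(q))=\mathrm{Lift}_{Q_\pm}(q)$. In this case the $\mathrm{Lift}_{\rho_i}(q)$ glue to a function $\vartheta_q\in\Gamma(X^o_{I,\mathfrak D},\mathcal O)$; $\vartheta_0:=1$. The $\vartheta_q$, $q\in B(\mathbb Z)$, form an $R_I$-module basis of $A_I$. *)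

theory Defs
  imports
    "HOL-Analysis.Function_Topology"
    "HOL-Algebra.QuotRing"
    "HOL-Algebra.Module"
    "HOL-Algebra.Free_Abelian_Groups"
    "HOL-Computational_Algebra.Polynomial_Factorial"
    "HOL-Library.Poly_Mapping"
    "HOL-Library.Product_Plus"
begin

definition ring_on :: "'a::comm_ring_1 set \<Rightarrow> 'a ring" where
  "ring_on S = \<lparr>carrier = S, monoid.mult = times, one = 1, ring.zero = 0, ring.add = plus\<rparr>"


section \<open>Looijenga pairs\<close>

text \<open>
  A rational surface has function field \<open>K = k(s,t)\<close>. An integral projective surface with
  function field \<open>K\<close> is recorded by its homogeneous coordinates \<open>y 0, \<dots>, y N \<in> K\<close>, that is, it is
  \<open>Proj k[y 0 T, \<dots>, y N T]\<close>, and a scheme-theoretic point is recorded by its local ring, a subring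
  of \<open>K\<close>. A point \<open>x\<close> lies in the closure of a point \<open>C\<close> iff the local ring of \<open>x\<close> is contained in
  that of \<open>C\<close>.
\<close>

type_synonym 'k ratfun = "'k poly fract poly fract"

definition scalar :: "'k::field \<Rightarrow> 'k ratfun" where
  "scalar c = to_fract [:to_fract [:c:]:]"

inductive_set kalg :: "'k::field ratfun set \<Rightarrow> 'k ratfun set" for S where
  "scalar c \<in> kalg S"
| "f \<in> S \<Longrightarrow> f \<in> kalg S"
| "f \<in> kalg S \<Longrightarrow> g \<in> kalg S \<Longrightarrow> f + g \<in> kalg S"
| "f \<in> kalg S \<Longrightarrow> g \<in> kalg S \<Longrightarrow> f * g \<in> kalg S"

definition chart :: "nat \<Rightarrow> (nat \<Rightarrow> 'k::field ratfun) \<Rightarrow> nat \<Rightarrow> 'k ratfun set" where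
  "chart N y j = kalg {y l / y j |l. l \<le> N}"

definition localization :: "'a::field set \<Rightarrow> 'a set \<Rightarrow> 'a set" where
  "localization A \<pp> = {a / b |a b. a \<in> A \<and> b \<in> A - \<pp>}"

definition closed_points :: "nat \<Rightarrow> (nat \<Rightarrow> 'k::field ratfun) \<Rightarrow> 'k ratfun set set" where
  "closed_points N y = {localization (chart N y j) \<mm> |j \<mm>.
     j \<le> N \<and> y j \<noteq> 0 \<and> maximalideal \<mm> (ring_on (chart N y j))}"

text \<open>A prime divisor is recorded by the local ring at its generic point.\<close>

definition prime_divisors :: "nat \<Rightarrow> (nat \<Rightarrow> 'k::field ratfun) \<Rightarrow> 'k ratfun set set" where
  "prime_divisors N y = {localization (chart N y j) \<pp> |j \<pp>.
     j \<le> N \<and> y j \<noteq> 0 \<and> primeideal \<pp> (ring_on (chart N y j)) \<and> \<pp> \<noteq> {0} \<and>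
     \<not> maximalideal \<pp> (ring_on (chart N y j))}"

definition local_units :: "'a::field set \<Rightarrow> 'a set" where
  "local_units x = {a \<in> x. a \<noteq> 0 \<and> inverse a \<in> x}"

definition local_max :: "'a::field set \<Rightarrow> 'a set" where
  "local_max x = x - local_units x"

definition params :: "'a::field set \<Rightarrow> 'a \<Rightarrow> 'a \<Rightarrow> bool" where
  "params x u v \<longleftrightarrow> u \<in> x \<and> v \<in> x \<and> local_max x = {a * u + b * v |a b. a \<in> x \<and> b \<in> x}"

definition smooth_rational_projective_surface :: "nat \<Rightarrow> (nat \<Rightarrow> 'k::field ratfun) \<Rightarrow> bool" where
  "smooth_rational_projective_surface N y \<longleftrightarrow>
     (\<exists>j\<le>N. y j \<noteq> 0) \<and>
     (\<forall>j\<le>N. y j \<noteq> 0 \<longrightarrow>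
        (\<forall>f. \<exists>a\<in>chart N y j. \<exists>b\<in>chart N y j. b \<noteq> 0 \<and> f = a / b)) \<and>
     (\<forall>x\<in>closed_points N y. \<exists>u v. params x u v)"

definition local_eq :: "'a::field set \<Rightarrow> 'a set \<Rightarrow> 'a \<Rightarrow> bool" where
  "local_eq x C h \<longleftrightarrow> h \<in> x \<and>
     (if x \<subseteq> C then local_max C \<inter> x else x) = {a * h |a. a \<in> x}"

text \<open>\<open>h\<close> is a local equation at \<open>x\<close> of the reduced divisor \<open>D 0 + \<dots> + D (n - 1)\<close>.\<close>

definition local_eq_sum :: "'a::field set \<Rightarrow> nat \<Rightarrow> (nat \<Rightarrow> 'a set) \<Rightarrow> 'a \<Rightarrow> bool" where
  "local_eq_sum x n D h \<longleftrightarrow> (\<exists>e. (\<forall>i<n. local_eq x (D i) (e i)) \<and> h = (\<Prod>i<n. e i))"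

text \<open>An ordinary double point: the local equation is \<open>u v\<close> up to cubic terms.\<close>

definition node_at :: "'a::field set \<Rightarrow> 'a \<Rightarrow> bool" where
  "node_at x h \<longleftrightarrow> (\<exists>u v. params x u v \<and>
     (\<exists>a\<in>x. \<exists>b\<in>x. \<exists>c\<in>x. \<exists>d\<in>x. h - u * v = a * u^3 + b * u^2 * v + c * u * v^2 + d * v^3))"

definition smooth_at :: "'a::field set \<Rightarrow> 'a \<Rightarrow> bool" where
  "smooth_at x h \<longleftrightarrow> (\<exists>v. params x h v)"

definition derivation :: "('k::field ratfun \<Rightarrow> 'k ratfun) \<Rightarrow> bool" where
  "derivation \<delta> \<longleftrightarrow> (\<forall>c. \<delta> (scalar c) = 0) \<and> (\<forall>f g. \<delta> (f + g) = \<delta> f + \<delta> g) \<and>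
     (\<forall>f g. \<delta> (f * g) = \<delta> f * g + f * \<delta> g)"

text \<open>Rational 2-forms are the alternating \<open>K\<close>-bilinear forms on the \<open>k\<close>-derivations of \<open>K\<close>.\<close>

definition rational_2form ::
  "(('k::field ratfun \<Rightarrow> 'k ratfun) \<Rightarrow> ('k ratfun \<Rightarrow> 'k ratfun) \<Rightarrow> 'k ratfun) \<Rightarrow> bool" where
  "rational_2form \<omega> \<longleftrightarrow>
     (\<forall>\<delta>. derivation \<delta> \<longrightarrow> \<omega> \<delta> \<delta> = 0) \<and>
     (\<forall>\<delta> \<delta>' \<epsilon>. derivation \<delta> \<and> derivation \<delta>' \<and> derivation \<epsilon> \<longrightarrow>
        \<omega> (\<lambda>f. \<delta> f + \<delta>' f) \<epsilon> = \<omega> \<delta> \<epsilon> + \<omega> \<delta>' \<epsilon> \<and>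
        \<omega> \<epsilon> (\<lambda>f. \<delta> f + \<delta>' f) = \<omega> \<epsilon> \<delta> + \<omega> \<epsilon> \<delta>') \<and>
     (\<forall>a \<delta> \<epsilon>. derivation \<delta> \<and> derivation \<epsilon> \<longrightarrow>
        \<omega> (\<lambda>f. a * \<delta> f) \<epsilon> = a * \<omega> \<delta> \<epsilon> \<and> \<omega> \<epsilon> (\<lambda>f. a * \<delta> f) = a * \<omega> \<epsilon> \<delta>)"

text \<open>
  \<open>D \<in> |-K|\<close>: some rational 2-form has divisor \<open>-D\<close>. With \<open>\<delta>\<^sub>u, \<delta>\<^sub>v\<close> dual to local
  parameters \<open>u, v\<close>, the 2-form \<open>\<omega>\<close> is \<open>\<omega>(\<delta>\<^sub>u, \<delta>\<^sub>v) du \<and> dv\<close>.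
\<close>

definition anticanonical :: "nat \<Rightarrow> (nat \<Rightarrow> 'k::field ratfun) \<Rightarrow> nat \<Rightarrow> (nat \<Rightarrow> 'k ratfun set) \<Rightarrow> bool" where
  "anticanonical N y n D \<longleftrightarrow> (\<exists>\<omega>. rational_2form \<omega> \<and>
     (\<forall>x\<in>closed_points N y. \<forall>u v \<delta>u \<delta>v h.
        params x u v \<and> derivation \<delta>u \<and> derivation \<delta>v \<and>
        \<delta>u u = 1 \<and> \<delta>u v = 0 \<and> \<delta>v u = 0 \<and> \<delta>v v = 1 \<and> local_eq_sum x n D h \<longrightarrow>
        h * \<omega> \<delta>u \<delta>v \<in> local_units x))"

definition looijenga_pair :: "nat \<Rightarrow> (nat \<Rightarrow> 'k::field ratfun) \<Rightarrow> nat \<Rightarrow> (nat \<Rightarrow> 'k ratfun set) \<Rightarrow> bool" where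
  "looijenga_pair N y n D \<longleftrightarrow>
     smooth_rational_projective_surface N y \<and>
     (\<forall>i<n. D i \<in> prime_divisors N y) \<and> inj_on D {..<n} \<and>
     (\<forall>x\<in>closed_points N y. \<forall>h. (\<exists>i<n. x \<subseteq> D i) \<and> local_eq_sum x n D h \<longrightarrow>
        smooth_at x h \<or> node_at x h) \<and>
     anticanonical N y n D \<and>
     (\<exists>x\<in>closed_points N y. \<exists>h. local_eq_sum x n D h \<and> node_at x h)"

definition smooth_rational_curve :: "nat \<Rightarrow> (nat \<Rightarrow> 'k::field ratfun) \<Rightarrow> 'k ratfun set \<Rightarrow> bool" where
  "smooth_rational_curve N y C \<longleftrightarrow>
     (\<forall>x\<in>closed_points N y. x \<subseteq> C \<longrightarrow> (\<exists>h. local_eq x C h \<and> smooth_at x h)) \<and>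
     (\<exists>t\<in>C. \<forall>f\<in>C. \<exists>a\<in>kalg {t}. \<exists>b\<in>kalg {t} - local_max C. f * b - a \<in> local_max C)"

text \<open>The components are numbered cyclically along the cycle (for \<open>n \<ge> 3\<close>).\<close>

definition cyclically_ordered :: "nat \<Rightarrow> (nat \<Rightarrow> 'k::field ratfun) \<Rightarrow> nat \<Rightarrow> (nat \<Rightarrow> 'k ratfun set) \<Rightarrow> bool" where
  "cyclically_ordered N y n D \<longleftrightarrow>
     (\<forall>i<n. smooth_rational_curve N y (D i)) \<and>
     (\<forall>i<n. \<exists>!x. x \<in> closed_points N y \<and> x \<subseteq> D i \<and> x \<subseteq> D (Suc i mod n)) \<and>
     (\<forall>i<n. \<forall>j<n. i \<noteq> j \<and> j \<noteq> Suc i mod n \<and> i \<noteq> Suc j mod n \<longrightarrow>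
        \<not> (\<exists>x\<in>closed_points N y. x \<subseteq> D i \<and> x \<subseteq> D j))"

text \<open>Order of vanishing at the point \<open>x\<close> of the smooth curve \<open>C\<close> of the restriction of \<open>g\<close> to \<open>C\<close>.\<close>

definition order_on_curve :: "'a::field set \<Rightarrow> 'a set \<Rightarrow> 'a \<Rightarrow> int \<Rightarrow> bool" where
  "order_on_curve C x g m \<longleftrightarrow> (\<exists>h v w. local_eq x C h \<and> params x h v \<and> w \<in> local_units x \<and>
     g - w * (v powi m) \<in> local_max C)"

text \<open>
  \<open>C\<^sup>2\<close> is the degree of \<open>O(C)\<close> restricted to \<open>C\<close>. If \<open>f\<close> generates the maximal ideal of the local
  ring at the generic point of \<open>C\<close>, the rational section \<open>1/f\<close> of \<open>O(C)\<close> is \<open>h/f\<close> times the local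
  generator \<open>1/h\<close> at \<open>x\<close>, where \<open>h\<close> is a local equation of \<open>C\<close> at \<open>x\<close>.
\<close>

definition self_intersection :: "nat \<Rightarrow> (nat \<Rightarrow> 'k::field ratfun) \<Rightarrow> 'k ratfun set \<Rightarrow> int" where
  "self_intersection N y C = (THE s. \<exists>f ord.
     local_max C = {a * f |a. a \<in> C} \<and>
     (\<forall>x\<in>closed_points N y. x \<subseteq> C \<longrightarrow>
        (\<exists>h. local_eq x C h \<and> order_on_curve C x (h / f) (ord x))) \<and>
     finite {x \<in> closed_points N y. x \<subseteq> C \<and> ord x \<noteq> 0} \<and>
     s = (\<Sum>x\<in>{x \<in> closed_points N y. x \<subseteq> C \<and> ord x \<noteq> 0}. ord x))"


section \<open>Toric monoids and monomial ideals\<close>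

definition zmul :: "int \<Rightarrow> 'a::ab_group_add \<Rightarrow> 'a" where
  "zmul k a = (if 0 \<le> k then ((+) a ^^ nat k) 0 else - (((+) a ^^ nat (- k)) 0))"

text \<open>The type \<open>'p\<close> is the group \<open>P\<^sup>g\<^sup>p\<close>; the cone is given by finitely many integral half-spaces.\<close>

definition toric_monoid :: "'p::ab_group_add set \<Rightarrow> bool" where
  "toric_monoid P \<longleftrightarrow>
     (\<exists>r::nat. \<lparr>carrier = (UNIV :: 'p set), monoid.mult = (+), one = 0\<rparr> \<cong> free_Abelian_group {..<r}) \<and>
     (\<forall>p. \<exists>a\<in>P. \<exists>b\<in>P. p = a - b) \<and>
     (\<exists>L :: ('p \<Rightarrow> int) set. finite L \<and> (\<forall>l\<in>L. \<forall>a b. l (a + b) = l a + l b) \<and>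
        P = {p. \<forall>l\<in>L. 0 \<le> l p})"

definition monoid_ideal :: "'p::ab_group_add set \<Rightarrow> 'p set \<Rightarrow> bool" where
  "monoid_ideal P I \<longleftrightarrow> I \<subseteq> P \<and> (\<forall>p\<in>P. \<forall>a\<in>I. p + a \<in> I)"

definition monoid_radical :: "'p::ab_group_add set \<Rightarrow> 'p set \<Rightarrow> 'p set" where
  "monoid_radical P I = {p \<in> P. \<exists>k>0. zmul (int k) p \<in> I}"

primrec ideal_power :: "'p::ab_group_add set \<Rightarrow> 'p set \<Rightarrow> nat \<Rightarrow> 'p set" where
  "ideal_power P J 0 = P"
| "ideal_power P J (Suc N) = {a + b |a b. a \<in> J \<and> b \<in> ideal_power P J N}"

definition monoid_algebra :: "'m::comm_monoid_add set \<Rightarrow> ('m \<Rightarrow>\<^sub>0 'k::comm_ring_1) ring" where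
  "monoid_algebra M = ring_on {f. Poly_Mapping.keys f \<subseteq> M}"

definition push :: "('a \<Rightarrow> 'b) \<Rightarrow> ('a \<Rightarrow>\<^sub>0 'k::comm_monoid_add) \<Rightarrow> ('b \<Rightarrow>\<^sub>0 'k)" where
  "push \<phi> F = (\<Sum>x\<in>Poly_Mapping.keys F. Poly_Mapping.single (\<phi> x) (Poly_Mapping.lookup F x))"


section \<open>The tropicalization\<close>

text \<open>
  \<open>B\<close> is embedded in the space of coordinate vectors, with \<open>v\<^sub>i\<close> the \<open>i\<close>-th unit vector; the
  cone with index \<open>i\<close> is \<open>\<sigma>\<^sub>i\<^sub>,\<^sub>i\<^sub>+\<^sub>1\<close>. Tangent vectors over this cone are written in the basis
  \<open>v\<^sub>i, v\<^sub>i\<^sub>+\<^sub>1\<close>.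
\<close>

definition max_cone :: "nat \<Rightarrow> nat \<Rightarrow> (nat \<Rightarrow> real) set" where
  "max_cone n i = {x. (\<forall>j. 0 \<le> x j) \<and> (\<forall>j. j \<noteq> i \<and> j \<noteq> Suc i mod n \<longrightarrow> x j = 0)}"

definition max_cone_int :: "nat \<Rightarrow> nat \<Rightarrow> (nat \<Rightarrow> real) set" where
  "max_cone_int n i = {x \<in> max_cone n i. 0 < x i \<and> 0 < x (Suc i mod n)}"

definition trop :: "nat \<Rightarrow> (nat \<Rightarrow> real) set" where
  "trop n = (\<Union>i<n. max_cone n i)"

definition re :: "(nat \<Rightarrow> int) \<Rightarrow> nat \<Rightarrow> real" where
  "re q = (\<lambda>j. real_of_int (q j))"

definition trop_int :: "nat \<Rightarrow> (nat \<Rightarrow> int) set" where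
  "trop_int n = {q. re q \<in> trop n}"

definition ray_through :: "(nat \<Rightarrow> int) \<Rightarrow> (nat \<Rightarrow> real) set" where
  "ray_through m = {\<lambda>j. r * re m j |r. 0 \<le> r}"

definition unit_vec :: "nat \<Rightarrow> nat \<Rightarrow> int" where
  "unit_vec i = (\<lambda>j. if j = i then 1 else 0)"

text \<open>Points of \<open>B\<close> on no ray of rational slope.\<close>

definition irrational_points :: "nat \<Rightarrow> (nat \<Rightarrow> real) set" where
  "irrational_points n = trop n - (\<Union>m\<in>trop_int n. ray_through m)"

definition coords :: "nat \<Rightarrow> nat \<Rightarrow> (nat \<Rightarrow> 'a) \<Rightarrow> 'a \<times> 'a" where
  "coords n i x = (x i, x (Suc i mod n))"

definition slope :: "nat \<Rightarrow> nat \<Rightarrow> (nat \<Rightarrow> real) \<Rightarrow> real" where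
  "slope n i x = x (Suc i mod n) / x i"


section \<open>Scattering diagrams\<close>

text \<open>
  A wall \<open>(m, f)\<close> consists of the primitive generator \<open>m\<close> of the ray and the coefficient function of
  \<open>\<Sum> f (p, k) z\<^sup>p X\<^sup>k\<^sup>m\<close>. The multivalued piecewise linear function enters through its bending
  parameters \<open>kappa\<close> only, the tropicalization through the number \<open>comps\<close> of components and their
  self-intersections \<open>selfint\<close>.
\<close>

record ('k, 'p) scatter_data =
  comps :: nat
  selfint :: "nat \<Rightarrow> int"
  monoidP :: "'p set"
  idealJ :: "'p set"
  kappa :: "nat \<Rightarrow> 'p"
  diag :: "((nat \<Rightarrow> int) \<times> ('p \<times> int \<Rightarrow> 'k)) set"

definition trivial_mod :: "'p::ab_group_add set \<Rightarrow> ('p \<times> int \<Rightarrow> 'k::comm_ring_1) \<Rightarrow> bool" where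
  "trivial_mod I f \<longleftrightarrow> (\<forall>p k. p \<notin> I \<longrightarrow> f (p, k) = (if (p, k) = (0, 0) then 1 else 0))"

definition completed :: "'p::ab_group_add set \<Rightarrow> 'p set \<Rightarrow> ('p \<times> int \<Rightarrow> 'k::comm_ring_1) set" where
  "completed P J = {f. (\<forall>p k. f (p, k) \<noteq> 0 \<longrightarrow> p \<in> P) \<and>
     (\<forall>N. finite {(p, k). p \<notin> ideal_power P J N \<and> f (p, k) \<noteq> 0})}"

definition scattering_diagram :: "('k::field, 'p::ab_group_add) scatter_data \<Rightarrow> bool" where
  "scattering_diagram G \<longleftrightarrow>
     (\<forall>(m, f)\<in>diag G.
        m \<in> trop_int (comps G) \<and> Gcd (range m) = 1 \<and>
        f \<in> completed (monoidP G) (idealJ G) \<and>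
        (\<forall>p. f (p, 0) = (if p = 0 then 1 else 0)) \<and>
        ((\<forall>p k. f (p, k) \<noteq> 0 \<longrightarrow> k \<le> 0) \<or> (\<forall>p k. f (p, k) \<noteq> 0 \<longrightarrow> 0 \<le> k)) \<and>
        ((\<forall>i<comps G. m = unit_vec i \<longrightarrow> kappa G i \<notin> idealJ G) \<longrightarrow> trivial_mod (idealJ G) f)) \<and>
     (\<forall>I. monoid_ideal (monoidP G) I \<and> monoid_radical (monoidP G) I = idealJ G \<longrightarrow>
        finite {(m, f) \<in> diag G. \<not> trivial_mod I f})"

definition supp :: "('k::field, 'p::ab_group_add) scatter_data \<Rightarrow> 'p set \<Rightarrow> (nat \<Rightarrow> real) set" where
  "supp G I = \<Union> {ray_through m |m. \<exists>f. (m, f) \<in> diag G \<and> \<not> trivial_mod I f}"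

definition truncate :: "'p::ab_group_add set \<Rightarrow> ('p \<times> int \<Rightarrow> 'k::comm_ring_1) \<Rightarrow> ('p \<times> int) \<Rightarrow>\<^sub>0 'k" where
  "truncate I f = Abs_poly_mapping (\<lambda>(p, k). if p \<in> I then 0 else f (p, k))"

text \<open>A representative modulo \<open>I\<close> of the product of the functions of all walls with generator \<open>m\<close>.\<close>

definition ray_fun :: "('k::field, 'p::ab_group_add) scatter_data \<Rightarrow> 'p set \<Rightarrow> (nat \<Rightarrow> int) \<Rightarrow> ('p \<times> int) \<Rightarrow>\<^sub>0 'k" where
  "ray_fun G I m = (\<Prod>f\<in>{f. (m, f) \<in> diag G \<and> \<not> trivial_mod I f}. truncate I f)"


section \<open>Gluing\<close>

definition ring_RI :: "('k::field, 'p::ab_group_add) scatter_data \<Rightarrow> 'p set \<Rightarrow> ('p \<Rightarrow>\<^sub>0 'k) set ring" where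
  "ring_RI G I = monoid_algebra (monoidP G) Quot {f. Poly_Mapping.keys f \<subseteq> I}"

definition cls_RI :: "('k::field, 'p::ab_group_add) scatter_data \<Rightarrow> 'p set \<Rightarrow> ('p \<Rightarrow>\<^sub>0 'k) \<Rightarrow> ('p \<Rightarrow>\<^sub>0 'k) set" where
  "cls_RI G I f = {f. Poly_Mapping.keys f \<subseteq> I} +>\<^bsub>monoid_algebra (monoidP G)\<^esub> f"

text \<open>
  \<open>R\<^sub>\<sigma>\<^sub>,\<^sub>I = R\<^sub>I[\<Lambda>\<^sub>\<sigma>]\<close>, the key \<open>(p, a, b)\<close> for \<open>\<sigma> = \<sigma>\<^sub>i\<^sub>,\<^sub>i\<^sub>+\<^sub>1\<close> standing for
  \<open>z\<^sup>p X\<^sup>m\<close> with \<open>m = a v\<^sub>i + b v\<^sub>i\<^sub>+\<^sub>1\<close>.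
\<close>

definition ring_sigma :: "('k::field, 'p::ab_group_add) scatter_data \<Rightarrow> 'p set \<Rightarrow>
    (('p \<times> int \<times> int) \<Rightarrow>\<^sub>0 'k) set ring" where
  "ring_sigma G I = monoid_algebra (monoidP G \<times> UNIV) Quot {f. Poly_Mapping.keys f \<subseteq> I \<times> UNIV}"

definition cls_sigma :: "('k::field, 'p::ab_group_add) scatter_data \<Rightarrow> 'p set \<Rightarrow>
    (('p \<times> int \<times> int) \<Rightarrow>\<^sub>0 'k) \<Rightarrow> (('p \<times> int \<times> int) \<Rightarrow>\<^sub>0 'k) set" where
  "cls_sigma G I f =
     {f. Poly_Mapping.keys f \<subseteq> I \<times> UNIV} +>\<^bsub>monoid_algebra (monoidP G \<times> UNIV)\<^esub> f"

text \<open>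
  In \<open>R\<^sub>\<rho>\<^sub>i\<^sub>,\<^sub>I\<close> the key \<open>(p, a, b, c)\<close> stands for \<open>z\<^sup>p X\<^sub>i\<^sub>-\<^sub>1\<^sup>a X\<^sub>i\<^sup>b X\<^sub>i\<^sub>+\<^sub>1\<^sup>c\<close>.
\<close>

definition rho_exponents :: "(int \<times> int \<times> int) set" where
  "rho_exponents = {0..} \<times> UNIV \<times> {0..}"

definition poly_rho :: "('k::field, 'p::ab_group_add) scatter_data \<Rightarrow> (('p \<times> int \<times> int \<times> int) \<Rightarrow>\<^sub>0 'k) ring" where
  "poly_rho G = monoid_algebra (monoidP G \<times> rho_exponents)"

definition ideal_rho :: "('k::field, 'p::ab_group_add) scatter_data \<Rightarrow> 'p set \<Rightarrow> nat \<Rightarrow>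
    (('p \<times> int \<times> int \<times> int) \<Rightarrow>\<^sub>0 'k) set" where
  "ideal_rho G I i = Idl\<^bsub>poly_rho G\<^esub>
     ({f. Poly_Mapping.keys f \<subseteq> I \<times> rho_exponents} \<union>
      {Poly_Mapping.single (0, 1, 0, 1) 1 -
       push (\<lambda>(p, k). (p + kappa G i, 0, k - selfint G i, 0)) (ray_fun G I (unit_vec i))})"

definition ring_rho :: "('k::field, 'p::ab_group_add) scatter_data \<Rightarrow> 'p set \<Rightarrow> nat \<Rightarrow>
    (('p \<times> int \<times> int \<times> int) \<Rightarrow>\<^sub>0 'k) set ring" where
  "ring_rho G I i = poly_rho G Quot ideal_rho G I i"

definition prv :: "nat \<Rightarrow> nat \<Rightarrow> nat" where
  "prv n i = (i + n - 1) mod n"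

definition psi_minus :: "('k::field, 'p::ab_group_add) scatter_data \<Rightarrow> 'p set \<Rightarrow> nat \<Rightarrow>
    (('p \<times> int \<times> int \<times> int) \<Rightarrow>\<^sub>0 'k) set \<Rightarrow> (('p \<times> int \<times> int) \<Rightarrow>\<^sub>0 'k) set" where
  "psi_minus G I i C = cls_sigma G I (let g = (SOME g. g \<in> C) in
     \<Sum>(p, a, b, c)\<in>Poly_Mapping.keys g.
       Poly_Mapping.single (p, a, b) (Poly_Mapping.lookup g (p, a, b, c)) *
       (push (\<lambda>(s, k). (s + kappa G i, - 1, k - selfint G i)) (ray_fun G I (unit_vec i))) ^ nat c)"

definition psi_plus :: "('k::field, 'p::ab_group_add) scatter_data \<Rightarrow> 'p set \<Rightarrow> nat \<Rightarrow>
    (('p \<times> int \<times> int \<times> int) \<Rightarrow>\<^sub>0 'k) set \<Rightarrow> (('p \<times> int \<times> int) \<Rightarrow>\<^sub>0 'k) set" where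
  "psi_plus G I i C = cls_sigma G I (let g = (SOME g. g \<in> C) in
     \<Sum>(p, a, b, c)\<in>Poly_Mapping.keys g.
       Poly_Mapping.single (p, b, c) (Poly_Mapping.lookup g (p, a, b, c)) *
       (push (\<lambda>(s, k). (s + kappa G i, k - selfint G i, - 1)) (ray_fun G I (unit_vec i))) ^ nat a)"

text \<open>
  Crossing the ray with generator \<open>m\<close> inside the cone with index \<open>i\<close>: \<open>e = 1\<close> when moving from
  \<open>\<rho>\<^sub>i\<close> towards \<open>\<rho>\<^sub>i\<^sub>+\<^sub>1\<close>, \<open>e = -1\<close> in the other direction. All walls supported on the ray
  are crossed at once (their automorphisms commute).
\<close>

definition wall_crossing :: "('k::field, 'p::ab_group_add) scatter_data \<Rightarrow> 'p set \<Rightarrow> nat \<Rightarrow> int \<Rightarrow>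
    (nat \<Rightarrow> int) \<Rightarrow> (('p \<times> int \<times> int) \<Rightarrow>\<^sub>0 'k) set \<Rightarrow> (('p \<times> int \<times> int) \<Rightarrow>\<^sub>0 'k) set" where
  "wall_crossing G I i e m C =
     (let g = (SOME g. g \<in> C); (a, b) = coords (comps G) i m in
      finsum (ring_sigma G I) (\<lambda>(p, x, y).
        cls_sigma G I (Poly_Mapping.single (p, x, y) (Poly_Mapping.lookup g (p, x, y))) \<otimes>\<^bsub>ring_sigma G I\<^esub>
        cls_sigma G I (push (\<lambda>(s, k). (s, k * a, k * b)) (ray_fun G I m)) [^]\<^bsub>ring_sigma G I\<^esub>
          (e * (b * x - a * y))) (Poly_Mapping.keys g))"

definition walls_in :: "('k::field, 'p::ab_group_add) scatter_data \<Rightarrow> 'p set \<Rightarrow> nat \<Rightarrow> (nat \<Rightarrow> int) set" where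
  "walls_in G I i = {m. re m \<in> max_cone_int (comps G) i \<and> (\<exists>f. (m, f) \<in> diag G \<and> \<not> trivial_mod I f)}"

definition sort_walls :: "('k::field, 'p::ab_group_add) scatter_data \<Rightarrow> nat \<Rightarrow> (nat \<Rightarrow> int) set \<Rightarrow> (nat \<Rightarrow> int) list" where
  "sort_walls G i W = sorted_key_list_of_set (\<lambda>m. slope (comps G) i (re m)) W"

text \<open>\<open>\<theta>\<^sub>\<gamma>\<close> for a path from \<open>Q\<close> to \<open>Q'\<close> in the interior of the cone with index \<open>i\<close>.\<close>

definition path_aut :: "('k::field, 'p::ab_group_add) scatter_data \<Rightarrow> 'p set \<Rightarrow> nat \<Rightarrow>
    (nat \<Rightarrow> real) \<Rightarrow> (nat \<Rightarrow> real) \<Rightarrow> (('p \<times> int \<times> int) \<Rightarrow>\<^sub>0 'k) set \<Rightarrow> (('p \<times> int \<times> int) \<Rightarrow>\<^sub>0 'k) set" where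
  "path_aut G I i Q Q' =
     (let sl = slope (comps G) i;
          between = (\<lambda>s t. sort_walls G i {m \<in> walls_in G I i. s < sl (re m) \<and> sl (re m) < t})
      in if sl Q \<le> sl Q' then fold (wall_crossing G I i 1) (between (sl Q) (sl Q'))
         else fold (wall_crossing G I i (- 1)) (rev (between (sl Q') (sl Q))))"

definition cone_aut :: "('k::field, 'p::ab_group_add) scatter_data \<Rightarrow> 'p set \<Rightarrow> nat \<Rightarrow>
    (('p \<times> int \<times> int) \<Rightarrow>\<^sub>0 'k) set \<Rightarrow> (('p \<times> int \<times> int) \<Rightarrow>\<^sub>0 'k) set" where
  "cone_aut G I i = fold (wall_crossing G I i 1) (sort_walls G i (walls_in G I i))"

text \<open>
  The \<open>R\<^sub>I\<close>-algebra of global functions on the glued scheme: families of functions on the affine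
  pieces that agree on the overlaps.
\<close>

definition ring_AI :: "('k::field, 'p::ab_group_add) scatter_data \<Rightarrow> 'p set \<Rightarrow>
    (('p \<Rightarrow>\<^sub>0 'k) set, nat \<Rightarrow> (('p \<times> int \<times> int \<times> int) \<Rightarrow>\<^sub>0 'k) set) module" where
  "ring_AI G I = (let n = comps G in
     \<lparr>carrier = {g \<in> (\<Pi>\<^sub>E i\<in>{..<n}. carrier (ring_rho G I i)).
        \<forall>i<n. psi_minus G I (Suc i mod n) (g (Suc i mod n)) = cone_aut G I i (psi_plus G I i (g i))},
      monoid.mult = (\<lambda>g h. \<lambda>i\<in>{..<n}. g i \<otimes>\<^bsub>ring_rho G I i\<^esub> h i),
      one = (\<lambda>i\<in>{..<n}. \<one>\<^bsub>ring_rho G I i\<^esub>),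
      ring.zero = (\<lambda>i\<in>{..<n}. \<zero>\<^bsub>ring_rho G I i\<^esub>),
      ring.add = (\<lambda>g h. \<lambda>i\<in>{..<n}. g i \<oplus>\<^bsub>ring_rho G I i\<^esub> h i),
      module.smult = (\<lambda>a g. \<lambda>i\<in>{..<n}.
        (ideal_rho G I i +>\<^bsub>poly_rho G\<^esub> push (\<lambda>p. (p, 0, 0, 0)) (SOME f. f \<in> a))
        \<otimes>\<^bsub>ring_rho G I i\<^esub> g i)\<rparr>)"


section \<open>Broken lines\<close>

text \<open>
  The domains of linearity are cut further where the line crosses a ray \<open>\<rho>\<^sub>i\<close>: a piece ends at time
  \<open>until\<close>, has its interior in the open cone with index \<open>pcone\<close>, and carries the monomial
  \<open>pcoef z\<^sup>p\<^sup>e\<^sup>x\<^sup>p X\<^sup>p\<^sup>d\<^sup>i\<^sup>r\<close> over that cone.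
\<close>

record ('k, 'p) piece =
  until :: real
  pcone :: nat
  pcoef :: 'k
  pexp :: 'p
  pdir :: "int \<times> int"

type_synonym ('k, 'p) broken = "(real \<Rightarrow> nat \<Rightarrow> real) \<times> ('k, 'p) piece list"

text \<open>
  Transport of \<open>z\<^sup>p X\<^sup>m\<close> from the cone with index \<open>i\<close> to a cone \<open>j\<close> that is equal or adjacent,
  using \<open>v\<^sub>r\<^sub>-\<^sub>1 + v\<^sub>r\<^sub>+\<^sub>1 = -D\<^sub>r\<^sup>2 v\<^sub>r\<close> for the common ray \<open>\<rho>\<^sub>r\<close>. With \<open>n\<close> positive on the cone \<open>j\<close>,
  \<open>\<langle>n, m\<rangle>\<close> is \<open>-a\<close> in the second and \<open>-b\<close> in the third case.
\<close>

definition transported :: "('k::field, 'p::ab_group_add) scatter_data \<Rightarrow>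
    nat \<Rightarrow> 'p \<Rightarrow> int \<times> int \<Rightarrow> nat \<Rightarrow> 'p \<Rightarrow> int \<times> int \<Rightarrow> bool" where
  "transported G i p m j p' m' \<longleftrightarrow> (let (a, b) = m; n = comps G in
     (j = i \<and> p' = p \<and> m' = m) \<or>
     (j = Suc i mod n \<and> p' = p - zmul (- a) (kappa G j) \<and> m' = (b - a * selfint G j, - a)) \<or>
     (i = Suc j mod n \<and> p' = p - zmul (- b) (kappa G i) \<and> m' = (- b, a - b * selfint G i)))"

text \<open>
  \<open>c z\<^sup>s X\<^sup>k\<^sup>m\<close> is a monomial term of the \<open>e\<close>-th power of the product of all functions on the ray
  with generator \<open>m\<close>, a product in the \<open>J\<close>-adic completion: its coefficient at \<open>s\<close> may be read off
  modulo any power of \<open>J\<close> not containing \<open>s\<close>.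
\<close>

definition monomial_term :: "('k::field, 'p::ab_group_add) scatter_data \<Rightarrow> (nat \<Rightarrow> int) \<Rightarrow> nat \<Rightarrow>
    'k \<Rightarrow> 'p \<Rightarrow> int \<Rightarrow> bool" where
  "monomial_term G m e c s k \<longleftrightarrow> c \<noteq> 0 \<and>
     (\<exists>N. s \<notin> ideal_power (monoidP G) (idealJ G) N \<and>
        c = Poly_Mapping.lookup (ray_fun G (ideal_power (monoidP G) (idealJ G) N) m ^ e) (s, k))"

text \<open>
  Passing at the point \<open>x\<close> from the piece \<open>L\<close> to the piece \<open>L'\<close>. The exponent \<open>\<langle>n, m\<rangle>\<close> is the
  absolute value of a determinant. Inside a cone the term \<open>1\<close> is excluded, since there is no new
  piece in this case; at a ray \<open>\<rho>\<^sub>i\<close> it means crossing without bending.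
\<close>

definition passes :: "('k::field, 'p::ab_group_add) scatter_data \<Rightarrow> (nat \<Rightarrow> real) \<Rightarrow>
    ('k, 'p) piece \<Rightarrow> ('k, 'p) piece \<Rightarrow> bool" where
  "passes G x L L' \<longleftrightarrow>
     (\<exists>m p a b c s k u v.
        m \<in> trop_int (comps G) \<and> Gcd (range m) = 1 \<and> x \<in> ray_through m \<and>
        transported G (pcone L) (pexp L) (pdir L) (pcone L') p (a, b) \<and>
        (u, v) = coords (comps G) (pcone L') m \<and> u * b - v * a \<noteq> 0 \<and>
        monomial_term G m (nat \<bar>u * b - v * a\<bar>) c s k \<and>
        (pcone L' = pcone L \<longrightarrow> (s, k) \<noteq> (0, 0)) \<and>
        pcoef L' = pcoef L * c \<and> pexp L' = p + s \<and> pdir L' = (a + k * u, b + k * v))"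

definition broken_line :: "('k::field, 'p::ab_group_add) scatter_data \<Rightarrow> (nat \<Rightarrow> int) \<Rightarrow>
    (nat \<Rightarrow> real) \<Rightarrow> ('k, 'p) broken \<Rightarrow> bool" where
  "broken_line G q Q \<beta> \<longleftrightarrow> (let (\<gamma>, ls) = \<beta>; n = comps G in
     \<gamma> \<in> extensional {..0} \<and> continuous_on {..0} \<gamma> \<and> \<gamma> ` {..0} \<subseteq> trop n - {\<lambda>_. 0} \<and> \<gamma> 0 = Q \<and>
     ls \<noteq> [] \<and> until (last ls) = 0 \<and> sorted_wrt (\<lambda>L L'. until L < until L') ls \<and>
     (\<forall>j<length ls. let L = ls ! j; i = pcone L in
        i < n \<and>
        (\<forall>t \<le> until L. (0 < j \<longrightarrow> until (ls ! (j - 1)) \<le> t) \<longrightarrow>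
           \<gamma> t \<in> max_cone n i \<and>
           \<gamma> t i = \<gamma> (until L) i + (until L - t) * fst (pdir L) \<and>
           \<gamma> t (Suc i mod n) = \<gamma> (until L) (Suc i mod n) + (until L - t) * snd (pdir L)) \<and>
        (\<forall>t < until L. (0 < j \<longrightarrow> until (ls ! (j - 1)) < t) \<longrightarrow> \<gamma> t \<in> max_cone_int n i)) \<and>
     (let L = hd ls in re q \<in> max_cone n (pcone L) \<and>
        pcoef L = 1 \<and> pexp L = 0 \<and> pdir L = coords n (pcone L) q) \<and>
     (\<forall>j. Suc j < length ls \<longrightarrow> passes G (\<gamma> (until (ls ! j))) (ls ! j) (ls ! Suc j)))"

text \<open>For \<open>q = 0\<close> there is only the constant line with monomial \<open>1\<close>.\<close>

definition broken_lines :: "('k::field, 'p::ab_group_add) scatter_data \<Rightarrow> (nat \<Rightarrow> int) \<Rightarrow>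
    (nat \<Rightarrow> real) \<Rightarrow> ('k, 'p) broken set" where
  "broken_lines G q Q = (if q = (\<lambda>_. 0)
     then {(\<lambda>t\<in>{..0}. Q, [\<lparr>until = 0, pcone = (THE i. i < comps G \<and> Q \<in> max_cone_int (comps G) i),
                           pcoef = 1, pexp = 0, pdir = (0, 0)\<rparr>])}
     else {\<beta>. broken_line G q Q \<beta>})"

definition bl_coef :: "('k::field, 'p::ab_group_add) broken \<Rightarrow> 'p \<Rightarrow>\<^sub>0 'k" where
  "bl_coef \<beta> = (let L = last (snd \<beta>) in Poly_Mapping.single (pexp L) (pcoef L))"

definition bl_dir :: "('k, 'p) broken \<Rightarrow> int \<times> int" where
  "bl_dir \<beta> = pdir (last (snd \<beta>))"

definition bl_mono :: "('k::field, 'p::ab_group_add) broken \<Rightarrow> ('p \<times> int \<times> int) \<Rightarrow>\<^sub>0 'k" where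
  "bl_mono \<beta> = (let L = last (snd \<beta>) in Poly_Mapping.single (pexp L, pdir L) (pcoef L))"

definition lift_at :: "('k::field, 'p::ab_group_add) scatter_data \<Rightarrow> 'p set \<Rightarrow> (nat \<Rightarrow> real) \<Rightarrow>
    (nat \<Rightarrow> int) \<Rightarrow> (('p \<times> int \<times> int) \<Rightarrow>\<^sub>0 'k) set" where
  "lift_at G I Q q =
     cls_sigma G I (\<Sum>\<beta>\<in>{\<beta> \<in> broken_lines G q Q. pexp (last (snd \<beta>)) \<notin> I}. bl_mono \<beta>)"


section \<open>Consistency and theta functions\<close>

text \<open>
  \<open>Q\<close> lies in the interior of the cone with index \<open>j\<close>, and its component in the complement of the
  support there has \<open>\<rho>\<^sub>i\<close> in its closure.
\<close>

definition next_to_ray :: "('k::field, 'p::ab_group_add) scatter_data \<Rightarrow> 'p set \<Rightarrow> nat \<Rightarrow> nat \<Rightarrow>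
    (nat \<Rightarrow> real) \<Rightarrow> bool" where
  "next_to_ray G I i j Q \<longleftrightarrow>
     Q \<in> irrational_points (comps G) \<and> Q \<in> max_cone_int (comps G) j \<and>
     ray_through (unit_vec i) \<subseteq>
       closure (connected_component_set (max_cone_int (comps G) j - supp G I) Q)"

definition consistent :: "('k::field, 'p::ab_group_add) scatter_data \<Rightarrow> bool" where
  "consistent G \<longleftrightarrow> (let n = comps G in
     \<forall>I. monoid_ideal (monoidP G) I \<and> monoid_radical (monoidP G) I = idealJ G \<longrightarrow>
       (\<forall>q\<in>trop_int n - {\<lambda>_. 0}. \<forall>i<n.
          (\<forall>Q Q'. Q \<in> irrational_points n \<and> Q' \<in> irrational_points n \<and>
             Q \<in> max_cone n i \<and> Q' \<in> max_cone n i \<longrightarrow>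
             lift_at G I Q' q = path_aut G I i Q Q' (lift_at G I Q q)) \<and>
          (\<forall>Qm Qp. next_to_ray G I i (prv n i) Qm \<and> next_to_ray G I i i Qp \<longrightarrow>
             (\<exists>l\<in>carrier (ring_rho G I i).
                psi_minus G I i l = lift_at G I Qm q \<and> psi_plus G I i l = lift_at G I Qp q))))"

definition lift_ray :: "('k::field, 'p::ab_group_add) scatter_data \<Rightarrow> 'p set \<Rightarrow> nat \<Rightarrow> (nat \<Rightarrow> int) \<Rightarrow>
    (('p \<times> int \<times> int \<times> int) \<Rightarrow>\<^sub>0 'k) set" where
  "lift_ray G I i q = (THE l. l \<in> carrier (ring_rho G I i) \<and>
     (\<forall>Qm Qp. next_to_ray G I i (prv (comps G) i) Qm \<and> next_to_ray G I i i Qp \<longrightarrow>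
        psi_minus G I i l = lift_at G I Qm q \<and> psi_plus G I i l = lift_at G I Qp q))"

definition theta :: "('k::field, 'p::ab_group_add) scatter_data \<Rightarrow> 'p set \<Rightarrow> (nat \<Rightarrow> int) \<Rightarrow>
    (nat \<Rightarrow> (('p \<times> int \<times> int \<times> int) \<Rightarrow>\<^sub>0 'k) set)" where
  "theta G I q = (if q = (\<lambda>_. 0) then \<one>\<^bsub>ring_AI G I\<^esub>
     else (\<lambda>i\<in>{..<comps G}. lift_ray G I i q))"

definition theta_expansion :: "('k::field, 'p::ab_group_add) scatter_data \<Rightarrow> 'p set \<Rightarrow>
    (nat \<Rightarrow> (('p \<times> int \<times> int \<times> int) \<Rightarrow>\<^sub>0 'k) set) \<Rightarrow> ((nat \<Rightarrow> int) \<Rightarrow> ('p \<Rightarrow>\<^sub>0 'k) set) \<Rightarrow> bool" where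
  "theta_expansion G I g \<alpha> \<longleftrightarrow>
     \<alpha> \<in> (trop_int (comps G) \<rightarrow>\<^sub>E carrier (ring_RI G I)) \<and>
     finite {q \<in> trop_int (comps G). \<alpha> q \<noteq> \<zero>\<^bsub>ring_RI G I\<^esub>} \<and>
     g = (\<Oplus>\<^bsub>ring_AI G I\<^esub> q\<in>{q \<in> trop_int (comps G). \<alpha> q \<noteq> \<zero>\<^bsub>ring_RI G I\<^esub>}.
            \<alpha> q \<odot>\<^bsub>ring_AI G I\<^esub> theta G I q)"

text \<open>
  Pairs of broken lines with endpoint \<open>z\<close> and total final direction \<open>m\<close>; pairs whose contribution
  vanishes in \<open>R\<^sub>I\<close> are left out, so that the index set is finite.
\<close>

definition product_pairs :: "('k::field, 'p::ab_group_add) scatter_data \<Rightarrow> 'p set \<Rightarrow>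
    (nat \<Rightarrow> int) \<Rightarrow> (nat \<Rightarrow> int) \<Rightarrow> (nat \<Rightarrow> real) \<Rightarrow> int \<times> int \<Rightarrow> (('k, 'p) broken \<times> ('k, 'p) broken) set" where
  "product_pairs G I q1 q2 z m = {(\<beta>1, \<beta>2) \<in> broken_lines G q1 z \<times> broken_lines G q2 z.
     bl_dir \<beta>1 + bl_dir \<beta>2 = m \<and> cls_RI G I (bl_coef \<beta>1 * bl_coef \<beta>2) \<noteq> \<zero>\<^bsub>ring_RI G I\<^esub>}"

end

theory Submission
  imports Defs
begin

text \<open>
The coefficient of \<open>X\<^sup>q\<close> in the lift of \<open>\<vartheta>\<^sub>q\<^sub>'\<close> at a general point \<open>z\<close> very close to \<open>q\<close> is \<open>1\<close> if \<open>q' = q\<close> and \<open>0\<close>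
otherwise: followed backwards from \<open>z\<close>, a broken line with final direction \<open>q\<close> runs parallel to the ray
through \<open>q\<close> and meets no other wall modulo \<open>I\<close>, so it is straight. Consistency identifies the restriction of
\<open>\<vartheta>\<^sub>q\<close> to the chamber of \<open>z\<close> with the lift at \<open>z\<close>, and restriction is multiplicative; hence the coefficient
of \<open>\<vartheta>\<^sub>q\<close> in any expansion of \<open>\<vartheta>\<^sub>q\<^sub>1 \<vartheta>\<^sub>q\<^sub>2\<close> is the coefficient of \<open>X\<^sup>q\<close> in the product of the two lifts at
\<open>z\<close>, which is the sum over pairs of broken lines. An expansion exists because a global function all of
whose coefficients of \<open>X\<^sup>q\<close> near \<open>q\<close> vanish is \<open>0\<close>: modulo \<open>J\<^sup>k\<^sup>+\<^sup>1\<close> an element of \<open>J\<^sup>k\<close> does not see wall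
crossings or \<open>z\<^sup>\<kappa>\<close>, so in each cone only exponents of that cone occur, and their coefficients vanish. As some
power of \<open>J\<close> lies in \<open>I\<close> (Dickson's lemma), induction on \<open>k\<close> finishes the argument.
\<close>

text \<open>The record operations \<open>truncate\<close> shadow the truncation of wall functions.\<close>

hide_const (open) piece.truncate scatter_data.truncate
hide_fact (open) piece.truncate_def scatter_data.truncate_def

text \<open>Consistency constrains lifts only through classes in quotient rings, and the definitions
  choose representatives with \<open>SOME\<close>. Everything is therefore computed on polynomials,
  with congruence modulo the polynomials with exponents in \<open>I\<close> in place of equality;
  \<open>psi_minus\<close>, \<open>psi_plus\<close> and the wall crossings get polynomial models
  that respect it. Two points shape the rest. A sum over an infinite set is \<open>0\<close>, so the
  broken lines that count modulo \<open>I\<close> must first be shown finite in number: each passage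
  adds an element of \<open>J\<close> to the exponent, which bounds the number of pieces, and,
  followed backwards from the fixed endpoint, a line meets the ray of its previous passage at a time
  determined by a linear equation. For the existence of expansions, an integral point on a ray of
  the fan lies in two cones and \<open>0\<close> lies in all of them; each point is tested in one
  cone only, and the gluing conditions carry the vanishing to the others.\<close>

abbreviation keys :: "('a \<Rightarrow>\<^sub>0 'b::zero) \<Rightarrow> 'a set" where
  "keys \<equiv> Poly_Mapping.keys"

abbreviation lookup :: "('a \<Rightarrow>\<^sub>0 'b::zero) \<Rightarrow> 'a \<Rightarrow> 'b" where
  "lookup \<equiv> Poly_Mapping.lookup"

abbreviation single :: "'a \<Rightarrow> 'b::zero \<Rightarrow> 'a \<Rightarrow>\<^sub>0 'b" where
  "single \<equiv> Poly_Mapping.single"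


section \<open>Quotients of subrings\<close>

text \<open>Subring and ideal are sets in an ambient commutative ring, so that congruences are
  memberships \<open>a - b \<in> A\<close> and calculations with representatives take place in the
  ambient ring.\<close>

locale quotient_on =
  fixes S A :: "'a::comm_ring_1 set"
  assumes S_one: "1 \<in> S"
    and S_add: "a \<in> S \<Longrightarrow> b \<in> S \<Longrightarrow> a + b \<in> S"
    and S_mult: "a \<in> S \<Longrightarrow> b \<in> S \<Longrightarrow> a * b \<in> S"
    and S_uminus: "a \<in> S \<Longrightarrow> - a \<in> S"
    and A_subset: "A \<subseteq> S"
    and A_zero: "0 \<in> A"
    and A_add: "a \<in> A \<Longrightarrow> b \<in> A \<Longrightarrow> a + b \<in> A"
    and A_mult: "a \<in> S \<Longrightarrow> b \<in> A \<Longrightarrow> a * b \<in> A"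
begin

lemma S_zero: "0 \<in> S"
  using A_zero A_subset by auto

lemma A_uminus: "a \<in> A \<Longrightarrow> - a \<in> A"
  using A_mult[of "- 1" a] S_uminus[OF S_one] by simp

lemma S_diff: "a \<in> S \<Longrightarrow> b \<in> S \<Longrightarrow> a - b \<in> S"
  using S_add[of a "- b"] S_uminus by simp

lemma A_diff: "a \<in> A \<Longrightarrow> b \<in> A \<Longrightarrow> a - b \<in> A"
  using A_add[of a "- b"] A_uminus by simp

lemma A_diff_swap: "a - b \<in> A \<Longrightarrow> b - a \<in> A"
  using A_uminus[of "a - b"] by simp

lemma A_diff_trans: "a - b \<in> A \<Longrightarrow> b - c \<in> A \<Longrightarrow> a - c \<in> A"
  using A_add[of "a - b" "b - c"] by simp

lemma S_sum: "(\<And>x. x \<in> T \<Longrightarrow> f x \<in> S) \<Longrightarrow> sum f T \<in> S"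
  by (induction T rule: infinite_finite_induct) (auto intro: S_add S_zero)

lemma S_prod: "(\<And>x. x \<in> T \<Longrightarrow> f x \<in> S) \<Longrightarrow> prod f T \<in> S"
  by (induction T rule: infinite_finite_induct) (auto intro: S_mult S_one)

lemma S_power: "a \<in> S \<Longrightarrow> a ^ k \<in> S"
  by (induction k) (auto intro: S_mult S_one)

lemma A_sum: "(\<And>x. x \<in> T \<Longrightarrow> f x \<in> A) \<Longrightarrow> sum f T \<in> A"
  by (induction T rule: infinite_finite_induct) (auto intro: A_add A_zero)

lemma A_mult_right: "a \<in> A \<Longrightarrow> b \<in> S \<Longrightarrow> a * b \<in> A"
  using A_mult[of b a] by (simp add: mult.commute)

lemma A_diff_mult:
  assumes "a - a' \<in> A" "b - b' \<in> A" "a \<in> S" "b' \<in> S"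
  shows "a * b - a' * b' \<in> A"
proof -
  have "a * b - a' * b' = a * (b - b') + (a - a') * b'"
    by (simp add: algebra_simps)
  then show ?thesis
    using assms by (simp add: A_add A_mult A_mult_right)
qed

lemma A_diff_power:
  assumes "a - b \<in> A" "a \<in> S" "b \<in> S"
  shows "a ^ k - b ^ k \<in> A"
  by (induction k) (use assms in \<open>auto intro!: A_diff_mult S_power simp: A_zero\<close>)

lemma A_diff_prod:
  assumes "\<And>x. x \<in> T \<Longrightarrow> f x - g x \<in> A" "\<And>x. x \<in> T \<Longrightarrow> f x \<in> S" "\<And>x. x \<in> T \<Longrightarrow> g x \<in> S"
  shows "prod f T - prod g T \<in> A"
  using assms
proof (induction T rule: infinite_finite_induct)
  case (insert x T)
  then show ?case by (auto intro!: A_diff_mult S_prod)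
qed (auto simp: A_zero)

lemma cring_ring_on: "cring (ring_on S)"
  by (rule cringI)
    (auto intro!: abelian_groupI comm_monoidI
      simp: ring_on_def S_add S_mult S_one S_zero algebra_simps,
     metis S_uminus add.left_inverse add.commute)

lemma ideal_ring_on: "ideal A (ring_on S)"
proof -
  interpret R: cring "ring_on S" by (rule cring_ring_on)
  have inv: "inv\<^bsub>add_monoid (ring_on S)\<^esub> a = - a" if "a \<in> A" for a
    using R.minus_equality[of "- a" a] that A_subset S_uminus
    by (auto simp: a_inv_def ring_on_def)
  show ?thesis
  proof (rule idealI)
    show "subgroup A (add_monoid (ring_on S))"
    proof
      fix x assume "x \<in> A"
      then show "inv\<^bsub>add_monoid (ring_on S)\<^esub> x \<in> A"
        by (subst inv) (auto intro: A_uminus)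
    qed (use A_subset A_zero A_add in \<open>auto simp: ring_on_def\<close>)
  qed (auto simp: R.ring_axioms, auto simp: ring_on_def A_mult A_mult_right)
qed

abbreviation Q :: "'a set ring" where
  "Q \<equiv> ring_on S Quot A"

definition cls :: "'a \<Rightarrow> 'a set" where
  "cls f = A +>\<^bsub>ring_on S\<^esub> f"

lemma cls_alt: "cls f = {a + f |a. a \<in> A}"
  by (auto simp: cls_def a_r_coset_def r_coset_def ring_on_def)

lemma cring_Q: "cring Q"
  by (rule ideal.quotient_is_cring[OF ideal_ring_on cring_ring_on])

lemma carrier_Q: "carrier Q = cls ` S"
  by (auto simp: FactRing_def A_RCOSETS_def' cls_def ring_on_def)

lemma cls_in_carrier: "f \<in> S \<Longrightarrow> cls f \<in> carrier Q"
  by (auto simp: carrier_Q)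

lemma cls_mult: "f \<in> S \<Longrightarrow> g \<in> S \<Longrightarrow> cls f \<otimes>\<^bsub>Q\<^esub> cls g = cls (f * g)"
  using ring_hom_mult[OF ideal.rcos_ring_hom[OF ideal_ring_on], of f g]
  by (simp add: cls_def ring_on_def)

lemma cls_add: "f \<in> S \<Longrightarrow> g \<in> S \<Longrightarrow> cls f \<oplus>\<^bsub>Q\<^esub> cls g = cls (f + g)"
  using ring_hom_add[OF ideal.rcos_ring_hom[OF ideal_ring_on], of f g]
  by (simp add: cls_def ring_on_def)

lemma one_Q: "\<one>\<^bsub>Q\<^esub> = cls 1"
  using ring_hom_one[OF ideal.rcos_ring_hom[OF ideal_ring_on]]
  by (simp add: cls_def ring_on_def)

lemma zero_Q: "\<zero>\<^bsub>Q\<^esub> = cls 0"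
  by (auto simp: FactRing_def cls_alt)

lemma cls_eqD: "cls f = cls g \<Longrightarrow> f - g \<in> A"
proof -
  assume "cls f = cls g"
  moreover have "f \<in> cls f"
    unfolding cls_alt using A_zero by force
  ultimately show "f - g \<in> A"
    by (auto simp: cls_alt)
qed

lemma cls_eqI:
  assumes "f - g \<in> A"
  shows "cls f = cls g"
proof -
  have *: "cls f \<subseteq> cls g" if "f - g \<in> A" for f g
  proof
    fix x assume "x \<in> cls f"
    then obtain a where "a \<in> A" "x = a + f" by (auto simp: cls_alt)
    then have "x = (a + (f - g)) + g" "a + (f - g) \<in> A"
      using that A_add by auto
    then show "x \<in> cls g" unfolding cls_alt by blast
  qed
  show ?thesis using *[OF assms] *[OF A_diff_swap[OF assms]] by blast
qed

lemma cls_eq_iff: "cls f = cls g \<longleftrightarrow> f - g \<in> A"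
  using cls_eqD cls_eqI by blast

lemma cls_eq_zero_iff: "cls f = \<zero>\<^bsub>Q\<^esub> \<longleftrightarrow> f \<in> A"
  by (simp add: zero_Q cls_eq_iff)

text \<open>\<open>psi_minus\<close>, \<open>psi_plus\<close>, \<open>wall_crossing\<close> and the
  scalar action pick a representative with \<open>SOME\<close>. The pick is harmless for additive
  maps that send \<open>A\<close> into the target ideal, since it differs from any given
  representative by an element of \<open>A\<close>.\<close>

lemma some_rep:
  assumes "f \<in> S"
  shows "(SOME g. g \<in> cls f) \<in> S" "(SOME g. g \<in> cls f) - f \<in> A"
proof -
  have "f \<in> cls f" unfolding cls_alt using A_zero by force
  then have "(SOME g. g \<in> cls f) \<in> cls f" by (rule someI)
  then obtain a where "a \<in> A" "(SOME g. g \<in> cls f) = a + f"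
    by (auto simp: cls_alt)
  then show "(SOME g. g \<in> cls f) \<in> S" "(SOME g. g \<in> cls f) - f \<in> A"
    using assms A_subset S_add by auto
qed

lemma cls_some_rep: "C \<in> carrier Q \<Longrightarrow> cls (SOME g. g \<in> C) = C"
  using some_rep cls_eqI by (fastforce simp: carrier_Q)

lemma finsum_cls:
  assumes "finite T" "\<And>x. x \<in> T \<Longrightarrow> f x \<in> S"
  shows "finsum Q (\<lambda>x. cls (f x)) T = cls (sum f T)"
proof -
  interpret Q: cring Q by (rule cring_Q)
  show ?thesis
    using assms
  proof (induction T rule: finite_induct)
    case empty
    then show ?case by (simp add: zero_Q)
  next
    case (insert x T)
    then show ?case
      by (subst Q.finsum_insert) (use S_sum[of T f] in \<open>auto intro!: cls_in_carrier simp: cls_add\<close>)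
  qed
qed

lemma cls_pow: "f \<in> S \<Longrightarrow> cls f [^]\<^bsub>Q\<^esub> (k::nat) = cls (f ^ k)"
proof -
  assume f: "f \<in> S"
  interpret Q: cring Q by (rule cring_Q)
  show ?thesis
    by (induction k) (use f in \<open>auto simp: one_Q cls_mult S_power mult.commute\<close>)
qed

text \<open>A wall function has negative powers only in the quotient, where \<open>g\<close>
  represents the inverse of \<open>f\<close>; the powers of \<open>f * g\<close> stay congruent to
  \<open>1\<close>.\<close>

lemma cls_int_pow:
  assumes "f \<in> S" "g \<in> S" "f * g - 1 \<in> A"
  shows "cls f [^]\<^bsub>Q\<^esub> (e::int) = cls (if 0 \<le> e then f ^ nat e else g ^ nat (- e))"
proof -
  interpret Q: cring Q by (rule cring_Q)
  have fg: "cls f \<otimes>\<^bsub>Q\<^esub> cls g = \<one>\<^bsub>Q\<^esub>"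
    using assms by (simp add: cls_mult one_Q cls_eq_iff)
  show ?thesis
  proof (cases "0 \<le> e")
    case True
    then have "\<not> e < 0" by simp
    then show ?thesis
      unfolding int_pow_def2 cls_pow[OF assms(1)] using True by (simp only: if_True if_False)
  next
    case False
    have "(f * g) ^ k - 1 ^ k \<in> A" for k
      by (rule A_diff_power[OF assms(3) S_mult[OF assms(1,2)] S_one])
    then have k: "f ^ k * g ^ k - 1 \<in> A" for k
      by (simp only: power_mult_distrib power_one)
    have "inv\<^bsub>Q\<^esub> (cls (f ^ nat (- e))) = cls (g ^ nat (- e))"
    proof (rule Q.comm_inv_char)
      show "cls (f ^ nat (- e)) \<otimes>\<^bsub>Q\<^esub> cls (g ^ nat (- e)) = \<one>\<^bsub>Q\<^esub>"
        unfolding cls_mult[OF S_power[OF assms(1)] S_power[OF assms(2)]] one_Q cls_eq_iff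
        by (rule k)
    qed (intro cls_in_carrier S_power assms)+
    moreover have "e < 0" using False by simp
    ultimately show ?thesis
      unfolding int_pow_def2 cls_pow[OF assms(1)] using False by (simp only: if_True if_False)
  qed
qed

end


section \<open>Linear extension of maps on exponents\<close>

text \<open>The scalar enters as a constant polynomial, so that the value is a sum of ring products
  and ideal membership passes through it.\<close>

definition lext :: "('a \<Rightarrow> ('b::comm_monoid_add \<Rightarrow>\<^sub>0 'k::comm_ring_1)) \<Rightarrow> ('a \<Rightarrow>\<^sub>0 'k) \<Rightarrow> ('b \<Rightarrow>\<^sub>0 'k)" where
  "lext h f = (\<Sum>x\<in>keys f. h x * single 0 (lookup f x))"

lemma lext_superset:
  assumes "finite T" "keys f \<subseteq> T"
  shows "lext h f = (\<Sum>x\<in>T. h x * single 0 (lookup f x))"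
  unfolding lext_def using assms
  by (intro sum.mono_neutral_left) (auto simp: in_keys_iff)

lemma lext_zero [simp]: "lext h 0 = 0"
  by (simp add: lext_def)

lemma lext_single [simp]: "lext h (single x c) = h x * single 0 c"
  by (simp add: lext_def)

lemma lext_add: "lext h (f + g) = lext h f + lext h g"
proof -
  let ?T = "keys f \<union> keys g"
  have "keys (f + g) \<subseteq> ?T" by (rule Poly_Mapping.keys_add)
  then show ?thesis
    by (simp add: lext_superset[of ?T] lookup_add single_add algebra_simps sum.distrib)
qed

lemma lext_uminus: "lext h (- f) = - lext h f"
  by (metis add_eq_0_iff lext_add lext_zero)

lemma lext_diff: "lext h (f - g) = lext h f - lext h g"
  using lext_add[of h f "- g"] by (simp add: lext_uminus)

lemma lext_sum: "lext h (sum f T) = (\<Sum>x\<in>T. lext h (f x))"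
  by (induction T rule: infinite_finite_induct) (auto simp: lext_add)

lemma sum_single_lookup: "(\<Sum>x\<in>keys f. single x (lookup f x)) = f"
  by (rule poly_mapping_eqI)
    (auto simp: lookup_sum lookup_single when_def in_keys_iff sum.delta)

lemma single_mult_zero: "single x 1 * single 0 c = single (x::'a::comm_monoid_add) (c::'k::comm_ring_1)"
  by (simp add: mult_single)

lemma push_lext: "push \<phi> f = lext (\<lambda>x. single (\<phi> x) 1) f"
  for \<phi> :: "'a \<Rightarrow> 'b::comm_monoid_add" and f :: "'a \<Rightarrow>\<^sub>0 'k::comm_ring_1"
  by (simp add: push_def lext_def single_mult_zero)

lemma keys_lext: "keys (lext h f) \<subseteq> (\<Union>x\<in>keys f. keys (h x))"
proof -
  have "keys (lext h f) \<subseteq> (\<Union>x\<in>keys f. keys (h x * single 0 (lookup f x)))"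
    unfolding lext_def by (rule keys_sum)
  also have "\<dots> \<subseteq> (\<Union>x\<in>keys f. keys (h x))"
  proof -
    have "keys (h x * single 0 (lookup f x)) \<subseteq> keys (h x)" for x
      using keys_mult[of "h x" "single 0 (lookup f x)"] by (auto split: if_splits)
    then show ?thesis by blast
  qed
  finally show ?thesis .
qed

context
  fixes \<phi> :: "'a \<Rightarrow> 'b::comm_monoid_add"
begin

lemma keys_push: "keys (push \<phi> f) \<subseteq> \<phi> ` keys f" for f :: "'a \<Rightarrow>\<^sub>0 'k::comm_ring_1"
  unfolding push_lext using keys_lext[of "\<lambda>x. single (\<phi> x) 1" f] by (auto split: if_splits)

lemma push_single [simp]: "push \<phi> (single x c) = single (\<phi> x) (c :: 'k::comm_ring_1)"
  by (simp add: push_lext mult_single)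

lemma push_diff: "push \<phi> (f - g) = push \<phi> f - push \<phi> g" for f g :: "'a \<Rightarrow>\<^sub>0 'k::comm_ring_1"
  by (simp add: push_lext lext_diff)

end

lemma times_sum_single:
  "f * g = (\<Sum>x\<in>keys f. \<Sum>y\<in>keys g. single (x + y) (lookup f x * lookup g y))"
proof -
  have "f * g = (\<Sum>x\<in>keys f. single x (lookup f x)) * (\<Sum>y\<in>keys g. single y (lookup g y))"
    by (simp add: sum_single_lookup)
  then show ?thesis by (simp add: sum_product mult_single)
qed


locale pm_quotient = quotient_on S A
  for S A :: "('b::comm_monoid_add \<Rightarrow>\<^sub>0 'k::comm_ring_1) set" +
  assumes S_const: "single 0 c \<in> S"
begin

lemma lext_in_A:
  assumes "\<And>x. x \<in> keys f \<Longrightarrow> h x \<in> A"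
  shows "lext h f \<in> A"
  unfolding lext_def using assms by (intro A_sum A_mult_right S_const)

text \<open>Both sides expand into double sums over pairs of exponents, and the summands differ by
  multiples of \<open>h (x + y) - h x * h y\<close>. The set \<open>X\<close> restricts this
  requirement to a region containing the exponents that occur.\<close>

lemma lext_mult:
  assumes X: "keys f \<subseteq> X" "keys g \<subseteq> X"
    and h: "\<And>x y. x \<in> X \<Longrightarrow> y \<in> X \<Longrightarrow> h (x + y) - h x * h y \<in> A"
  shows "lext h (f * g) - lext h f * lext h g \<in> A"
proof -
  have "lext h (f * g) = (\<Sum>x\<in>keys f. \<Sum>y\<in>keys g. h (x + y) * single 0 (lookup f x * lookup g y))"
    by (simp add: times_sum_single[of f g] lext_sum)
  also have "\<dots> - lext h f * lext h g =
      (\<Sum>x\<in>keys f. \<Sum>y\<in>keys g. (h (x + y) - h x * h y) * single 0 (lookup f x * lookup g y))"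
  proof -
    have "single (0::'b) (a * b) = single 0 a * single 0 b" for a b :: 'k
      by (simp add: mult_single)
    then show ?thesis
      unfolding lext_def sum_product sum_subtractf[symmetric]
      by (intro sum.cong refl) (simp add: algebra_simps)
  qed
  also have "\<dots> \<in> A"
    using X by (intro A_sum A_mult_right h S_const) auto
  finally show ?thesis .
qed

end


section \<open>Monomial ideals of monoid algebras\<close>

lemma keys_diff_subset: "keys (f - g) \<subseteq> keys f \<union> keys (g :: 'a \<Rightarrow>\<^sub>0 'k::ab_group_add)"
  by (auto simp: in_keys_iff lookup_minus)

lemma keys_uminus [simp]: "keys (- f) = keys (f :: 'a \<Rightarrow>\<^sub>0 'k::ab_group_add)"
  by (auto simp: in_keys_iff)

text \<open>Polynomials with exponents in a submonoid, modulo those with exponents in an ideal of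
  it: one pattern for R_I, the rings of maximal cones and the wall functions. The argument
  \<open>ty\<close> fixes the coefficient type, which \<open>M\<close> and \<open>K\<close> do not
  determine.\<close>

locale monoid_pair =
  fixes M K :: "'m::comm_monoid_add set"
    and ty :: "'k::comm_ring_1 itself"
  assumes M_zero: "0 \<in> M"
    and M_add: "a \<in> M \<Longrightarrow> b \<in> M \<Longrightarrow> a + b \<in> M"
    and K_subset: "K \<subseteq> M"
    and K_add: "a \<in> M \<Longrightarrow> b \<in> K \<Longrightarrow> a + b \<in> K"
begin

sublocale pm_quotient "{f :: 'm \<Rightarrow>\<^sub>0 'k. keys f \<subseteq> M}" "{f :: 'm \<Rightarrow>\<^sub>0 'k. keys f \<subseteq> K}"
proof
  fix a b :: "'m \<Rightarrow>\<^sub>0 'k"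
  show "a \<in> {f. keys f \<subseteq> M} \<Longrightarrow> b \<in> {f. keys f \<subseteq> M} \<Longrightarrow> a + b \<in> {f. keys f \<subseteq> M}"
    "a \<in> {f. keys f \<subseteq> K} \<Longrightarrow> b \<in> {f. keys f \<subseteq> K} \<Longrightarrow> a + b \<in> {f. keys f \<subseteq> K}"
    using Poly_Mapping.keys_add[of a b] by auto
  have ex: "\<exists>u v. u \<in> keys a \<and> v \<in> keys b \<and> x = u + v" if "x \<in> keys (a * b)" for x
    using keys_mult[of a b] that by blast
  show "a \<in> {f. keys f \<subseteq> M} \<Longrightarrow> b \<in> {f. keys f \<subseteq> M} \<Longrightarrow> a * b \<in> {f. keys f \<subseteq> M}"
  proof (intro CollectI subsetI)
    fix x assume "a \<in> {f. keys f \<subseteq> M}" "b \<in> {f. keys f \<subseteq> M}" "x \<in> keys (a * b)"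
    then show "x \<in> M" using ex[of x] M_add by blast
  qed
  show "a \<in> {f. keys f \<subseteq> M} \<Longrightarrow> b \<in> {f. keys f \<subseteq> K} \<Longrightarrow> a * b \<in> {f. keys f \<subseteq> K}"
  proof (intro CollectI subsetI)
    fix x assume "a \<in> {f. keys f \<subseteq> M}" "b \<in> {f. keys f \<subseteq> K}" "x \<in> keys (a * b)"
    then show "x \<in> K" using ex[of x] K_add by blast
  qed
qed (use M_zero K_subset in \<open>auto split: if_splits\<close>)

end

lemma lookup_eq_if_keys_diff:
  "keys (f - g) \<subseteq> K \<Longrightarrow> x \<notin> K \<Longrightarrow> lookup f x = lookup (g :: 'a \<Rightarrow>\<^sub>0 'k::ab_group_add) x"
  by (metis eq_iff_diff_eq_0 in_keys_iff lookup_minus subsetD)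

lemma keys_diff_subsetI:
  "(\<And>x. x \<notin> K \<Longrightarrow> lookup f x = lookup g x) \<Longrightarrow> keys (f - g) \<subseteq> K"
  for f g :: "'a \<Rightarrow>\<^sub>0 'k::ab_group_add"
  by (force simp: in_keys_iff lookup_minus)


section \<open>Toric monoids\<close>

lemma zmul_of_nat: "zmul (int k) p = ((+) p ^^ k) 0"
  by (simp add: zmul_def)

lemma zmul_uminus_of_nat: "zmul (- int k) p = - (((+) p ^^ k) 0)"
  by (cases "k = 0") (auto simp: zmul_def)

text \<open>Dickson's lemma for sequences: subsequences are extracted one coordinate at a time, and
  a monotone sequence of naturals is nondecreasing from some place on.\<close>

lemma dickson:
  fixes l :: "nat \<Rightarrow> 'l \<Rightarrow> nat"
  assumes "finite L"
  shows "\<exists>r::nat \<Rightarrow> nat. strict_mono r \<and> (\<forall>x\<in>L. \<forall>i j. i \<le> j \<longrightarrow> l (r i) x \<le> l (r j) x)"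
  using assms
proof (induction L rule: finite_induct)
  case empty
  have "strict_mono (id :: nat \<Rightarrow> nat)" by (simp add: strict_mono_def)
  then show ?case by blast
next
  case (insert x L)
  then obtain r :: "nat \<Rightarrow> nat" where r: "strict_mono r" "\<forall>y\<in>L. \<forall>i j. i \<le> j \<longrightarrow> l (r i) y \<le> l (r j) y"
    by blast
  obtain s :: "nat \<Rightarrow> nat" where s: "strict_mono s" "monoseq (\<lambda>n. l (r (s n)) x)"
    using seq_monosub[of "\<lambda>n. l (r n) x"] by auto
  \<comment> \<open>A nonincreasing sequence is constant once it attains its minimum
    \<open>m\<close>.\<close>
  have "\<exists>k. \<forall>i j. i \<le> j \<longrightarrow> l (r (s (k + i))) x \<le> l (r (s (k + j))) x"
  proof -
    define m where "m = (LEAST v. \<exists>k. v = l (r (s k)) x)"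
    have "\<exists>k. m = l (r (s k)) x"
      unfolding m_def by (rule LeastI) blast
    then obtain k where k: "m = l (r (s k)) x" by blast
    have min: "m \<le> l (r (s i)) x" for i
      unfolding m_def by (rule Least_le) blast
    from s(2) show ?thesis
      unfolding monoseq_def
    proof
      assume "\<forall>i j. i \<le> j \<longrightarrow> l (r (s j)) x \<le> l (r (s i)) x"
      then have "l (r (s (k + i))) x = m" for i
        using min[of "k + i"] k by (simp add: le_antisym)
      then have "\<forall>i j. i \<le> j \<longrightarrow> l (r (s (k + i))) x \<le> l (r (s (k + j))) x" by simp
      then show ?thesis by blast
    qed (auto intro!: exI[of _ 0])
  qed
  then obtain k where k: "\<forall>i j. i \<le> j \<longrightarrow> l (r (s (k + i))) x \<le> l (r (s (k + j))) x" by blast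
  show ?case
  proof (intro exI conjI)
    show "strict_mono (\<lambda>i. r (s (k + i)))"
      using r(1) s(1) by (auto simp: strict_mono_def)
    show "\<forall>y\<in>insert x L. \<forall>i j. i \<le> j \<longrightarrow> l (r (s (k + i))) y \<le> l (r (s (k + j))) y"
      using k r(2) s(1) by (auto simp: strict_mono_less_eq)
  qed
qed

locale toric =
  fixes P :: "'p::ab_group_add set"
  assumes toric: "toric_monoid P"
begin

lemma half_spaces:
  obtains L :: "('p \<Rightarrow> int) set" where "finite L" "\<And>l a b. l \<in> L \<Longrightarrow> l (a + b) = l a + l b"
    "\<And>p. p \<in> P \<longleftrightarrow> (\<forall>l\<in>L. 0 \<le> l p)"
  using toric unfolding toric_monoid_def by blast

lemma P_zero: "0 \<in> P"
proof -
  obtain L :: "('p \<Rightarrow> int) set" where L: "\<And>l a b. l \<in> L \<Longrightarrow> l (a + b) = l a + l b"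
    "\<And>p. p \<in> P \<longleftrightarrow> (\<forall>l\<in>L. 0 \<le> l p)"
    by (rule half_spaces) blast
  have "0 \<le> l 0" if "l \<in> L" for l
    using L(1)[OF that, of 0 0] by simp
  then show ?thesis unfolding L(2) by blast
qed

lemma P_add: "a \<in> P \<Longrightarrow> b \<in> P \<Longrightarrow> a + b \<in> P"
proof -
  assume ab: "a \<in> P" "b \<in> P"
  obtain L :: "('p \<Rightarrow> int) set" where L: "\<And>l a b. l \<in> L \<Longrightarrow> l (a + b) = l a + l b"
    "\<And>p. p \<in> P \<longleftrightarrow> (\<forall>l\<in>L. 0 \<le> l p)"
    by (rule half_spaces) blast
  show ?thesis
    using ab L(1) unfolding L(2) by (metis add_nonneg_nonneg)
qed

lemma P_funpow: "a \<in> P \<Longrightarrow> ((+) a ^^ k) 0 \<in> P"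
  by (induction k) (auto intro: P_zero P_add)

text \<open>On \<open>P\<close> the defining half-space functionals take nonnegative integral
  values, so Dickson's lemma yields two terms along which all of them increase weakly; then the
  difference satisfies all inequalities of \<open>P\<close>.\<close>

lemma seq_has_ascent:
  fixes p :: "nat \<Rightarrow> 'p"
  assumes "\<And>i. p i \<in> P"
  shows "\<exists>i j. i < j \<and> p j - p i \<in> P"
proof -
  obtain L :: "('p \<Rightarrow> int) set" where L: "finite L" "\<And>l a b. l \<in> L \<Longrightarrow> l (a + b) = l a + l b"
    "\<And>p. p \<in> P \<longleftrightarrow> (\<forall>l\<in>L. 0 \<le> l p)"
    by (rule half_spaces) blast
  have diff: "l (a - b) = l a - l b" if "l \<in> L" for l a b
    using L(2)[OF that, of "a - b" b] by simp
  obtain r :: "nat \<Rightarrow> nat" where r: "strict_mono r"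
    "\<forall>l\<in>L. \<forall>i j. i \<le> j \<longrightarrow> nat (l (p (r i))) \<le> nat (l (p (r j)))"
    using dickson[OF L(1), of "\<lambda>i l. nat (l (p i))"] by blast
  have "p (r 1) - p (r 0) \<in> P"
    unfolding L(3)
  proof (intro ballI)
    fix l assume l: "l \<in> L"
    then have "nat (l (p (r 0))) \<le> nat (l (p (r 1)))" using r(2) by simp
    moreover have "0 \<le> l (p (r 1))" using assms[of "r 1"] l L(3) by blast
    ultimately show "0 \<le> l (p (r 1) - p (r 0))" by (simp add: diff[OF l])
  qed
  moreover have "r 0 < r 1" using r(1) by (simp add: strict_mono_def)
  ultimately show ?thesis by blast
qed

text \<open>Otherwise elements of \<open>K\<close> could be chosen one after the other, each outside
  \<open>f + P\<close> for all earlier choices \<open>f\<close>, and this sequence would have no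
  ascent.\<close>

lemma monoid_ideal_finitely_generated:
  assumes "monoid_ideal P K"
  shows "\<exists>F. finite F \<and> F \<subseteq> K \<and> (\<forall>a\<in>K. \<exists>f\<in>F. a - f \<in> P)"
proof (rule ccontr)
  assume contr: "\<not> ?thesis"
  define c where "c F = (SOME a. a \<in> K \<and> (\<forall>f\<in>F. a - f \<notin> P))" for F
  have c: "c F \<in> K \<and> (\<forall>f\<in>F. c F - f \<notin> P)" if "finite F" "F \<subseteq> K" for F
  proof -
    have "\<not> (\<forall>a\<in>K. \<exists>f\<in>F. a - f \<in> P)"
      using contr that by (simp only: not_ex) blast
    then have "\<exists>a. a \<in> K \<and> (\<forall>f\<in>F. a - f \<notin> P)" by blast
    then show ?thesis unfolding c_def by (rule someI_ex)
  qed
  \<comment> \<open>\<open>E i\<close> holds the first \<open>i\<close> choices.\<close>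
  define E where "E = rec_nat {} (\<lambda>_ F. insert (c F) F)"
  have E: "E 0 = {}" "E (Suc i) = insert (c (E i)) (E i)" for i
    by (auto simp: E_def)
  have EK: "finite (E i) \<and> E i \<subseteq> K" for i
    by (induction i) (use c in \<open>auto simp: E\<close>)
  have mono: "c (E i) \<in> E j" if "i < j" for i j
    using that by (induction j) (auto simp: E less_Suc_eq)
  have "c (E i) \<in> P" for i
    using c[of "E i"] EK[of i] assms unfolding monoid_ideal_def by blast
  then obtain i j where "i < j" "c (E j) - c (E i) \<in> P"
    using seq_has_ascent[of "\<lambda>i. c (E i)"] by blast
  then show False
    using c[of "E j"] EK[of j] mono[of i j] by blast
qed

lemma ideal_power_ideal:
  assumes "monoid_ideal P J"
  shows "monoid_ideal P (ideal_power P J k)"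
proof (induction k)
  case 0
  then show ?case by (auto simp: monoid_ideal_def P_add)
next
  case (Suc k)
  show ?case
    unfolding monoid_ideal_def
  proof (intro conjI ballI subsetI)
    fix x assume "x \<in> ideal_power P J (Suc k)"
    then show "x \<in> P" using assms Suc by (auto simp: monoid_ideal_def intro!: P_add)
  next
    fix p x assume p: "p \<in> P" and "x \<in> ideal_power P J (Suc k)"
    then obtain a b where "x = a + b" "a \<in> J" "b \<in> ideal_power P J k" by auto
    then have "p + x = (p + a) + b" "p + a \<in> J"
      using assms p by (auto simp: monoid_ideal_def add.assoc)
    then show "p + x \<in> ideal_power P J (Suc k)"
      using \<open>b \<in> _\<close> unfolding ideal_power.simps by blast
  qed
qed

lemma ideal_power_Suc_subset:
  assumes "monoid_ideal P J"
  shows "ideal_power P J (Suc k) \<subseteq> ideal_power P J k"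
  using ideal_power_ideal[OF assms, of k] assms by (auto simp: monoid_ideal_def)

lemma ideal_power_antimono:
  assumes "monoid_ideal P J" "k \<le> k'"
  shows "ideal_power P J k' \<subseteq> ideal_power P J k"
  using assms(2) by (induction rule: dec_induct) (use ideal_power_Suc_subset[OF assms(1)] in blast)+

text \<open>A product of more than \<open>\<Sum>f\<in>F. c f\<close> elements of \<open>J\<close> involves some generator \<open>f\<close> at least
  \<open>c f\<close> times.\<close>

lemma ideal_power_subset:
  assumes "monoid_ideal P J" "monoid_ideal P I" "monoid_radical P I = J"
  shows "\<exists>k. ideal_power P J k \<subseteq> I"
proof -
  obtain F where F: "finite F" "F \<subseteq> J" "\<forall>a\<in>J. \<exists>f\<in>F. a - f \<in> P"
    using monoid_ideal_finitely_generated[OF assms(1)] by blast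
  have "\<exists>k. ((+) f ^^ k) 0 \<in> I" if "f \<in> F" for f
    using F(2) that assms(3) by (auto simp: monoid_radical_def zmul_of_nat)
  then obtain c where c: "\<And>f. f \<in> F \<Longrightarrow> ((+) f ^^ c f) 0 \<in> I" by metis
  \<comment> \<open>Each factor from \<open>J\<close> is a generator plus an element of
    \<open>P\<close>; \<open>e f\<close> counts how often the generator \<open>f\<close> is
    used.\<close>
  have exp: "\<exists>e p. p \<in> P \<and> x = p + (\<Sum>f\<in>F. ((+) f ^^ e f) 0) \<and> (\<Sum>f\<in>F. e f) = k"
    if "x \<in> ideal_power P J k" for x k
    using that
  proof (induction k arbitrary: x)
    case 0
    then show ?case by (intro exI[of _ "\<lambda>_. 0"] exI[of _ x]) auto
  next
    case (Suc k)
    then obtain a b where ab: "x = a + b" "a \<in> J" "b \<in> ideal_power P J k" by auto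
    obtain g where g: "g \<in> F" "a - g \<in> P" using F(3) ab(2) by blast
    obtain e p where e: "p \<in> P" "b = p + (\<Sum>f\<in>F. ((+) f ^^ e f) 0)" "(\<Sum>f\<in>F. e f) = k"
      using Suc.IH[OF ab(3)] by blast
    let ?e = "e(g := Suc (e g))"
    have *: "(\<Sum>f\<in>F. ((+) f ^^ ?e f) 0) = g + (\<Sum>f\<in>F. ((+) f ^^ e f) 0)"
      using F(1) g(1) by (simp add: sum.remove[of F g] add.assoc)
    have "(\<Sum>f\<in>F. ?e f) = Suc k"
      using F(1) g(1) e(3) by (simp add: sum.remove[of F g])
    moreover have "x = ((a - g) + p) + (\<Sum>f\<in>F. ((+) f ^^ ?e f) 0)"
      unfolding * ab(1) e(2) by (simp add: algebra_simps)
    ultimately show ?case using g(2) e(1) P_add by blast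
  qed
  have "ideal_power P J (Suc (\<Sum>f\<in>F. c f)) \<subseteq> I"
  proof
    fix x assume "x \<in> ideal_power P J (Suc (\<Sum>f\<in>F. c f))"
    then obtain e p where e: "p \<in> P" "x = p + (\<Sum>f\<in>F. ((+) f ^^ e f) 0)" "(\<Sum>f\<in>F. e f) = Suc (\<Sum>f\<in>F. c f)"
      using exp by blast
    obtain g where g: "g \<in> F" "c g \<le> e g"
    proof (rule ccontr)
      assume "\<not> thesis"
      then have "\<forall>f\<in>F. e f \<le> c f" using that by force
      then have "(\<Sum>f\<in>F. e f) \<le> (\<Sum>f\<in>F. c f)" by (intro sum_mono) auto
      then show False using e(3) by simp
    qed
    have FP: "f \<in> P" if "f \<in> F" for f
      using F(2) assms(1) that by (auto simp: monoid_ideal_def)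
    have split: "((+) g ^^ e g) 0 = ((+) g ^^ (e g - c g)) 0 + ((+) g ^^ c g) 0"
    proof -
      have "((+) g ^^ (a + b)) 0 = ((+) g ^^ a) 0 + ((+) g ^^ b) 0" for a b :: nat
        by (induction a) (auto simp: add.assoc)
      from this[of "e g - c g" "c g"] show ?thesis using g(2) by simp
    qed
    have "x = (p + ((\<Sum>f\<in>F - {g}. ((+) f ^^ e f) 0) + ((+) g ^^ (e g - c g)) 0)) + ((+) g ^^ c g) 0"
      unfolding e(2) sum.remove[OF F(1) g(1)] split by (simp add: algebra_simps)
    moreover have "(\<Sum>f\<in>T. ((+) f ^^ e f) 0) \<in> P" if "T \<subseteq> F" for T
      using that FP by (induction T rule: infinite_finite_induct) (auto intro!: P_add P_zero P_funpow)
    ultimately have "\<exists>y\<in>P. x = y + ((+) g ^^ c g) 0"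
      using P_add[OF e(1)] P_add[OF _ P_funpow[OF FP[OF g(1)]]] by blast
    then show "x \<in> I"
      using assms(2) c[OF g(1)] unfolding monoid_ideal_def by blast
  qed
  then show ?thesis by blast
qed

end


section \<open>Coefficients and supports under linear extension\<close>

lemma lookup_times_const: "lookup (f * single 0 c) x = lookup f x * c"
  for f :: "'b::comm_monoid_add \<Rightarrow>\<^sub>0 'k::comm_ring_1"
proof -
  have "f * single 0 c = Poly_Mapping.map ((*) c) f"
    by (simp add: mult_map_scale_conv_mult mult.commute)
  then show ?thesis
    by (simp add: Poly_Mapping.map.rep_eq when_def mult.commute)
qed

lemma lookup_lext: "lookup (lext h f) y = (\<Sum>x\<in>keys f. lookup (h x) y * lookup f x)"
  by (simp add: lext_def lookup_sum lookup_times_const)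

lemma lext_push: "lext h (push \<phi> f) = lext (\<lambda>x. h (\<phi> x)) f"
  for f :: "'a \<Rightarrow>\<^sub>0 'k::comm_ring_1" and \<phi> :: "'a \<Rightarrow> 'b::comm_monoid_add"
  by (simp add: push_lext lext_def[of "\<lambda>x. single (\<phi> x) 1"] lext_sum single_mult_zero)
    (simp add: lext_def)

lemma single_times_push: "single x 1 * push \<phi> f = push (\<lambda>y. x + \<phi> y) f"
  for f :: "'a \<Rightarrow>\<^sub>0 'k::comm_ring_1" and \<phi> :: "'a \<Rightarrow> 'b::comm_monoid_add"
  by (simp add: push_def sum_distrib_left mult_single)

lemma keys_mult_subset:
  assumes "\<And>x y. x \<in> keys f \<Longrightarrow> y \<in> keys g \<Longrightarrow> x + y \<in> T"
  shows "keys (f * g) \<subseteq> T"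
  using keys_mult[of f g] assms by blast

lemma keys_push_subset:
  fixes \<phi> :: "'a \<Rightarrow> 'b::comm_monoid_add" and f :: "'a \<Rightarrow>\<^sub>0 'k::comm_ring_1"
  assumes "\<And>x. x \<in> keys f \<Longrightarrow> \<phi> x \<in> T"
  shows "keys (push \<phi> f) \<subseteq> T"
  using keys_push[of \<phi> f] assms by blast

lemma keys_single_times:
  fixes f :: "'b::comm_monoid_add \<Rightarrow>\<^sub>0 'k::comm_ring_1"
  assumes "y \<in> keys (single x 1 * f)"
  shows "\<exists>u\<in>keys f. y = x + u"
proof -
  obtain v u where "v \<in> keys (single x (1::'k))" "u \<in> keys f" "y = v + u"
    using subsetD[OF keys_mult assms] by blast
  then show ?thesis by (auto split: if_splits)
qed

lemma single_zero3: "single (0, 0, 0) 1 = (1 :: 'a::monoid_add \<times> 'b::monoid_add \<times> 'c::monoid_add \<Rightarrow>\<^sub>0 'k::comm_ring_1)"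
  by (metis single_one zero_prod_def)

lemma single_zero4:
  "single (0, 0, 0, 0) 1 = (1 :: 'a::monoid_add \<times> 'b::monoid_add \<times> 'c::monoid_add \<times> 'd::monoid_add \<Rightarrow>\<^sub>0 'k::comm_ring_1)"
  by (metis single_one zero_prod_def)

text \<open>For a key that is injective only on \<open>S\<close>: the slope is such a key on the
  walls inside one cone.\<close>

lemma (in linorder) set_sorted_key_list_of_set_inj:
  assumes "inj_on f S" "W \<subseteq> S" "finite W"
  shows "set (sorted_key_list_of_set f W) = W"
proof -
  interpret folding_insort_key less_eq less S f
    by unfold_locales (rule assms)
  show ?thesis by (rule set_sorted_key_list_of_set[OF assms(2,3)])
qed

section \<open>Integer powers modulo an ideal\<close>

context quotient_on
begin

lemma inverse_power_cancel:
  assumes "f \<in> S" "g \<in> S" "f * g - 1 \<in> A"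
  shows "f ^ (c + b) * g ^ b - f ^ c \<in> A"
proof -
  have "f ^ (c + b) * g ^ b - f ^ c = f ^ c * ((f * g) ^ b - 1 ^ b)"
    by (simp add: power_add power_mult_distrib algebra_simps)
  moreover have "(f * g) ^ b - 1 ^ b \<in> A"
    by (rule A_diff_power[OF assms(3) S_mult[OF assms(1,2)] S_one])
  ultimately show ?thesis
    using A_mult[OF S_power[OF assms(1)]] by (simp only:)
qed

text \<open>The power of \<open>f\<close> with integral exponent, where \<open>g\<close> stands in
  for the inverse of \<open>f\<close> modulo \<open>A\<close>.\<close>

definition ipow :: "'a \<Rightarrow> 'a \<Rightarrow> int \<Rightarrow> 'a" where
  "ipow f g e = (if 0 \<le> e then f ^ nat e else g ^ nat (- e))"

lemma ipow_in_S: "f \<in> S \<Longrightarrow> g \<in> S \<Longrightarrow> ipow f g e \<in> S"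
  by (simp add: ipow_def S_power)

text \<open>For mixed signs the surplus factors \<open>f * g\<close> cancel only modulo
  \<open>A\<close>; for equal signs the exponent law is an equality.\<close>

lemma ipow_add_neg:
  assumes "f \<in> S" "g \<in> S" "f * g - 1 \<in> A" "0 \<le> d" "e < 0"
  shows "ipow f g d * ipow f g e - ipow f g (d + e) \<in> A"
proof (cases "0 \<le> d + e")
  case True
  then have "nat d = nat (d + e) + nat (- e)" using assms(5) by simp
  then show ?thesis
    using inverse_power_cancel[OF assms(1-3), of "nat (d + e)" "nat (- e)"] True assms(4,5)
    by (simp add: ipow_def)
next
  case False
  then have "nat (- e) = nat (- (d + e)) + nat d" using assms(4) by simp
  moreover have "g * f - 1 \<in> A" using assms(3) by (simp add: mult.commute)
  ultimately show ?thesis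
    using inverse_power_cancel[OF assms(2,1), of "nat (- (d + e))" "nat d"] False assms(4,5)
    by (simp add: ipow_def mult.commute)
qed

lemma ipow_add:
  assumes "f \<in> S" "g \<in> S" "f * g - 1 \<in> A"
  shows "ipow f g (d + e) - ipow f g d * ipow f g e \<in> A"
proof -
  consider "0 \<le> d" "0 \<le> e" | "0 \<le> d" "e < 0" | "d < 0" "0 \<le> e" | "d < 0" "e < 0"
    by linarith
  then show ?thesis
  proof cases
    case 1
    then show ?thesis by (simp add: ipow_def nat_add_distrib power_add A_zero)
  next
    case 2
    then show ?thesis using A_diff_swap[OF ipow_add_neg[OF assms]] by simp
  next
    case 3
    then show ?thesis
      using A_diff_swap[OF ipow_add_neg[OF assms, of e d]] by (simp add: add.commute mult.commute)
  next
    case 4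
    then have "nat (- (d + e)) = nat (- d) + nat (- e)" by simp
    then show ?thesis using 4 by (simp add: ipow_def power_add A_zero)
  qed
qed

end

section \<open>The data of the theorem and its monomial ideals\<close>

locale gs_setup = toric "monoidP G"
  for G :: "('k::field, 'p::ab_group_add) scatter_data" +
  fixes I :: "'p set"
  assumes three: "3 \<le> comps G"
    and J_ideal: "monoid_ideal (monoidP G) (idealJ G)"
    and J_radical: "monoid_radical (monoidP G) (idealJ G) = idealJ G"
    and kappa_J: "i < comps G \<Longrightarrow> kappa G i \<in> idealJ G"
    and diagram: "scattering_diagram G"
    and consistent: "consistent G"
    and I_ideal: "monoid_ideal (monoidP G) I"
    and I_radical: "monoid_radical (monoidP G) I = idealJ G"
begin

abbreviation "n \<equiv> comps G"
abbreviation "P \<equiv> monoidP G"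
abbreviation "J \<equiv> idealJ G"
abbreviation "\<kappa> \<equiv> kappa G"
abbreviation "D \<equiv> selfint G"
abbreviation "Jpow \<equiv> ideal_power P J"

lemma J_subset: "J \<subseteq> P"
  using J_ideal by (simp add: monoid_ideal_def)

lemma I_subset: "I \<subseteq> P"
  using I_ideal by (simp add: monoid_ideal_def)

lemma ideal_add: "monoid_ideal P K \<Longrightarrow> a \<in> P \<Longrightarrow> b \<in> K \<Longrightarrow> a + b \<in> K"
  by (simp add: monoid_ideal_def)

lemma ideal_add': "monoid_ideal P K \<Longrightarrow> b \<in> K \<Longrightarrow> a \<in> P \<Longrightarrow> b + a \<in> K"
  by (metis add.commute monoid_ideal_def)

lemma P_ideal: "monoid_ideal P P"
  by (simp add: monoid_ideal_def P_add)

lemma Un_ideal: "monoid_ideal P K \<Longrightarrow> monoid_ideal P K' \<Longrightarrow> monoid_ideal P (K \<union> K')"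
  by (auto simp: monoid_ideal_def)

lemma I_subset_J: "I \<subseteq> J"
proof
  fix p assume "p \<in> I"
  then have "zmul (int 1) p \<in> I" "p \<in> P"
    using I_subset by (auto simp: zmul_def)
  then have "p \<in> monoid_radical P I"
    unfolding monoid_radical_def by blast
  then show "p \<in> J" by (simp add: I_radical)
qed

lemma Jpow_ideal: "monoid_ideal P (Jpow k)"
  by (rule ideal_power_ideal[OF J_ideal])

text \<open>An exponent of nilpotence of \<open>J\<close> modulo \<open>I\<close>. It bounds the
  passages of a broken line, the length of the geometric series that inverts a wall function, and
  the induction in \<open>vanishing\<close>.\<close>

definition nil :: nat where
  "nil = (SOME k. Jpow k \<subseteq> I)"

lemma Jpow_nil: "Jpow nil \<subseteq> I"
  unfolding nil_def by (rule someI_ex) (rule ideal_power_subset[OF J_ideal I_ideal I_radical])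

text \<open>The finiteness condition on the diagram speaks of ideals with radical \<open>J\<close>;
  this makes it available for the powers of \<open>J\<close> that occur in
  \<open>monomial_term\<close>. The power \<open>0\<close> is \<open>P\<close> itself and is
  excluded.\<close>

lemma Jpow_radical:
  assumes "0 < k"
  shows "monoid_radical P (Jpow k) = J"
proof (intro equalityI subsetI)
  fix p assume "p \<in> monoid_radical P (Jpow k)"
  then obtain l where l: "p \<in> P" "l > 0" "zmul (int l) p \<in> Jpow k"
    by (auto simp: monoid_radical_def)
  have "Jpow k \<subseteq> Jpow (Suc 0)"
    using assms by (intro ideal_power_antimono[OF J_ideal]) simp
  also have "\<dots> \<subseteq> J"
    by (auto intro: ideal_add'[OF J_ideal])
  finally have "p \<in> monoid_radical P J"
    using l by (auto simp: monoid_radical_def)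
  then show "p \<in> J" by (simp add: J_radical)
next
  fix p assume p: "p \<in> J"
  have "((+) p ^^ l) 0 \<in> Jpow l" for l
    by (induction l) (use p P_zero in auto)
  then have "zmul (int k) p \<in> Jpow k"
    by (simp add: zmul_of_nat)
  then show "p \<in> monoid_radical P (Jpow k)"
    using p assms J_subset unfolding monoid_radical_def by blast
qed

lemma monoid_pair_times:
  assumes "monoid_ideal P K" "(0 :: 'e::comm_monoid_add) \<in> X" "\<And>a b. a \<in> X \<Longrightarrow> b \<in> X \<Longrightarrow> a + b \<in> X"
  shows "monoid_pair (P \<times> X) (K \<times> X)"
  by standard
    (use assms P_zero P_add in \<open>auto simp: monoid_ideal_def zero_prod_def\<close>)

lemma monoid_pair_UNIV: "monoid_ideal P K \<Longrightarrow> monoid_pair (P \<times> (UNIV :: 'e::comm_monoid_add set)) (K \<times> UNIV)"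
  by (rule monoid_pair_times) auto

lemma monoid_pair_P: "monoid_ideal P K \<Longrightarrow> monoid_pair P K"
  by standard (auto simp: P_zero P_add monoid_ideal_def)

lemma rho_exponents_zero: "0 \<in> rho_exponents"
  by (auto simp: rho_exponents_def zero_prod_def)

lemma rho_exponents_add: "a \<in> rho_exponents \<Longrightarrow> b \<in> rho_exponents \<Longrightarrow> a + b \<in> rho_exponents"
  by (auto simp: rho_exponents_def)

sublocale RI: monoid_pair P I "TYPE('k)"
  by (rule monoid_pair_P[OF I_ideal])

sublocale sig: monoid_pair "P \<times> (UNIV :: (int \<times> int) set)" "I \<times> UNIV" "TYPE('k)"
  by (rule monoid_pair_UNIV[OF I_ideal])

sublocale wal: monoid_pair "P \<times> (UNIV :: int set)" "I \<times> UNIV" "TYPE('k)"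
  by (rule monoid_pair_UNIV[OF I_ideal])

sublocale prho: monoid_pair "P \<times> rho_exponents" "I \<times> rho_exponents" "TYPE('k)"
  by (rule monoid_pair_times[OF I_ideal rho_exponents_zero rho_exponents_add])

lemma ring_RI_eq: "ring_RI G I = RI.Q"
  by (simp add: ring_RI_def monoid_algebra_def)

lemma cls_RI_eq: "cls_RI G I f = RI.cls f"
  by (simp add: cls_RI_def monoid_algebra_def RI.cls_def)

lemma ring_sigma_eq: "ring_sigma G I = sig.Q"
  by (simp add: ring_sigma_def monoid_algebra_def)

lemma cls_sigma_eq: "cls_sigma G I f = sig.cls f"
  by (simp add: cls_sigma_def monoid_algebra_def sig.cls_def)


section \<open>Wall functions modulo monomial ideals\<close>

text \<open>Modulo such an ideal an element of the \<open>J\<close>-adic completion has finitely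
  many terms, so \<open>truncate\<close> is a polynomial with the expected coefficients. Unlike a
  condition on the radical, the property passes to unions with arbitrary monoid ideals.\<close>

definition fine_ideal :: "'p set \<Rightarrow> bool" where
  "fine_ideal K \<longleftrightarrow> monoid_ideal P K \<and> (\<exists>k. Jpow k \<subseteq> K)"

lemma fine_ideal_I: "fine_ideal I"
  using I_ideal Jpow_nil by (auto simp: fine_ideal_def)

lemma fine_ideal_Jpow: "fine_ideal (Jpow k)"
  using Jpow_ideal by (auto simp: fine_ideal_def)

lemma fine_ideal_Un: "fine_ideal K \<Longrightarrow> monoid_ideal P K' \<Longrightarrow> fine_ideal (K \<union> K')"
  by (auto simp: fine_ideal_def intro: Un_ideal)

lemma wallD:
  assumes "(m, f) \<in> diag G"
  shows "m \<in> trop_int n" "Gcd (range m) = 1" "f \<in> completed P J"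
    "(\<And>i. i < n \<Longrightarrow> m \<noteq> unit_vec i) \<Longrightarrow> trivial_mod J f"
  using diagram assms unfolding scattering_diagram_def by blast+

lemma finite_nontrivial:
  assumes "monoid_ideal P K" "monoid_radical P K = J"
  shows "finite {(m, f) \<in> diag G. \<not> trivial_mod K f}"
  using diagram assms unfolding scattering_diagram_def by blast

lemma finite_nontrivial_at:
  assumes "monoid_ideal P K" "monoid_radical P K = J"
  shows "finite {f. (m, f) \<in> diag G \<and> \<not> trivial_mod K f}"
  by (rule finite_subset[OF _ finite_imageI[OF finite_nontrivial[OF assms], of snd]]) force

lemma lookup_truncate:
  assumes "f \<in> completed P J" "fine_ideal K"
  shows "lookup (truncate K f) (p, k) = (if p \<in> K then 0 else f (p, k))"
proof -
  obtain l where l: "Jpow l \<subseteq> K" using assms(2) by (auto simp: fine_ideal_def)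
  have "finite {(p, k). p \<notin> Jpow l \<and> f (p, k) \<noteq> 0}"
    using assms(1) by (auto simp: completed_def)
  then have "finite {x. (case x of (p, k) \<Rightarrow> if p \<in> K then 0 else f (p, k)) \<noteq> 0}"
    by (rule rev_finite_subset) (use l in \<open>auto split: if_splits\<close>)
  then show ?thesis
    unfolding truncate_def by (subst lookup_Abs_poly_mapping) auto
qed

lemma keys_truncate:
  assumes "f \<in> completed P J" "fine_ideal K"
  shows "keys (truncate K f) \<subseteq> P \<times> UNIV"
proof
  fix x assume x: "x \<in> keys (truncate K f)"
  obtain p k where pk: "x = (p, k)" by (cases x)
  then have "f (p, k) \<noteq> 0"
    using x lookup_truncate[OF assms, of p k] by (auto simp: in_keys_iff split: if_splits)
  then show "x \<in> P \<times> UNIV"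
    using assms(1) by (auto simp: completed_def pk)
qed

lemma keys_ray_fun:
  assumes "fine_ideal K"
  shows "keys (ray_fun G K m) \<subseteq> P \<times> UNIV"
proof -
  have "ray_fun G K m \<in> {f. keys f \<subseteq> P \<times> UNIV}"
    unfolding ray_fun_def
    by (rule wal.S_prod) (use keys_truncate[OF wallD(3) assms] in auto)
  then show ?thesis by simp
qed

lemma ray_fun_trivial:
  assumes "\<And>f. (m, f) \<in> diag G \<Longrightarrow> trivial_mod K f"
  shows "ray_fun G K m = 1"
proof -
  have "{f. (m, f) \<in> diag G \<and> \<not> trivial_mod K f} = {}" using assms by blast
  then show ?thesis unfolding ray_fun_def by (simp only: prod.empty)
qed

lemma truncate_trivial:
  assumes "trivial_mod K' f" "f \<in> completed P J" "fine_ideal K" "K \<subseteq> K'"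
  shows "keys (truncate K f - 1) \<subseteq> K' \<times> UNIV"
proof (rule keys_diff_subsetI)
  fix x :: "'p \<times> int" assume x: "x \<notin> K' \<times> UNIV"
  obtain p k where pk: "x = (p, k)" by (cases x)
  have "p \<notin> K'" using x pk by simp
  then show "lookup (truncate K f) x = lookup 1 x"
    using assms by (auto simp: pk lookup_truncate trivial_mod_def lookup_one when_def zero_prod_def)
qed

text \<open>The product modulo \<open>K\<close> may have more factors. Those trivial modulo
  \<open>K'\<close> are congruent to \<open>1\<close>, and the others agree with their truncations
  modulo \<open>K'\<close>. Finiteness is assumed at \<open>K\<close> because a product over an
  infinite set would be \<open>1\<close>.\<close>

lemma ray_fun_cong:
  assumes "fine_ideal K" "fine_ideal K'" "K \<subseteq> K'"
    and fin: "finite {f. (m, f) \<in> diag G \<and> \<not> trivial_mod K f}"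
  shows "keys (ray_fun G K m - ray_fun G K' m) \<subseteq> K' \<times> UNIV"
proof -
  let ?A = "{f. (m, f) \<in> diag G \<and> \<not> trivial_mod K f}"
  let ?A' = "{f. (m, f) \<in> diag G \<and> \<not> trivial_mod K' f}"
  interpret K': monoid_pair "P \<times> (UNIV :: int set)" "K' \<times> UNIV" "TYPE('k)"
    using assms by (intro monoid_pair_UNIV) (auto simp: fine_ideal_def)
  have sub: "?A' \<subseteq> ?A"
    using assms(3) by (auto simp: trivial_mod_def)
  let ?g = "\<lambda>f. if trivial_mod K' f then 1 else truncate K' f"
  have "ray_fun G K' m = prod ?g ?A"
    unfolding ray_fun_def by (rule prod.mono_neutral_cong_left) (use sub fin in auto)
  moreover have "prod (truncate K) ?A - prod ?g ?A \<in> {f. keys f \<subseteq> K' \<times> UNIV}"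
  proof (rule K'.A_diff_prod)
    fix f assume "f \<in> ?A"
    then have f: "f \<in> completed P J" using wallD(3) by blast
    show "truncate K f \<in> {f. keys f \<subseteq> P \<times> UNIV}"
      using keys_truncate[OF f assms(1)] by simp
    show "?g f \<in> {f. keys f \<subseteq> P \<times> UNIV}"
      using keys_truncate[OF f assms(2)] K'.S_one by auto
    show "truncate K f - ?g f \<in> {f. keys f \<subseteq> K' \<times> UNIV}"
    proof (cases "trivial_mod K' f")
      case True
      then show ?thesis using truncate_trivial[OF True f assms(1,3)] by simp
    next
      case False
      have "keys (truncate K f - truncate K' f) \<subseteq> K' \<times> UNIV"
        using assms(3) by (intro keys_diff_subsetI)
          (auto simp: lookup_truncate[OF f assms(1)] lookup_truncate[OF f assms(2)] split: if_splits)
      then show ?thesis using False by simp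
    qed
  qed
  ultimately show ?thesis
    by (simp add: ray_fun_def)
qed

text \<open>Comparison with the product modulo \<open>J\<close>, which is empty.\<close>

lemma ray_fun_trivial_mod:
  assumes "\<And>f. (m, f) \<in> diag G \<Longrightarrow> trivial_mod J f"
  shows "keys (ray_fun G I m - 1) \<subseteq> J \<times> UNIV"
proof -
  have fine: "fine_ideal J"
    using fine_ideal_Un[OF fine_ideal_I J_ideal] I_subset_J by (simp add: Un_absorb1)
  have "keys (ray_fun G I m - ray_fun G J m) \<subseteq> J \<times> UNIV"
    by (rule ray_fun_cong[OF fine_ideal_I fine I_subset_J finite_nontrivial_at[OF I_ideal I_radical]])
  then show ?thesis
    using ray_fun_trivial[OF assms] by simp
qed

text \<open>\<open>monomial_term\<close> reads a coefficient modulo some power of \<open>J\<close>,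
  whereas lifts are computed modulo \<open>I\<close>. The two products agree modulo the union of
  both ideals, which misses \<open>s\<close> if \<open>I\<close> does.\<close>

lemma monomial_term_mod:
  assumes "monomial_term G m e c s k"
  shows "s \<in> P"
    and "s \<notin> I \<Longrightarrow> c = lookup (ray_fun G I m ^ e) (s, k)"
proof -
  obtain N where N: "c \<noteq> 0" "s \<notin> Jpow N" "c = lookup (ray_fun G (Jpow N) m ^ e) (s, k)"
    using assms unfolding monomial_term_def by blast
  have "ray_fun G (Jpow N) m ^ e \<in> {f. keys f \<subseteq> P \<times> UNIV}"
    by (rule wal.S_power) (simp add: keys_ray_fun[OF fine_ideal_Jpow])
  then show sP: "s \<in> P"
    using N by (auto simp: in_keys_iff)
  assume s: "s \<notin> I"
  \<comment> \<open>The power \<open>0\<close> of \<open>J\<close> is \<open>P\<close>, which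
    contains \<open>s\<close>.\<close>
  have N0: "0 < N"
    using N(2) sP by (cases N) auto
  let ?K = "I \<union> Jpow N"
  have K: "fine_ideal ?K"
    by (rule fine_ideal_Un[OF fine_ideal_I Jpow_ideal])
  interpret K: monoid_pair "P \<times> (UNIV :: int set)" "?K \<times> UNIV" "TYPE('k)"
    using K by (intro monoid_pair_UNIV) (auto simp: fine_ideal_def)
  have 1: "keys (ray_fun G I m - ray_fun G ?K m) \<subseteq> ?K \<times> UNIV"
    by (rule ray_fun_cong[OF fine_ideal_I K _ finite_nontrivial_at[OF I_ideal I_radical]]) auto
  have 2: "keys (ray_fun G (Jpow N) m - ray_fun G ?K m) \<subseteq> ?K \<times> UNIV"
    by (rule ray_fun_cong[OF fine_ideal_Jpow K _ finite_nontrivial_at[OF Jpow_ideal Jpow_radical[OF N0]]]) auto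
  have "ray_fun G (Jpow N) m - ray_fun G I m \<in> {f. keys f \<subseteq> ?K \<times> UNIV}"
    using K.A_diff_trans[OF _ K.A_diff_swap, of "ray_fun G (Jpow N) m" "ray_fun G ?K m" "ray_fun G I m"] 1 2
    by simp
  then have "ray_fun G (Jpow N) m ^ e - ray_fun G I m ^ e \<in> {f. keys f \<subseteq> ?K \<times> UNIV}"
    by (rule K.A_diff_power) (simp_all add: keys_ray_fun[OF fine_ideal_Jpow] keys_ray_fun[OF fine_ideal_I])
  then show "c = lookup (ray_fun G I m ^ e) (s, k)"
    unfolding N(3) using s N(2) by (intro lookup_eq_if_keys_diff[of _ _ "?K \<times> UNIV"]) auto
qed

section \<open>The rings at the rays\<close>

text \<open>The two localization maps \<open>psi_minus\<close> and \<open>psi_plus\<close> send a monomial \<open>x\<close> to \<open>z\<^sup>\<tau>\<^sup>x F\<^sup>\<delta>\<^sup>x\<close>, where \<open>\<delta> x\<close> is the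
  exponent of the variable that is eliminated.\<close>

definition eval_mono where
  "eval_mono \<tau> \<delta> F x = single (\<tau> x) 1 * F ^ nat (\<delta> x)"

lemma eval_mono_add:
  assumes "\<tau> (x + y) = \<tau> x + \<tau> y" "\<delta> (x + y) = \<delta> x + \<delta> y" "0 \<le> \<delta> x" "0 \<le> \<delta> y"
  shows "eval_mono \<tau> \<delta> (F :: 'b::comm_monoid_add \<Rightarrow>\<^sub>0 'k) (x + y) = eval_mono \<tau> \<delta> F x * eval_mono \<tau> \<delta> F y"
proof -
  have "single (\<tau> x + \<tau> y) (1::'k) = single (\<tau> x) 1 * single (\<tau> y) 1"
    by (simp add: mult_single)
  then show ?thesis
    using assms by (simp add: eval_mono_def nat_add_distrib power_add algebra_simps)
qed

lemma lext_hom: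
  fixes h :: "'a::comm_monoid_add \<Rightarrow> ('b::comm_monoid_add \<Rightarrow>\<^sub>0 'k)"
  assumes "keys f \<subseteq> X" "keys g \<subseteq> X" "\<And>x y. x \<in> X \<Longrightarrow> y \<in> X \<Longrightarrow> h (x + y) = h x * h y"
  shows "lext h (f * g) = lext h f * lext h g"
proof -
  interpret pm_quotient "UNIV :: ('b \<Rightarrow>\<^sub>0 'k) set" "{0}"
    by standard auto
  show ?thesis
    using lext_mult[OF assms(1,2), of h] assms(3) by simp
qed

text \<open>\<open>Fm i\<close> is the image of X_{i+1} over the cone before the ray
  \<open>i\<close>, \<open>Fp i\<close> that of X_{i-1} over the cone after it, and
  \<open>Fr i\<close> is the value that the relation of the ring at the ray assigns to X_{i-1}
  X_{i+1}.\<close>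

definition Fm :: "nat \<Rightarrow> ('p \<times> int \<times> int) \<Rightarrow>\<^sub>0 'k" where
  "Fm i = push (\<lambda>(s, k). (s + \<kappa> i, - 1, k - D i)) (ray_fun G I (unit_vec i))"

definition Fp :: "nat \<Rightarrow> ('p \<times> int \<times> int) \<Rightarrow>\<^sub>0 'k" where
  "Fp i = push (\<lambda>(s, k). (s + \<kappa> i, k - D i, - 1)) (ray_fun G I (unit_vec i))"

definition Fr :: "nat \<Rightarrow> ('p \<times> int \<times> int \<times> int) \<Rightarrow>\<^sub>0 'k" where
  "Fr i = push (\<lambda>(s, k). (s + \<kappa> i, 0, k - D i, 0)) (ray_fun G I (unit_vec i))"

definition hm :: "nat \<Rightarrow> 'p \<times> int \<times> int \<times> int \<Rightarrow> ('p \<times> int \<times> int) \<Rightarrow>\<^sub>0 'k" where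
  "hm i = eval_mono (\<lambda>(p, a, b, c). (p, a, b)) (\<lambda>(p, a, b, c). c) (Fm i)"
definition hp :: "nat \<Rightarrow> 'p \<times> int \<times> int \<times> int \<Rightarrow> ('p \<times> int \<times> int) \<Rightarrow>\<^sub>0 'k" where
  "hp i = eval_mono (\<lambda>(p, a, b, c). (p, b, c)) (\<lambda>(p, a, b, c). a) (Fp i)"

definition Psim where
  "Psim i f = lext (hm i) f"
definition Psip where
  "Psip i f = lext (hp i) f"

lemma psi_minus_eq: "psi_minus G I i C = sig.cls (Psim i (SOME g. g \<in> C))"
proof -
  have "single x 1 * F * single (0::'p \<times> int \<times> int) c = single x c * F"
    for x and c :: 'k and F
    unfolding single_mult_zero[of x c, symmetric] by (simp only: mult_ac)
  then show ?thesis
    unfolding psi_minus_def cls_sigma_eq Psim_def lext_def hm_def eval_mono_def Fm_def Let_def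
    by (intro arg_cong[of _ _ sig.cls] sum.cong refl) (simp add: case_prod_beta)
qed

lemma psi_plus_eq: "psi_plus G I i C = sig.cls (Psip i (SOME g. g \<in> C))"
proof -
  have "single x 1 * F * single (0::'p \<times> int \<times> int) c = single x c * F"
    for x and c :: 'k and F
    unfolding single_mult_zero[of x c, symmetric] by (simp only: mult_ac)
  then show ?thesis
    unfolding psi_plus_def cls_sigma_eq Psip_def lext_def hp_def eval_mono_def Fp_def Let_def
    by (intro arg_cong[of _ _ sig.cls] sum.cong refl) (simp add: case_prod_beta)
qed

text \<open>Since \<open>\<kappa> i\<close> lies in \<open>J\<close>, the image of the eliminated
  variable has all exponents in \<open>J\<close>, and its transversal exponent is
  \<open>- 1\<close>. The first fact keeps negative transversal exponents out of the current layer
  of the \<open>J\<close>-adic filtration, the second lets the coefficients of normal forms be read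
  off.\<close>

lemma keys_Fm: "i < n \<Longrightarrow> keys (Fm i) \<subseteq> {(p, a, b). p \<in> J \<and> a = - 1}"
  unfolding Fm_def
  by (rule keys_push_subset)
    (use keys_ray_fun[OF fine_ideal_I, of "unit_vec i"] kappa_J[of i] in \<open>auto intro: ideal_add[OF J_ideal]\<close>)

lemma keys_Fp: "i < n \<Longrightarrow> keys (Fp i) \<subseteq> {(p, a, b). p \<in> J \<and> b = - 1}"
  unfolding Fp_def
  by (rule keys_push_subset)
    (use keys_ray_fun[OF fine_ideal_I, of "unit_vec i"] kappa_J[of i] in \<open>auto intro: ideal_add[OF J_ideal]\<close>)

lemma keys_Fr: "i < n \<Longrightarrow> keys (Fr i) \<subseteq> {(p, a, b, c). p \<in> J \<and> a = 0 \<and> c = 0}"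
  unfolding Fr_def
  by (rule keys_push_subset)
    (use keys_ray_fun[OF fine_ideal_I, of "unit_vec i"] kappa_J[of i] in \<open>auto intro: ideal_add[OF J_ideal]\<close>)

lemma keys_Fm_pow:
  assumes "i < n"
  shows "keys (Fm i ^ k) \<subseteq> {(p, a, b). p \<in> P \<and> (0 < k \<longrightarrow> p \<in> J) \<and> a = - int k}"
proof (induction k)
  case 0
  then show ?case by (auto simp: P_zero zero_prod_def)
next
  case (Suc k)
  show ?case
    unfolding power_Suc
  proof (rule keys_mult_subset)
    fix x y assume xy: "x \<in> keys (Fm i)" "y \<in> keys (Fm i ^ k)"
    obtain x1 x2 x3 y1 y2 y3 where "x = (x1, x2, x3)" "y = (y1, y2, y3)" by (cases x, cases y)
    then show "x + y \<in> {(p, a, b). p \<in> P \<and> (0 < Suc k \<longrightarrow> p \<in> J) \<and> a = - int (Suc k)}"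
      using subsetD[OF keys_Fm[OF assms] xy(1)] subsetD[OF Suc xy(2)] subsetD[OF J_subset, of x1]
      by (simp add: P_add ideal_add'[OF J_ideal])
  qed
qed

lemma keys_Fp_pow:
  assumes "i < n"
  shows "keys (Fp i ^ k) \<subseteq> {(p, a, b). p \<in> P \<and> (0 < k \<longrightarrow> p \<in> J) \<and> b = - int k}"
proof (induction k)
  case 0
  then show ?case by (auto simp: P_zero zero_prod_def)
next
  case (Suc k)
  show ?case
    unfolding power_Suc
  proof (rule keys_mult_subset)
    fix x y assume xy: "x \<in> keys (Fp i)" "y \<in> keys (Fp i ^ k)"
    obtain x1 x2 x3 y1 y2 y3 where "x = (x1, x2, x3)" "y = (y1, y2, y3)" by (cases x, cases y)
    then show "x + y \<in> {(p, a, b). p \<in> P \<and> (0 < Suc k \<longrightarrow> p \<in> J) \<and> b = - int (Suc k)}"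
      using subsetD[OF keys_Fp[OF assms] xy(1)] subsetD[OF Suc xy(2)] subsetD[OF J_subset, of x1]
      by (simp add: P_add ideal_add'[OF J_ideal])
  qed
qed

lemma keys_Fr_pow:
  assumes "i < n"
  shows "keys (Fr i ^ k) \<subseteq> {(p, a, b, c). p \<in> P \<and> a = 0 \<and> c = 0}"
proof (induction k)
  case 0
  then show ?case by (auto simp: P_zero zero_prod_def)
next
  case (Suc k)
  show ?case
    unfolding power_Suc
  proof (rule keys_mult_subset)
    fix x y assume xy: "x \<in> keys (Fr i)" "y \<in> keys (Fr i ^ k)"
    obtain x1 x2 x3 x4 y1 y2 y3 y4 where "x = (x1, x2, x3, x4)" "y = (y1, y2, y3, y4)" by (cases x, cases y)
    then show "x + y \<in> {(p, a, b, c). p \<in> P \<and> a = 0 \<and> c = 0}"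
      using subsetD[OF keys_Fr[OF assms] xy(1)] subsetD[OF Suc xy(2)] subsetD[OF J_subset, of x1]
      by (simp add: P_add ideal_add'[OF J_ideal])
  qed
qed

lemma keys_hm:
  assumes "i < n" "0 \<le> c" "y \<in> keys (hm i (p, a, b, c))"
  shows "\<exists>s b'. y = (p + s, a - c, b') \<and> s \<in> P \<and> (0 < c \<longrightarrow> s \<in> J)"
proof -
  have y: "y \<in> keys (single (p, a, b) 1 * Fm i ^ nat c)"
    using assms(3) by (simp only: hm_def eval_mono_def prod.case)
  obtain u where u: "u \<in> keys (Fm i ^ nat c)" "y = (p, a, b) + u"
    using keys_single_times[OF y] by (elim bexE) simp
  obtain s a' b' where u': "u = (s, a', b')" by (cases u)
  have "s \<in> P" "0 < c \<longrightarrow> s \<in> J" "a' = - c"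
    using subsetD[OF keys_Fm_pow[OF assms(1)] u(1)] assms(2) by (simp_all add: u')
  then show ?thesis
    by (intro exI[of _ s] exI[of _ "b + b'"]) (simp add: u(2) u')
qed

lemma keys_hp:
  assumes "i < n" "0 \<le> a" "y \<in> keys (hp i (p, a, b, c))"
  shows "\<exists>s b'. y = (p + s, b', c - a) \<and> s \<in> P \<and> (0 < a \<longrightarrow> s \<in> J)"
proof -
  have y: "y \<in> keys (single (p, b, c) 1 * Fp i ^ nat a)"
    using assms(3) by (simp only: hp_def eval_mono_def prod.case)
  obtain u where u: "u \<in> keys (Fp i ^ nat a)" "y = (p, b, c) + u"
    using keys_single_times[OF y] by (elim bexE) simp
  obtain s b' c' where u': "u = (s, b', c')" by (cases u)
  have "s \<in> P" "0 < a \<longrightarrow> s \<in> J" "c' = - a"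
    using subsetD[OF keys_Fp_pow[OF assms(1)] u(1)] assms(2) by (simp_all add: u')
  then show ?thesis
    by (intro exI[of _ s] exI[of _ "b + b'"]) (simp add: u(2) u')
qed

lemma keys_Psim:
  assumes "i < n" "monoid_ideal P K" "keys f \<subseteq> K \<times> rho_exponents"
  shows "keys (Psim i f) \<subseteq> K \<times> UNIV"
proof
  fix y assume "y \<in> keys (Psim i f)"
  then obtain x where x: "x \<in> keys f" "y \<in> keys (hm i x)"
    using keys_lext[of "hm i" f] unfolding Psim_def by blast
  obtain p a b c where pabc: "x = (p, a, b, c)" by (cases x)
  have "0 \<le> c" "p \<in> K" using x(1) assms(3) by (auto simp: pabc rho_exponents_def)
  moreover obtain s b' where "y = (p + s, a - c, b')" "s \<in> P"
    using keys_hm[OF assms(1) \<open>0 \<le> c\<close> x(2)[unfolded pabc]] by blast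
  ultimately show "y \<in> K \<times> UNIV"
    by (simp add: ideal_add'[OF assms(2)])
qed

lemma keys_Psip:
  assumes "i < n" "monoid_ideal P K" "keys f \<subseteq> K \<times> rho_exponents"
  shows "keys (Psip i f) \<subseteq> K \<times> UNIV"
proof
  fix y assume "y \<in> keys (Psip i f)"
  then obtain x where x: "x \<in> keys f" "y \<in> keys (hp i x)"
    using keys_lext[of "hp i" f] unfolding Psip_def by blast
  obtain p a b c where pabc: "x = (p, a, b, c)" by (cases x)
  have "0 \<le> a" "p \<in> K" using x(1) assms(3) by (auto simp: pabc rho_exponents_def)
  moreover obtain s b' where "y = (p + s, b', c - a)" "s \<in> P"
    using keys_hp[OF assms(1) \<open>0 \<le> a\<close> x(2)[unfolded pabc]] by blast
  ultimately show "y \<in> K \<times> UNIV"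
    by (simp add: ideal_add'[OF assms(2)])
qed

lemma Psim_mult:
  assumes "keys f \<subseteq> P \<times> rho_exponents" "keys g \<subseteq> P \<times> rho_exponents"
  shows "Psim i (f * g) = Psim i f * Psim i g"
  unfolding Psim_def
  by (rule lext_hom[OF assms]) (unfold hm_def, rule eval_mono_add, auto simp: rho_exponents_def)

lemma Psip_mult:
  assumes "keys f \<subseteq> P \<times> rho_exponents" "keys g \<subseteq> P \<times> rho_exponents"
  shows "Psip i (f * g) = Psip i f * Psip i g"
  unfolding Psip_def
  by (rule lext_hom[OF assms]) (unfold hp_def, rule eval_mono_add, auto simp: rho_exponents_def)

lemma Psim_const: "Psim i (push (\<lambda>p. (p, 0, 0, 0)) a) = push (\<lambda>p. (p, 0, 0)) a"
  unfolding Psim_def lext_push hm_def eval_mono_def by (simp add: push_lext)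

lemma Psip_const: "Psip i (push (\<lambda>p. (p, 0, 0, 0)) a) = push (\<lambda>p. (p, 0, 0)) a"
  unfolding Psip_def lext_push hp_def eval_mono_def by (simp add: push_lext)

lemma Psip_one: "Psip i 1 = 1"
  using Psip_const[of i "single 0 1"]
  by (simp add: single_zero3 single_zero4 del: single_one)

definition gen_rho where "gen_rho i = single (0, 1, 0, 1) (1::'k) - Fr i"

lemma ideal_rho_eq: "ideal_rho G I i = Idl\<^bsub>poly_rho G\<^esub> ({f. keys f \<subseteq> I \<times> rho_exponents} \<union> {gen_rho i})"
  by (simp add: ideal_rho_def gen_rho_def Fr_def)

lemma poly_rho_eq: "poly_rho G = ring_on {f :: ('p \<times> int \<times> int \<times> int) \<Rightarrow>\<^sub>0 'k. keys f \<subseteq> P \<times> rho_exponents}"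
  by (simp add: poly_rho_def monoid_algebra_def)

lemma keys_gen_rho: "i < n \<Longrightarrow> keys (gen_rho i) \<subseteq> P \<times> rho_exponents"
  using keys_diff_subset[of "single (0, 1, 0, 1) (1::'k)" "Fr i"] keys_Fr[of i] J_subset P_zero
  by (auto simp: gen_rho_def rho_exponents_def)

text \<open>The relation goes to \<open>0\<close> exactly, not only modulo \<open>I\<close>, because
  the same polynomial \<open>ray_fun G I (unit_vec i)\<close> occurs in the relation and in the
  image of the eliminated variable.\<close>

lemma Psim_gen_rho: "Psim i (gen_rho i) = 0"
proof -
  have "single (0::'p, 1::int, 0::int) (1::'k) * Fm i =
      push (\<lambda>(s, k). (s + \<kappa> i, 0, k - D i)) (ray_fun G I (unit_vec i))"
    by (simp add: Fm_def single_times_push split_def)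
  moreover have "Psim i (Fr i) = push (\<lambda>(s, k). (s + \<kappa> i, 0, k - D i)) (ray_fun G I (unit_vec i))"
    unfolding Psim_def Fr_def lext_push hm_def eval_mono_def by (simp add: push_lext split_def)
  ultimately show ?thesis
    by (simp add: gen_rho_def Psim_def lext_diff) (simp add: hm_def eval_mono_def)
qed

lemma Psip_gen_rho: "Psip i (gen_rho i) = 0"
proof -
  have "single (0::'p, 0::int, 1::int) (1::'k) * Fp i =
      push (\<lambda>(s, k). (s + \<kappa> i, k - D i, 0)) (ray_fun G I (unit_vec i))"
    by (simp add: Fp_def single_times_push split_def)
  moreover have "Psip i (Fr i) = push (\<lambda>(s, k). (s + \<kappa> i, k - D i, 0)) (ray_fun G I (unit_vec i))"
    unfolding Psip_def Fr_def lext_push hp_def eval_mono_def by (simp add: push_lext split_def)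
  ultimately show ?thesis
    by (simp add: gen_rho_def Psip_def lext_diff) (simp add: hp_def eval_mono_def)
qed

lemma ideal_rho_ideal:
  assumes "i < n"
  shows "ideal (ideal_rho G I i) (poly_rho G)"
proof -
  interpret R: cring "poly_rho G"
    unfolding poly_rho_eq by (rule prho.cring_ring_on)
  show ?thesis
    unfolding ideal_rho_eq using prho.A_subset keys_gen_rho[OF assms]
    by (intro R.genideal_ideal) (auto simp: poly_rho_eq ring_on_def)
qed

lemma pm_quotient_rho:
  assumes "i < n"
  shows "pm_quotient {f :: ('p \<times> int \<times> int \<times> int) \<Rightarrow>\<^sub>0 'k. keys f \<subseteq> P \<times> rho_exponents} (ideal_rho G I i)"
proof -
  interpret R: cring "poly_rho G"
    unfolding poly_rho_eq by (rule prho.cring_ring_on)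
  interpret A: ideal "ideal_rho G I i" "poly_rho G"
    by (rule ideal_rho_ideal[OF assms])
  show ?thesis
  proof
    fix a b
    show "ideal_rho G I i \<subseteq> {f. keys f \<subseteq> P \<times> rho_exponents}"
      using A.a_subset by (simp add: poly_rho_eq ring_on_def)
    show "0 \<in> ideal_rho G I i"
      using A.zero_closed by (simp add: poly_rho_eq ring_on_def)
    show "a \<in> ideal_rho G I i \<Longrightarrow> b \<in> ideal_rho G I i \<Longrightarrow> a + b \<in> ideal_rho G I i"
      using A.a_closed[of a b] by (simp add: poly_rho_eq ring_on_def)
    show "a \<in> {f. keys f \<subseteq> P \<times> rho_exponents} \<Longrightarrow> b \<in> ideal_rho G I i \<Longrightarrow> a * b \<in> ideal_rho G I i"
      using A.I_l_closed[of b a] by (simp add: poly_rho_eq ring_on_def)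
  qed (use prho.S_one prho.S_add prho.S_mult prho.S_uminus prho.S_const in auto)
qed

lemma ideal_rho_generators:
  assumes "i < n"
  shows "keys f \<subseteq> I \<times> rho_exponents \<Longrightarrow> f \<in> ideal_rho G I i" "gen_rho i \<in> ideal_rho G I i"
proof -
  interpret R: cring "poly_rho G"
    unfolding poly_rho_eq by (rule prho.cring_ring_on)
  have "{f. keys f \<subseteq> I \<times> rho_exponents} \<union> {gen_rho i} \<subseteq> ideal_rho G I i"
    unfolding ideal_rho_eq using prho.A_subset keys_gen_rho[OF assms]
    by (intro R.genideal_self) (auto simp: poly_rho_eq ring_on_def)
  then show "keys f \<subseteq> I \<times> rho_exponents \<Longrightarrow> f \<in> ideal_rho G I i" "gen_rho i \<in> ideal_rho G I i"
    by auto
qed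

text \<open>The elements that \<open>\<Psi>\<close> sends into the ideal of \<open>I\<close> form an
  ideal containing the generators. One argument serves both localization maps.\<close>

lemma ideal_rho_minimal:
  assumes "\<And>f g. keys f \<subseteq> P \<times> rho_exponents \<Longrightarrow> keys g \<subseteq> P \<times> rho_exponents \<Longrightarrow> \<Psi> (f * g) = \<Psi> f * \<Psi> g"
    and "\<And>f g. \<Psi> (f + g) = \<Psi> f + \<Psi> g"
    and "\<And>f. keys f \<subseteq> P \<times> rho_exponents \<Longrightarrow> keys (\<Psi> f) \<subseteq> P \<times> UNIV"
    and "\<And>f. keys f \<subseteq> I \<times> rho_exponents \<Longrightarrow> keys (\<Psi> f) \<subseteq> I \<times> UNIV"
    and "\<Psi> (gen_rho i) = 0" and "i < n" and "f \<in> ideal_rho G I i"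
  shows "keys (\<Psi> f :: ('p \<times> int \<times> int) \<Rightarrow>\<^sub>0 'k) \<subseteq> I \<times> UNIV"
proof -
  let ?A = "{f :: ('p \<times> int \<times> int \<times> int) \<Rightarrow>\<^sub>0 'k. keys f \<subseteq> P \<times> rho_exponents \<and> keys (\<Psi> f) \<subseteq> I \<times> UNIV}"
  interpret R: cring "poly_rho G"
    unfolding poly_rho_eq by (rule prho.cring_ring_on)
  have zero: "\<Psi> 0 = 0" using assms(2)[of 0 0] by simp
  interpret A: quotient_on "{f :: ('p \<times> int \<times> int \<times> int) \<Rightarrow>\<^sub>0 'k. keys f \<subseteq> P \<times> rho_exponents}" ?A
  proof
    fix a b :: "('p \<times> int \<times> int \<times> int) \<Rightarrow>\<^sub>0 'k"
    show "a \<in> ?A \<Longrightarrow> b \<in> ?A \<Longrightarrow> a + b \<in> ?A"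
      using prho.S_add[of a b] sig.A_add[of "\<Psi> a" "\<Psi> b"] by (simp add: assms(2))
    show "a \<in> {f. keys f \<subseteq> P \<times> rho_exponents} \<Longrightarrow> b \<in> ?A \<Longrightarrow> a * b \<in> ?A"
      using prho.S_mult[of a b] sig.A_mult[of "\<Psi> a" "\<Psi> b"] assms(3)[of a] by (simp add: assms(1))
  qed (use prho.S_one prho.S_add prho.S_mult prho.S_uminus in \<open>auto simp: zero\<close>)
  have "ideal ?A (poly_rho G)"
    unfolding poly_rho_eq by (rule A.ideal_ring_on)
  moreover have "{f. keys f \<subseteq> I \<times> rho_exponents} \<union> {gen_rho i} \<subseteq> ?A"
    using assms(4,5) keys_gen_rho[OF assms(6)] prho.A_subset by auto
  ultimately have "ideal_rho G I i \<subseteq> ?A"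
    unfolding ideal_rho_eq by (rule R.genideal_minimal)
  then show ?thesis using assms(7) by blast
qed

lemma Psim_add: "Psim i (f + g) = Psim i f + Psim i g"
  and Psip_add: "Psip i (f + g) = Psip i f + Psip i g"
  and Psim_diff: "Psim i (f - g) = Psim i f - Psim i g"
  and Psip_diff: "Psip i (f - g) = Psip i f - Psip i g"
  and Psip_sum: "Psip i (sum h T) = (\<Sum>x\<in>T. Psip i (h x))"
  by (simp_all add: Psim_def Psip_def lext_add lext_diff lext_sum)

lemma Psim_ideal: "i < n \<Longrightarrow> f \<in> ideal_rho G I i \<Longrightarrow> keys (Psim i f) \<subseteq> I \<times> UNIV"
  by (rule ideal_rho_minimal[of "Psim i"])
    (auto simp: Psim_mult Psim_add Psim_gen_rho dest: keys_Psim[OF _ P_ideal] keys_Psim[OF _ I_ideal])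

lemma Psip_ideal: "i < n \<Longrightarrow> f \<in> ideal_rho G I i \<Longrightarrow> keys (Psip i f) \<subseteq> I \<times> UNIV"
  by (rule ideal_rho_minimal[of "Psip i"])
    (auto simp: Psip_mult Psip_add Psip_gen_rho dest: keys_Psip[OF _ P_ideal] keys_Psip[OF _ I_ideal])

abbreviation rcls where "rcls i f \<equiv> ideal_rho G I i +>\<^bsub>poly_rho G\<^esub> f"

lemma rcls_eq: "rcls i f = quotient_on.cls {f. keys f \<subseteq> P \<times> rho_exponents} (ideal_rho G I i) f"
  if "i < n"
  using quotient_on.cls_def[OF pm_quotient.axioms(1)[OF pm_quotient_rho[OF that]]] by (simp add: poly_rho_eq)

lemma ring_rho_eq: "ring_rho G I i = ring_on {f. keys f \<subseteq> P \<times> rho_exponents} Quot ideal_rho G I i"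
  by (simp add: ring_rho_def poly_rho_eq)

lemma psi_minus_rcls:
  assumes "i < n" "keys f \<subseteq> P \<times> rho_exponents"
  shows "psi_minus G I i (rcls i f) = sig.cls (Psim i f)"
proof -
  interpret R: pm_quotient "{f :: ('p \<times> int \<times> int \<times> int) \<Rightarrow>\<^sub>0 'k. keys f \<subseteq> P \<times> rho_exponents}" "ideal_rho G I i"
    by (rule pm_quotient_rho[OF assms(1)])
  have "(SOME g. g \<in> rcls i f) - f \<in> ideal_rho G I i"
    using R.some_rep(2)[of f] assms by (simp add: rcls_eq)
  from Psim_ideal[OF assms(1) this] show ?thesis
    unfolding psi_minus_eq by (intro sig.cls_eqI) (simp add: Psim_diff)
qed

lemma psi_plus_rcls:
  assumes "i < n" "keys f \<subseteq> P \<times> rho_exponents"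
  shows "psi_plus G I i (rcls i f) = sig.cls (Psip i f)"
proof -
  interpret R: pm_quotient "{f :: ('p \<times> int \<times> int \<times> int) \<Rightarrow>\<^sub>0 'k. keys f \<subseteq> P \<times> rho_exponents}" "ideal_rho G I i"
    by (rule pm_quotient_rho[OF assms(1)])
  have "(SOME g. g \<in> rcls i f) - f \<in> ideal_rho G I i"
    using R.some_rep(2)[of f] assms by (simp add: rcls_eq)
  from Psip_ideal[OF assms(1) this] show ?thesis
    unfolding psi_plus_eq by (intro sig.cls_eqI) (simp add: Psip_diff)
qed


subsection \<open>Normal forms\<close>

text \<open>Every product X_{i-1} X_{i+1} is replaced by \<open>Fr i\<close>. One pass suffices,
  because \<open>Fr i\<close> contains neither variable.\<close>

definition nf :: "nat \<Rightarrow> (('p \<times> int \<times> int \<times> int) \<Rightarrow>\<^sub>0 'k) \<Rightarrow> ('p \<times> int \<times> int \<times> int) \<Rightarrow>\<^sub>0 'k" where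
  "nf i f = lext (\<lambda>(p, a, b, c). single (p, a - min a c, b, c - min a c) 1 * Fr i ^ nat (min a c)) f"

definition normal :: "(('p \<times> int \<times> int \<times> int) \<Rightarrow>\<^sub>0 'k) \<Rightarrow> bool" where
  "normal f \<longleftrightarrow> keys f \<subseteq> P \<times> {(a, b, c). 0 \<le> a \<and> 0 \<le> c \<and> (a = 0 \<or> c = 0)}"

lemma normal_keys: "normal f \<Longrightarrow> keys f \<subseteq> P \<times> rho_exponents"
  by (auto simp: normal_def rho_exponents_def)

lemma normal_nf:
  assumes "i < n" "keys f \<subseteq> P \<times> rho_exponents"
  shows "normal (nf i f)"
  unfolding normal_def
proof
  fix y assume "y \<in> keys (nf i f)"
  then obtain x where x: "x \<in> keys f"
    "y \<in> keys ((\<lambda>(p, a, b, c). single (p, a - min a c, b, c - min a c) (1::'k) * Fr i ^ nat (min a c)) x)"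
    using subsetD[OF keys_lext] unfolding nf_def by blast
  obtain p a b c where pabc: "x = (p, a, b, c)" by (cases x)
  have y: "y \<in> keys (single (p, a - min a c, b, c - min a c) (1::'k) * Fr i ^ nat (min a c))"
    using x(2) by (simp add: pabc)
  obtain u where u: "u \<in> keys (Fr i ^ nat (min a c))" "y = (p, a - min a c, b, c - min a c) + u"
    using keys_single_times[OF y] by (elim bexE) simp
  obtain s a' b' c' where u': "u = (s, a', b', c')" by (cases u)
  have "s \<in> P" "a' = 0" "c' = 0"
    using subsetD[OF keys_Fr_pow[OF assms(1)] u(1)] by (simp_all add: u')
  moreover have "p \<in> P" using x(1) assms(2) by (auto simp: pabc)
  ultimately show "y \<in> P \<times> {(a, b, c). 0 \<le> a \<and> 0 \<le> c \<and> (a = 0 \<or> c = 0)}"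
    by (auto simp: u(2) u' P_add min_def)
qed

lemma nf_cong:
  assumes "i < n" "keys f \<subseteq> P \<times> rho_exponents"
  shows "f - nf i f \<in> ideal_rho G I i"
proof -
  interpret R: pm_quotient "{f :: ('p \<times> int \<times> int \<times> int) \<Rightarrow>\<^sub>0 'k. keys f \<subseteq> P \<times> rho_exponents}" "ideal_rho G I i"
    by (rule pm_quotient_rho[OF assms(1)])
  have X: "keys (single (0::'p, 1::int, 0::int, 1::int) (1::'k)) \<subseteq> P \<times> rho_exponents"
    by (auto simp: P_zero rho_exponents_def)
  have Fr: "keys (Fr i) \<subseteq> P \<times> rho_exponents"
    using keys_Fr[OF assms(1)] J_subset by (auto simp: rho_exponents_def)
  have "f = lext (\<lambda>x. single x 1) f"
    by (simp add: lext_def single_mult_zero sum_single_lookup)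
  then have "f - nf i f = lext (\<lambda>x. single x 1 -
      (\<lambda>(p, a, b, c). single (p, a - min a c, b, c - min a c) 1 * Fr i ^ nat (min a c)) x) f"
    unfolding nf_def by (simp add: lext_def left_diff_distrib sum_subtractf)
  also have "\<dots> \<in> ideal_rho G I i"
  proof (rule R.lext_in_A)
    fix x assume x: "x \<in> keys f"
    obtain p a b c where pabc: "x = (p, a, b, c)" by (cases x)
    define d where "d = min a c"
    have d: "p \<in> P" "0 \<le> d" "d \<le> a" "d \<le> c"
      using x assms(2) by (auto simp: pabc d_def rho_exponents_def)
    have pow: "single (0::'p, 1::int, 0::int, 1::int) (1::'k) ^ k = single (0, int k, 0, int k) 1" for k
      by (induction k) (auto simp: mult_single single_zero4)
    have "single x (1::'k) = single (p, a - d, b, c - d) 1 * single (0, 1, 0, 1) 1 ^ nat d"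
      using d by (simp add: pow mult_single pabc)
    \<comment> \<open>The powers of X_{i-1} X_{i+1} and of \<open>Fr i\<close> are congruent because
      their bases differ by the generator of the ideal.\<close>
    then have "single x (1::'k) - single (p, a - d, b, c - d) 1 * Fr i ^ nat d =
        single (p, a - d, b, c - d) 1 * (single (0, 1, 0, 1) 1 ^ nat d - Fr i ^ nat d)"
      by (simp add: right_diff_distrib)
    also have "\<dots> \<in> ideal_rho G I i"
      by (intro R.A_mult R.A_diff_power)
        (use d X Fr ideal_rho_generators(2)[OF assms(1)] in \<open>auto simp: gen_rho_def rho_exponents_def\<close>)
    finally show "single x 1 - (\<lambda>(p, a, b, c). single (p, a - min a c, b, c - min a c) 1 * Fr i ^ nat (min a c)) x
        \<in> ideal_rho G I i"
      by (simp add: pabc d_def)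
  qed
  finally show ?thesis .
qed

text \<open>In a normal monomial with a positive power of X_{i+1} the exponent of X_{i-1} is
  \<open>0\<close>, so its image has negative first exponents. The coefficients at
  \<open>0 \<le> a\<close> come unchanged from the monomials without X_{i+1}.\<close>

lemma lookup_Psim_normal:
  assumes "i < n" "normal f" "0 \<le> a"
  shows "lookup (Psim i f) (p, a, b) = lookup f (p, a, b, 0)"
proof -
  have *: "lookup (hm i x) (p, a, b) * lookup f x = (if x = (p, a, b, 0) then lookup f x else 0)"
    if "x \<in> keys f" for x
  proof -
    obtain p' a' b' c' where x: "x = (p', a', b', c')" by (cases x)
    have c: "0 \<le> c'" "a' = 0 \<or> c' = 0" using that assms(2) by (auto simp: x normal_def)
    show ?thesis
    proof (cases "c' = 0")
      case True
      then show ?thesis by (simp add: x hm_def eval_mono_def lookup_single when_def)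
    next
      case False
      then have "a' - c' < 0" using c by auto
      then have "(p, a, b) \<notin> keys (hm i x)"
        using keys_hm[OF assms(1) c(1), of "(p, a, b)" p' a' b'] assms(3) by (fastforce simp: x)
      then show ?thesis using False by (simp add: x in_keys_iff)
    qed
  qed
  have "lookup (Psim i f) (p, a, b) = (\<Sum>x\<in>keys f. if x = (p, a, b, 0) then lookup f x else 0)"
    unfolding Psim_def lookup_lext by (rule sum.cong[OF refl *])
  also have "\<dots> = lookup f (p, a, b, 0)"
    by (simp add: sum.delta in_keys_iff)
  finally show ?thesis .
qed

lemma lookup_Psip_normal:
  assumes "i < n" "normal f" "0 \<le> c"
  shows "lookup (Psip i f) (p, b, c) = lookup f (p, 0, b, c)"
proof -
  have *: "lookup (hp i x) (p, b, c) * lookup f x = (if x = (p, 0, b, c) then lookup f x else 0)"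
    if "x \<in> keys f" for x
  proof -
    obtain p' a' b' c' where x: "x = (p', a', b', c')" by (cases x)
    have c: "0 \<le> a'" "a' = 0 \<or> c' = 0" using that assms(2) by (auto simp: x normal_def)
    show ?thesis
    proof (cases "a' = 0")
      case True
      then show ?thesis by (simp add: x hp_def eval_mono_def lookup_single when_def)
    next
      case False
      then have "c' - a' < 0" using c by auto
      then have "(p, b, c) \<notin> keys (hp i x)"
        using keys_hp[OF assms(1) c(1), of "(p, b, c)" p' b' c'] assms(3) by (fastforce simp: x)
      then show ?thesis using False by (simp add: x in_keys_iff)
    qed
  qed
  have "lookup (Psip i f) (p, b, c) = (\<Sum>x\<in>keys f. if x = (p, 0, b, c) then lookup f x else 0)"
    unfolding Psip_def lookup_lext by (rule sum.cong[OF refl *])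
  also have "\<dots> = lookup f (p, 0, b, c)"
    by (simp add: sum.delta in_keys_iff)
  finally show ?thesis .
qed

text \<open>A negative first exponent arises only by eliminating X_{i+1}, and this adds an element
  of \<open>J\<close>. For consecutive layers \<open>K\<close> and \<open>K'\<close> such exponents
  are invisible modulo \<open>K'\<close>.\<close>

lemma Psim_negative:
  assumes "i < n" "normal f" "keys f \<subseteq> K \<times> UNIV" "\<And>k j. k \<in> K \<Longrightarrow> j \<in> J \<Longrightarrow> k + j \<in> K'"
    and "p \<notin> K'" "a < 0"
  shows "lookup (Psim i f) (p, a, b) = 0"
proof (rule ccontr)
  assume "lookup (Psim i f) (p, a, b) \<noteq> 0"
  then have "(p, a, b) \<in> keys (Psim i f)" by (simp add: in_keys_iff)
  then obtain x where x: "x \<in> keys f" "(p, a, b) \<in> keys (hm i x)"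
    using keys_lext[of "hm i" f] unfolding Psim_def by blast
  obtain p' a' b' c' where pabc: "x = (p', a', b', c')" by (cases x)
  have c: "0 \<le> c'" "0 \<le> a'" "p' \<in> K" using x(1) assms(2,3) by (auto simp: pabc normal_def)
  obtain s where "p = p' + s" "a = a' - c'" "0 < c' \<longrightarrow> s \<in> J"
    using keys_hm[OF assms(1) c(1) x(2)[unfolded pabc]] by blast
  then show False
    using assms(4)[OF c(3), of s] c assms(5,6) by simp
qed

lemma Psip_negative:
  assumes "i < n" "normal f" "keys f \<subseteq> K \<times> UNIV" "\<And>k j. k \<in> K \<Longrightarrow> j \<in> J \<Longrightarrow> k + j \<in> K'"
    and "p \<notin> K'" "c < 0"
  shows "lookup (Psip i f) (p, b, c) = 0"
proof (rule ccontr)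
  assume "lookup (Psip i f) (p, b, c) \<noteq> 0"
  then have "(p, b, c) \<in> keys (Psip i f)" by (simp add: in_keys_iff)
  then obtain x where x: "x \<in> keys f" "(p, b, c) \<in> keys (hp i x)"
    using keys_lext[of "hp i" f] unfolding Psip_def by blast
  obtain p' a' b' c' where pabc: "x = (p', a', b', c')" by (cases x)
  have c: "0 \<le> a'" "0 \<le> c'" "p' \<in> K" using x(1) assms(2,3) by (auto simp: pabc normal_def)
  obtain s where "p = p' + s" "c = c' - a'" "0 < a' \<longrightarrow> s \<in> J"
    using keys_hp[OF assms(1) c(1) x(2)[unfolded pabc]] by blast
  then show False
    using assms(4)[OF c(3), of s] c assms(5,6) by simp
qed

text \<open>The two maps together see every coefficient of a normal form: monomials without X_{i+1}
  through \<open>Psim\<close>, those without X_{i-1} through \<open>Psip\<close>. Hence a lift at a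
  ray is unique, as the \<open>THE\<close> in \<open>lift_ray\<close> requires.\<close>

lemma Psi_injective:
  assumes "i < n" "keys f \<subseteq> P \<times> rho_exponents"
    and "keys (Psim i f) \<subseteq> I \<times> UNIV" "keys (Psip i f) \<subseteq> I \<times> UNIV"
  shows "f \<in> ideal_rho G I i"
proof -
  interpret R: pm_quotient "{f :: ('p \<times> int \<times> int \<times> int) \<Rightarrow>\<^sub>0 'k. keys f \<subseteq> P \<times> rho_exponents}" "ideal_rho G I i"
    by (rule pm_quotient_rho[OF assms(1)])
  let ?N = "nf i f"
  have N: "normal ?N" by (rule normal_nf[OF assms(1,2)])
  have diff: "keys (Psim i f - Psim i ?N) \<subseteq> I \<times> UNIV" "keys (Psip i f - Psip i ?N) \<subseteq> I \<times> UNIV"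
    using Psim_ideal[OF assms(1) nf_cong[OF assms(1,2)]] Psip_ideal[OF assms(1) nf_cong[OF assms(1,2)]]
    by (simp_all add: Psim_diff Psip_diff)
  have "keys ?N \<subseteq> I \<times> rho_exponents"
  proof
    fix x assume x: "x \<in> keys ?N"
    obtain p a b c where pabc: "x = (p, a, b, c)" by (cases x)
    have ac: "0 \<le> a" "0 \<le> c" "a = 0 \<or> c = 0"
      using x N by (auto simp: pabc normal_def)
    have "p \<in> I"
    proof (rule ccontr)
      assume p: "p \<notin> I"
      have "(p, a, b) \<notin> keys (Psim i f)" "(p, b, c) \<notin> keys (Psip i f)"
        using assms(3,4) p by blast+
      then have "lookup (Psim i ?N) (p, a, b) = 0" "lookup (Psip i ?N) (p, b, c) = 0"
        using lookup_eq_if_keys_diff[OF diff(1), of "(p, a, b)"] lookup_eq_if_keys_diff[OF diff(2), of "(p, b, c)"] p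
        by (simp_all add: in_keys_iff)
      then have "lookup ?N x = 0"
        using ac lookup_Psim_normal[OF assms(1) N ac(1), of p b] lookup_Psip_normal[OF assms(1) N ac(2), of p b]
        by (auto simp: pabc)
      then show False using x by (simp add: in_keys_iff)
    qed
    then show "x \<in> I \<times> rho_exponents"
      using ac by (simp add: pabc rho_exponents_def)
  qed
  then have "?N \<in> ideal_rho G I i"
    by (rule ideal_rho_generators(1)[OF assms(1)])
  then show ?thesis
    using R.A_add[OF nf_cong[OF assms(1,2)], of ?N] by simp
qed

section \<open>Wall crossings\<close>

definition nxt :: "nat \<Rightarrow> nat" where "nxt i = Suc i mod n"

lemma nxt_less: "nxt i < n"
  using three by (simp add: nxt_def)

lemma nxt_neq: "i < n \<Longrightarrow> nxt i \<noteq> i"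
  using three by (cases "Suc i = n") (auto simp: nxt_def)

lemma coords_eq: "coords n i x = (x i, x (nxt i))"
  by (simp add: coords_def nxt_def)

lemma re_max_cone_int:
  assumes "re m \<in> max_cone_int n i"
  shows "0 < m i" "0 < m (nxt i)" "j \<noteq> i \<Longrightarrow> j \<noteq> nxt i \<Longrightarrow> m j = 0"
  using assms by (auto simp: max_cone_int_def max_cone_def re_def nxt_def)

lemma walls_inD:
  assumes "m \<in> walls_in G I i"
  shows "m \<in> trop_int n" "Gcd (range m) = 1" "re m \<in> max_cone_int n i"
  using assms wallD by (auto simp: walls_in_def)

lemma finite_walls_in: "finite (walls_in G I i)"
proof -
  have "walls_in G I i \<subseteq> fst ` {(m, f) \<in> diag G. \<not> trivial_mod I f}"
    by (force simp: walls_in_def)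
  then show ?thesis
    by (rule finite_subset) (rule finite_imageI[OF finite_nontrivial[OF I_ideal I_radical]])
qed

lemma primitive_coprime:
  assumes "Gcd (range m) = (1::int)" "\<And>j. j \<noteq> i \<Longrightarrow> j \<noteq> i' \<Longrightarrow> m j = 0"
  shows "coprime (m i) (m i')"
proof (rule coprimeI)
  fix d assume d: "d dvd m i" "d dvd m i'"
  have "d dvd m j" for j
    using d assms(2)[of j] by (cases "j = i"; cases "j = i'") auto
  then have "d dvd Gcd (range m)" by (auto intro: Gcd_greatest)
  then show "is_unit d" using assms(1) by simp
qed

text \<open>Generators are primitive: if two slopes agree, coprimality makes the first coordinates
  divide each other.\<close>

lemma inj_on_slope: "inj_on (\<lambda>m. slope n i (re m)) (walls_in G I i)"
proof (rule inj_onI)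
  fix m m' assume m: "m \<in> walls_in G I i" and m': "m' \<in> walls_in G I i"
    and eq: "slope n i (re m) = slope n i (re m')"
  note M = re_max_cone_int[OF walls_inD(3)[OF m]] re_max_cone_int[OF walls_inD(3)[OF m']]
  have "real_of_int (m (nxt i) * m' i) = real_of_int (m' (nxt i) * m i)"
    using eq M(1,4) by (simp add: slope_def re_def nxt_def frac_eq_eq)
  then have cross: "m (nxt i) * m' i = m' (nxt i) * m i"
    by (simp only: of_int_eq_iff)
  have cop: "coprime (m i) (m (nxt i))" "coprime (m' i) (m' (nxt i))"
    using primitive_coprime[OF walls_inD(2)[OF m]] primitive_coprime[OF walls_inD(2)[OF m']] M(3,6) by blast+
  have "m i dvd m (nxt i) * m' i" unfolding cross by simp
  then have 1: "m i dvd m' i" using cop(1) by (simp add: coprime_dvd_mult_right_iff)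
  have "m' i dvd m' (nxt i) * m i" unfolding cross[symmetric] by simp
  then have 2: "m' i dvd m i" using cop(2) by (simp add: coprime_dvd_mult_right_iff)
  have i: "m i = m' i" using zdvd_antisym_nonneg[OF _ _ 1 2] M(1,4) by simp
  then have "m (nxt i) = m' (nxt i)" using cross M(1) by simp
  then have "m j = m' j" for j
    using i M(3,6)[of j] by (cases "j = i"; cases "j = nxt i") auto
  then show "m = m'" by (rule ext)
qed

lemma set_sort_walls: "W \<subseteq> walls_in G I i \<Longrightarrow> set (sort_walls G i W) = W"
proof -
  assume W: "W \<subseteq> walls_in G I i"
  show ?thesis
    unfolding sort_walls_def
    by (rule set_sorted_key_list_of_set_inj[OF inj_on_slope W finite_subset[OF W finite_walls_in]])
qed

lemma walls_trivial_mod_J: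
  assumes "m \<in> walls_in G I i" "i < n" "(m, f) \<in> diag G"
  shows "trivial_mod J f"
proof (rule wallD(4)[OF assms(3)])
  fix j assume "j < n"
  show "m \<noteq> unit_vec j"
  proof
    assume "m = unit_vec j"
    then have "i = j" "nxt i = j"
      using re_max_cone_int(1,2)[OF walls_inD(3)[OF assms(1)]] by (auto simp: unit_vec_def split: if_splits)
    then show False using nxt_neq[OF assms(2)] by simp
  qed
qed

definition wfn :: "nat \<Rightarrow> (nat \<Rightarrow> int) \<Rightarrow> ('p \<times> int \<times> int) \<Rightarrow>\<^sub>0 'k" where
  "wfn i m = push (\<lambda>(s, k). (s, k * m i, k * m (nxt i))) (ray_fun G I m)"

text \<open>A truncated geometric series. For a wall inside the cone,
  \<open>(1 - wfn i m) ^ nil\<close> has exponents in \<open>Jpow nil\<close>, hence in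
  \<open>I\<close>, so this is an inverse of \<open>wfn i m\<close> modulo \<open>I\<close>.\<close>

definition winv :: "nat \<Rightarrow> (nat \<Rightarrow> int) \<Rightarrow> ('p \<times> int \<times> int) \<Rightarrow>\<^sub>0 'k" where
  "winv i m = (\<Sum>k<nil. (1 - wfn i m) ^ k)"

text \<open>The image of a monomial under the crossing in the direction \<open>e = 1\<close>, from
  the ray \<open>i\<close> towards the next ray.\<close>

definition wmono :: "nat \<Rightarrow> (nat \<Rightarrow> int) \<Rightarrow> 'p \<times> int \<times> int \<Rightarrow> ('p \<times> int \<times> int) \<Rightarrow>\<^sub>0 'k" where
  "wmono i m x = single x 1 * sig.ipow (wfn i m) (winv i m) (m (nxt i) * fst (snd x) - m i * snd (snd x))"

definition Wc :: "nat \<Rightarrow> (nat \<Rightarrow> int) \<Rightarrow> (('p \<times> int \<times> int) \<Rightarrow>\<^sub>0 'k) \<Rightarrow> ('p \<times> int \<times> int) \<Rightarrow>\<^sub>0 'k" where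
  "Wc i m f = lext (wmono i m) f"

lemma monoid_pair_J: "monoid_pair (P \<times> (UNIV :: (int \<times> int) set)) (J \<times> UNIV)"
  by (rule monoid_pair_UNIV[OF J_ideal])

lemma keys_wfn: "keys (wfn i m) \<subseteq> P \<times> UNIV"
  unfolding wfn_def by (rule keys_push_subset) (use keys_ray_fun[OF fine_ideal_I, of m] in auto)

lemma keys_wfn_minus_one:
  assumes "m \<in> walls_in G I i" "i < n"
  shows "keys (wfn i m - 1) \<subseteq> J \<times> UNIV"
proof -
  have "push (\<lambda>(s, k). (s, k * m i, k * m (nxt i))) (1 :: ('p \<times> int) \<Rightarrow>\<^sub>0 'k) =
      push (\<lambda>(s, k). (s, k * m i, k * m (nxt i))) (single (0, 0) 1)"
    by (simp flip: zero_prod_def)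
  also have "\<dots> = 1"
    by (simp add: single_zero3 del: single_one)
  finally have "wfn i m - 1 = push (\<lambda>(s, k). (s, k * m i, k * m (nxt i))) (ray_fun G I m - 1)"
    by (simp add: wfn_def push_diff)
  then show ?thesis
    using ray_fun_trivial_mod[of m] walls_trivial_mod_J[OF assms] by (auto intro!: keys_push_subset)
qed

lemma keys_wfn_pow:
  assumes "m \<in> walls_in G I i" "i < n"
  shows "keys ((1 - wfn i m) ^ k) \<subseteq> Jpow k \<times> UNIV"
proof (induction k)
  case 0
  then show ?case by (simp add: P_zero zero_prod_def)
next
  case (Suc k)
  have 1: "keys (1 - wfn i m) \<subseteq> J \<times> UNIV"
    using keys_wfn_minus_one[OF assms] keys_uminus[of "wfn i m - 1"] by simp
  show ?case
    unfolding power_Suc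
  proof (rule keys_mult_subset)
    fix x y assume xy: "x \<in> keys (1 - wfn i m)" "y \<in> keys ((1 - wfn i m) ^ k)"
    have "fst x \<in> J" "fst y \<in> Jpow k" using 1 Suc xy by auto
    then have "fst (x + y) \<in> Jpow (Suc k)" by auto
    then show "x + y \<in> Jpow (Suc k) \<times> UNIV" by (simp add: mem_Times_iff)
  qed
qed

lemma wfn_winv:
  assumes "m \<in> walls_in G I i" "i < n"
  shows "keys (wfn i m * winv i m - 1) \<subseteq> I \<times> UNIV" "keys (winv i m) \<subseteq> P \<times> UNIV"
    "keys (winv i m - 1) \<subseteq> J \<times> UNIV"
proof -
  interpret j: monoid_pair "P \<times> (UNIV :: (int \<times> int) set)" "J \<times> UNIV" "TYPE('k)"
    by (rule monoid_pair_J)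
  have "1 - (1 - wfn i m) ^ nil = wfn i m * winv i m"
    unfolding winv_def using one_diff_power_eq[of "1 - wfn i m" nil] by simp
  then have "wfn i m * winv i m - 1 = - ((1 - wfn i m) ^ nil)"
    by (simp add: algebra_simps)
  then show 1: "keys (wfn i m * winv i m - 1) \<subseteq> I \<times> UNIV"
    using keys_wfn_pow[OF assms, of nil] Jpow_nil by (simp only: keys_uminus) blast
  have "winv i m \<in> {f. keys f \<subseteq> P \<times> UNIV}"
    unfolding winv_def
    by (intro sig.S_sum sig.S_power sig.S_diff sig.S_one) (simp add: keys_wfn)
  then show 2: "keys (winv i m) \<subseteq> P \<times> UNIV" by simp
  have "winv i m - 1 = (wfn i m * winv i m - 1) - (wfn i m - 1) * winv i m"
    by (simp add: algebra_simps)
  also have "\<dots> \<in> {f. keys f \<subseteq> J \<times> UNIV}"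
    by (rule j.A_diff[OF _ j.A_mult_right]) (use 1 2 I_subset_J keys_wfn_minus_one[OF assms] in blast)+
  finally show "keys (winv i m - 1) \<subseteq> J \<times> UNIV" by simp
qed

lemma keys_ipow:
  assumes "m \<in> walls_in G I i" "i < n"
  shows "keys (sig.ipow (wfn i m) (winv i m) e) \<subseteq> P \<times> UNIV"
  using sig.ipow_in_S[of "wfn i m" "winv i m" e] keys_wfn[of i m] wfn_winv(2)[OF assms] by simp

lemma keys_ipow_minus_one:
  assumes "m \<in> walls_in G I i" "i < n"
  shows "keys (sig.ipow (wfn i m) (winv i m) e - 1) \<subseteq> J \<times> UNIV"
proof -
  interpret j: monoid_pair "P \<times> (UNIV :: (int \<times> int) set)" "J \<times> UNIV" "TYPE('k)"
    by (rule monoid_pair_J)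
  have "wfn i m ^ k - 1 ^ k \<in> {f. keys f \<subseteq> J \<times> UNIV}" "winv i m ^ k - 1 ^ k \<in> {f. keys f \<subseteq> J \<times> UNIV}" for k
    using keys_wfn_minus_one[OF assms] wfn_winv(2,3)[OF assms] keys_wfn[of i m]
    by (intro j.A_diff_power[OF _ _ j.S_one]; simp)+
  then show ?thesis by (simp add: sig.ipow_def)
qed

lemma keys_wmono:
  assumes "m \<in> walls_in G I i" "i < n" "y \<in> keys (wmono i m (p, x))"
  shows "\<exists>s\<in>P. fst y = p + s"
proof -
  obtain u where "u \<in> keys (sig.ipow (wfn i m) (winv i m) (m (nxt i) * fst x - m i * snd x))" "y = (p, x) + u"
    using keys_single_times assms(3) unfolding wmono_def by fastforce
  then show ?thesis using keys_ipow[OF assms(1,2)] by fastforce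
qed

lemma keys_Wc:
  assumes "m \<in> walls_in G I i" "i < n" "monoid_ideal P K" "keys f \<subseteq> K \<times> UNIV"
  shows "keys (Wc i m f) \<subseteq> K \<times> UNIV"
proof
  fix y assume "y \<in> keys (Wc i m f)"
  then obtain x where x: "x \<in> keys f" "y \<in> keys (wmono i m x)"
    using keys_lext[of "wmono i m" f] unfolding Wc_def by blast
  obtain s where "s \<in> P" "fst y = fst x + s"
    using keys_wmono[OF assms(1,2), of y "fst x" "snd x"] x(2) by auto
  moreover have "fst x \<in> K" using x(1) assms(4) by auto
  ultimately show "y \<in> K \<times> UNIV" by (simp add: mem_Times_iff ideal_add'[OF assms(3)])
qed

lemma Wc_add: "Wc i m (f + g) = Wc i m f + Wc i m g"
  and Wc_diff: "Wc i m (f - g) = Wc i m f - Wc i m g"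
  and Wc_sum: "Wc i m (sum h T) = (\<Sum>x\<in>T. Wc i m (h x))"
  by (simp_all add: Wc_def lext_add lext_diff lext_sum)

lemma Wc_const: "Wc i m (push (\<lambda>p. (p, 0, 0)) a) = push (\<lambda>p. (p, 0, 0)) a"
  unfolding Wc_def lext_push wmono_def by (simp add: push_lext sig.ipow_def)

text \<open>Multiplicative only modulo \<open>I\<close>, because \<open>winv i m\<close> inverts
  \<open>wfn i m\<close> only there.\<close>

lemma Wc_mult:
  assumes "m \<in> walls_in G I i" "i < n" "keys f \<subseteq> P \<times> UNIV" "keys g \<subseteq> P \<times> UNIV"
  shows "keys (Wc i m (f * g) - Wc i m f * Wc i m g) \<subseteq> I \<times> UNIV"
proof -
  have wS: "wfn i m \<in> {f. keys f \<subseteq> P \<times> UNIV}" "winv i m \<in> {f. keys f \<subseteq> P \<times> UNIV}"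
    using keys_wfn[of i m] wfn_winv(2)[OF assms(1,2)] by auto
  have wI: "wfn i m * winv i m - 1 \<in> {f. keys f \<subseteq> I \<times> UNIV}"
    using wfn_winv(1)[OF assms(1,2)] by auto
  have "Wc i m (f * g) - Wc i m f * Wc i m g \<in> {f. keys f \<subseteq> I \<times> UNIV}"
    unfolding Wc_def
  proof (rule sig.lext_mult[OF assms(3,4)])
    fix x y :: "'p \<times> int \<times> int"
    let ?e = "\<lambda>x. m (nxt i) * fst (snd x) - m i * snd (snd x)"
    let ?u = "sig.ipow (wfn i m) (winv i m)"
    assume xy: "x \<in> P \<times> UNIV" "y \<in> P \<times> UNIV"
    have e: "?e (x + y) = ?e x + ?e y" by (simp add: algebra_simps)
    have s: "single (x + y) (1::'k) = single x 1 * single y 1" by (simp add: mult_single)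
    have "wmono i m (x + y) - wmono i m x * wmono i m y =
        (single x 1 * single y 1) * (?u (?e x + ?e y) - ?u (?e x) * ?u (?e y))"
      unfolding wmono_def e s by (simp add: algebra_simps)
    also have "\<dots> \<in> {f. keys f \<subseteq> I \<times> UNIV}"
      by (rule sig.A_mult[OF sig.S_mult sig.ipow_add[OF wS wI]]) (use xy in auto)
    finally show "wmono i m (x + y) - wmono i m x * wmono i m y \<in> {f. keys f \<subseteq> I \<times> UNIV}" .
  qed
  then show ?thesis by simp
qed

text \<open>Walls inside a cone have functions congruent to \<open>1\<close> modulo \<open>J\<close>, so wall crossings act trivially on
  the graded pieces of the \<open>J\<close>-adic filtration.\<close>

lemma Wc_layer:
  assumes "m \<in> walls_in G I i" "i < n" "keys f \<subseteq> K \<times> UNIV" "\<And>k j. k \<in> K \<Longrightarrow> j \<in> J \<Longrightarrow> k + j \<in> K'"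
  shows "keys (Wc i m f - f) \<subseteq> K' \<times> UNIV"
proof -
  have "f = lext (\<lambda>x. single x 1) f"
    by (simp add: lext_def single_mult_zero sum_single_lookup)
  then have "Wc i m f - f = lext (\<lambda>x. wmono i m x - single x 1) f"
    unfolding Wc_def by (simp add: lext_def left_diff_distrib sum_subtractf)
  also have "keys \<dots> \<subseteq> K' \<times> UNIV"
  proof
    fix y assume "y \<in> keys (lext (\<lambda>x. wmono i m x - single x 1) f)"
    then obtain x where x: "x \<in> keys f" "y \<in> keys (wmono i m x - single x 1)"
      using keys_lext[of "\<lambda>x. wmono i m x - single x 1" f] by blast
    define e where "e = m (nxt i) * fst (snd x) - m i * snd (snd x)"
    have "y \<in> keys (single x 1 * (sig.ipow (wfn i m) (winv i m) e - 1))"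
      using x(2) by (simp add: wmono_def right_diff_distrib e_def)
    then obtain u where u: "u \<in> keys (sig.ipow (wfn i m) (winv i m) e - 1)" "y = x + u"
      using keys_single_times by blast
    have "fst u \<in> J" "fst x \<in> K"
      using subsetD[OF keys_ipow_minus_one[OF assms(1,2)] u(1)] subsetD[OF assms(3) x(1)]
      by (simp_all add: mem_Times_iff)
    then show "y \<in> K' \<times> UNIV"
      using assms(4) by (simp add: u(2) mem_Times_iff)
  qed
  finally show ?thesis .
qed

text \<open>Each summand is a product with an integer power in the quotient, which
  \<open>cls_int_pow\<close> turns into a power of \<open>wfn\<close> or \<open>winv\<close>. So the
  crossing is computed by a linear extension on any representative.\<close>

lemma wall_crossing_cls:
  assumes "m \<in> walls_in G I i" "i < n" "keys f \<subseteq> P \<times> UNIV"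
  shows "wall_crossing G I i 1 m (sig.cls f) = sig.cls (Wc i m f)"
proof -
  interpret Q: cring sig.Q by (rule sig.cring_Q)
  define g where "g = (SOME g. g \<in> sig.cls f)"
  have g: "keys g \<subseteq> P \<times> UNIV" "keys (g - f) \<subseteq> I \<times> UNIV"
    using sig.some_rep[of f] assms(3) by (auto simp: g_def)
  have wS: "wfn i m \<in> {f. keys f \<subseteq> P \<times> UNIV}" "winv i m \<in> {f. keys f \<subseteq> P \<times> UNIV}"
    using keys_wfn[of i m] wfn_winv(2)[OF assms(1,2)] by auto
  have wI: "wfn i m * winv i m - 1 \<in> {f. keys f \<subseteq> I \<times> UNIV}"
    using wfn_winv(1)[OF assms(1,2)] by auto
  let ?e = "\<lambda>x. m (nxt i) * fst (snd x) - m i * snd (snd x)"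
  have S: "single x c \<in> {f. keys f \<subseteq> P \<times> UNIV}" if "x \<in> keys g" for x and c :: 'k
    using g(1) that by auto
  have summand: "sig.cls (single x (lookup g x)) \<otimes>\<^bsub>sig.Q\<^esub> sig.cls (wfn i m) [^]\<^bsub>sig.Q\<^esub> (1 * ?e x) =
      sig.cls (wmono i m x * single 0 (lookup g x))" if x: "x \<in> keys g" for x
  proof -
    have "single x (lookup g x) * sig.ipow (wfn i m) (winv i m) (?e x) = wmono i m x * single 0 (lookup g x)"
      unfolding single_mult_zero[of x "lookup g x", symmetric] wmono_def by (simp only: mult_ac)
    then show ?thesis
      using sig.cls_mult[OF S[OF x] sig.ipow_in_S[OF wS]]
      by (simp only: sig.cls_int_pow[OF wS wI] sig.ipow_def[symmetric] mult_1_left)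
  qed
  have inS: "wmono i m x * single 0 (lookup g x) \<in> {f. keys f \<subseteq> P \<times> UNIV}" if x: "x \<in> keys g" for x
    unfolding wmono_def by (intro sig.S_mult S[OF x] sig.ipow_in_S[OF wS] sig.S_const)
  have "wall_crossing G I i 1 m (sig.cls f) =
      finsum sig.Q (\<lambda>x. sig.cls (single x (lookup g x)) \<otimes>\<^bsub>sig.Q\<^esub> sig.cls (wfn i m) [^]\<^bsub>sig.Q\<^esub> (1 * ?e x)) (keys g)"
    unfolding wall_crossing_def Let_def coords_eq prod.case ring_sigma_eq cls_sigma_eq g_def[symmetric] wfn_def
    by (simp add: split_def)
  also have "\<dots> = finsum sig.Q (\<lambda>x. sig.cls (wmono i m x * single 0 (lookup g x))) (keys g)"
    by (rule Q.finsum_cong') (use inS in \<open>auto simp only: summand intro!: sig.cls_in_carrier\<close>)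
  also have "\<dots> = sig.cls (Wc i m g)"
    unfolding Wc_def lext_def by (rule sig.finsum_cls) (simp_all only: finite_keys inS)
  also have "\<dots> = sig.cls (Wc i m f)"
    using keys_Wc[OF assms(1,2) I_ideal g(2)] by (intro sig.cls_eqI) (simp add: Wc_diff)
  finally show ?thesis .
qed


subsection \<open>Sequences of wall crossings\<close>

definition Wf :: "nat \<Rightarrow> (nat \<Rightarrow> int) list \<Rightarrow> (('p \<times> int \<times> int) \<Rightarrow>\<^sub>0 'k) \<Rightarrow> ('p \<times> int \<times> int) \<Rightarrow>\<^sub>0 'k" where
  "Wf i ms = fold (Wc i) ms"

lemma keys_Wf:
  "set ms \<subseteq> walls_in G I i \<Longrightarrow> i < n \<Longrightarrow> monoid_ideal P K \<Longrightarrow> keys f \<subseteq> K \<times> UNIV \<Longrightarrow> keys (Wf i ms f) \<subseteq> K \<times> UNIV"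
  unfolding Wf_def by (induction ms arbitrary: f) (auto dest: keys_Wc)

lemma Wf_add: "Wf i ms (f + g) = Wf i ms f + Wf i ms g"
  unfolding Wf_def by (induction ms arbitrary: f g) (auto simp: Wc_add)

lemma Wf_diff: "Wf i ms (f - g) = Wf i ms f - Wf i ms g"
  unfolding Wf_def by (induction ms arbitrary: f g) (auto simp: Wc_diff)

lemma Wf_sum: "Wf i ms (sum h T) = (\<Sum>x\<in>T. Wf i ms (h x))"
  unfolding Wf_def by (induction ms arbitrary: h) (auto simp: Wc_sum)

lemma Wf_const: "Wf i ms (push (\<lambda>p. (p, 0, 0)) a) = push (\<lambda>p. (p, 0, 0)) a"
  unfolding Wf_def by (induction ms) (auto simp: Wc_const)

lemma Wf_cong:
  assumes "set ms \<subseteq> walls_in G I i" "i < n" "keys (f - g) \<subseteq> I \<times> UNIV"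
  shows "keys (Wf i ms f - Wf i ms g) \<subseteq> I \<times> UNIV"
  using keys_Wf[OF assms(1,2) I_ideal assms(3)] by (simp add: Wf_diff)

lemma Wf_mult:
  assumes "set ms \<subseteq> walls_in G I i" "i < n" "keys f \<subseteq> P \<times> UNIV" "keys g \<subseteq> P \<times> UNIV"
  shows "keys (Wf i ms (f * g) - Wf i ms f * Wf i ms g) \<subseteq> I \<times> UNIV"
  using assms
proof (induction ms arbitrary: f g)
  case Nil
  then show ?case by (simp add: Wf_def)
next
  case (Cons m ms)
  have m: "m \<in> walls_in G I i" "set ms \<subseteq> walls_in G I i" using Cons.prems(1) by auto
  have step: "Wf i (m # ms) h = Wf i ms (Wc i m h)" for h by (simp add: Wf_def)
  have "keys (Wf i ms (Wc i m (f * g)) - Wf i ms (Wc i m f * Wc i m g)) \<subseteq> I \<times> UNIV"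
    by (rule Wf_cong[OF m(2) Cons.prems(2) Wc_mult[OF m(1) Cons.prems(2-4)]])
  moreover have "keys (Wf i ms (Wc i m f * Wc i m g) - Wf i ms (Wc i m f) * Wf i ms (Wc i m g)) \<subseteq> I \<times> UNIV"
    by (rule Cons.IH[OF m(2) Cons.prems(2)]) (rule keys_Wc[OF m(1) Cons.prems(2) P_ideal], rule Cons.prems)+
  ultimately show ?case
    unfolding step using sig.A_diff_trans by blast
qed

text \<open>Each crossing preserves the layer \<open>K\<close> and changes the function only within
  \<open>K'\<close>, so the changes add up inside \<open>K'\<close>.\<close>

lemma Wf_layer:
  assumes "set ms \<subseteq> walls_in G I i" "i < n" "monoid_ideal P K" "monoid_ideal P K'"
    "keys f \<subseteq> K \<times> UNIV" "\<And>k j. k \<in> K \<Longrightarrow> j \<in> J \<Longrightarrow> k + j \<in> K'"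
  shows "keys (Wf i ms f - f) \<subseteq> K' \<times> UNIV"
  using assms(1,5)
proof (induction ms arbitrary: f)
  case Nil
  then show ?case by (simp add: Wf_def)
next
  case (Cons m ms)
  interpret K': monoid_pair "P \<times> (UNIV :: (int \<times> int) set)" "K' \<times> UNIV" "TYPE('k)"
    by (rule monoid_pair_UNIV[OF assms(4)])
  have m: "m \<in> walls_in G I i" "set ms \<subseteq> walls_in G I i" using Cons.prems(1) by auto
  have "keys (Wf i ms (Wc i m f) - Wc i m f) \<subseteq> K' \<times> UNIV"
    by (rule Cons.IH[OF m(2) keys_Wc[OF m(1) assms(2,3) Cons.prems(2)]])
  moreover have "keys (Wc i m f - f) \<subseteq> K' \<times> UNIV"
    by (rule Wc_layer[OF m(1) assms(2) Cons.prems(2) assms(6)])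
  ultimately show ?case
    using K'.A_diff_trans[of "Wf i ms (Wc i m f)" "Wc i m f" f] by (simp add: Wf_def)
qed

lemma fold_wall_crossing:
  assumes "set ms \<subseteq> walls_in G I i" "i < n" "keys f \<subseteq> P \<times> UNIV"
  shows "fold (wall_crossing G I i 1) ms (sig.cls f) = sig.cls (Wf i ms f)"
  using assms(1,3)
proof (induction ms arbitrary: f)
  case (Cons m ms)
  then show ?case
    using keys_Wc[OF _ assms(2) P_ideal, of m f] by (simp add: Wf_def wall_crossing_cls[OF _ assms(2)])
qed (simp add: Wf_def)

section \<open>Points and sectors of the tropicalization\<close>

lemma max_cone_iff: "x \<in> max_cone n i \<longleftrightarrow> (\<forall>j. 0 \<le> x j) \<and> (\<forall>j. j \<noteq> i \<and> j \<noteq> nxt i \<longrightarrow> x j = 0)"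
  by (simp add: max_cone_def nxt_def)

lemma max_cone_int_iff: "x \<in> max_cone_int n i \<longleftrightarrow> x \<in> max_cone n i \<and> 0 < x i \<and> 0 < x (nxt i)"
  by (simp add: max_cone_int_def nxt_def)

lemma slope_eq: "slope n i x = x (nxt i) / x i"
  by (simp add: slope_def nxt_def)

lemma trop_iff: "x \<in> trop n \<longleftrightarrow> (\<exists>i<n. x \<in> max_cone n i)"
  by (auto simp: trop_def)

lemma re_unit_vec: "re (unit_vec i) j = (if j = i then 1 else 0)"
  by (simp add: re_def unit_vec_def)

lemma unit_vec_trop_int: "i < n \<Longrightarrow> unit_vec i \<in> trop_int n"
  unfolding trop_int_def mem_Collect_eq trop_iff
  by (intro exI[of _ i]) (auto simp: max_cone_iff re_unit_vec)

lemma nxt_cases: "i < n \<Longrightarrow> nxt i = (if Suc i = n then 0 else Suc i)"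
  by (auto simp: nxt_def)

lemma nxt_inj: "i < n \<Longrightarrow> j < n \<Longrightarrow> nxt i = nxt j \<Longrightarrow> i = j"
  by (auto simp: nxt_cases split: if_splits)

lemma nxt_nxt_neq: "i < n \<Longrightarrow> nxt (nxt i) \<noteq> i"
  using three by (auto simp: nxt_cases nxt_less split: if_splits)

lemma prv_nxt: "i < n \<Longrightarrow> prv n (nxt i) = i"
  using three by (auto simp: nxt_cases prv_def)

lemma prv_less: "prv n i < n"
  using three by (simp add: prv_def)

lemma nxt_prv: "i < n \<Longrightarrow> nxt (prv n i) = i"
  using three by (cases i) (auto simp: nxt_def prv_def mod_Suc)

text \<open>The boundary rays of a cone are rational, with generators \<open>unit_vec i\<close> and
  \<open>unit_vec (nxt i)\<close>.\<close>

lemma irrational_interior: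
  assumes "Q \<in> irrational_points n" "Q \<in> max_cone n i" "i < n"
  shows "Q \<in> max_cone_int n i"
proof -
  have no: "\<And>m. m \<in> trop_int n \<Longrightarrow> Q \<notin> ray_through m"
    using assms(1) by (auto simp: irrational_points_def)
  have C: "0 \<le> Q j" "j \<noteq> i \<Longrightarrow> j \<noteq> nxt i \<Longrightarrow> Q j = 0" for j
    using assms(2) by (auto simp: max_cone_iff)
  have "Q i \<noteq> 0"
  proof
    assume "Q i = 0"
    then have "Q j = Q (nxt i) * re (unit_vec (nxt i)) j" for j
      using C(2)[of j] by (cases "j = i") (auto simp: re_unit_vec)
    then have "Q = (\<lambda>j. Q (nxt i) * re (unit_vec (nxt i)) j)" by blast
    then have "Q \<in> ray_through (unit_vec (nxt i))"
      unfolding ray_through_def using C(1)[of "nxt i"] by blast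
    then show False using no[OF unit_vec_trop_int[OF nxt_less]] by blast
  qed
  moreover have "Q (nxt i) \<noteq> 0"
  proof
    assume "Q (nxt i) = 0"
    then have "Q j = Q i * re (unit_vec i) j" for j
      using C(2)[of j] by (cases "j = nxt i") (auto simp: re_unit_vec)
    then have "Q = (\<lambda>j. Q i * re (unit_vec i) j)" by blast
    then have "Q \<in> ray_through (unit_vec i)"
      unfolding ray_through_def using C(1)[of i] by blast
    then show False using no[OF unit_vec_trop_int[OF assms(3)]] by blast
  qed
  ultimately show ?thesis
    using assms(2) C(1)[of i] C(1)[of "nxt i"] by (simp add: max_cone_int_iff)
qed

text \<open>Distinct cones share at most one coordinate direction, because the cycle has at least
  three rays.\<close>

lemma interior_unique:
  assumes "Q \<in> max_cone_int n i" "Q \<in> max_cone n j" "i < n" "j < n"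
  shows "i = j"
proof (rule ccontr)
  assume "i \<noteq> j"
  have pos: "Q i > 0" "Q (nxt i) > 0" using assms(1) by (simp_all add: max_cone_int_iff)
  have zero: "l = j \<or> l = nxt j" if "Q l > 0" for l
    using assms(2) that by (auto simp: max_cone_iff)
  have i: "i = nxt j" using zero[OF pos(1)] \<open>i \<noteq> j\<close> by simp
  have "nxt i = j \<or> nxt i = nxt j" by (rule zero[OF pos(2)])
  then have "nxt (nxt j) = j \<or> nxt i = nxt j" unfolding i .
  then show False
    using nxt_inj[OF assms(3,4)] nxt_nxt_neq[OF assms(4)] \<open>i \<noteq> j\<close> i by simp
qed

definition pt :: "nat \<Rightarrow> real \<Rightarrow> real \<Rightarrow> nat \<Rightarrow> real" where
  "pt i a b j = (if j = i then a else if j = nxt i then b else 0)"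

lemma pt_simps:
  assumes "i < n"
  shows "pt i a b i = a" "pt i a b (nxt i) = b" "slope n i (pt i a b) = b / a"
    "pt i a b \<in> max_cone n i \<longleftrightarrow> 0 \<le> a \<and> 0 \<le> b"
    "pt i a b \<in> max_cone_int n i \<longleftrightarrow> 0 < a \<and> 0 < b"
proof -
  show v: "pt i a b i = a" "pt i a b (nxt i) = b"
    using nxt_neq[OF assms] by (simp_all add: pt_def)
  then show "slope n i (pt i a b) = b / a" by (simp add: slope_eq)
  have "(\<forall>j. 0 \<le> pt i a b j) \<longleftrightarrow> 0 \<le> a \<and> 0 \<le> b"
  proof
    assume "\<forall>j. 0 \<le> pt i a b j"
    then show "0 \<le> a \<and> 0 \<le> b" using v by metis
  qed (simp add: pt_def)
  moreover have "\<forall>j. j \<noteq> i \<and> j \<noteq> nxt i \<longrightarrow> pt i a b j = 0" by (simp add: pt_def)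
  ultimately show "pt i a b \<in> max_cone n i \<longleftrightarrow> 0 \<le> a \<and> 0 \<le> b"
    by (simp add: max_cone_iff)
  then show "pt i a b \<in> max_cone_int n i \<longleftrightarrow> 0 < a \<and> 0 < b"
    unfolding max_cone_int_iff v by auto
qed

lemma pt_eq: "i < n \<Longrightarrow> x \<in> max_cone n i \<Longrightarrow> x = pt i (x i) (x (nxt i))"
  by (auto simp: pt_def max_cone_iff)

lemma continuous_on_pt:
  assumes "continuous_on T f" "continuous_on T g"
  shows "continuous_on T (\<lambda>t. pt i (f t) (g t))"
proof (rule continuous_on_coordinatewise_then_product)
  fix j
  show "continuous_on T (\<lambda>t. pt i (f t) (g t) j)"
    by (cases "j = i"; cases "j = nxt i") (simp_all add: pt_def assms)
qed

text \<open>A positive rational first coordinate and an irrational second one give an irrational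
  ratio, so the point avoids all rational rays.\<close>

lemma irrational_point_exists:
  assumes "i < n" "0 \<le> a" "0 \<le> b" "0 < \<delta>" "0 < \<delta>'"
  shows "\<exists>u v. a < u \<and> u < a + \<delta> \<and> b < v \<and> v < b + \<delta>' \<and> pt i u v \<in> irrational_points n"
proof -
  obtain u where u: "u \<in> \<rat>" "a < u" "u < a + \<delta>"
    using Rats_dense_in_real[of a "a + \<delta>"] assms(4) by auto
  obtain v where v: "v \<in> {b<..<b + \<delta>'}" "v \<notin> \<rat>"
    using open_minus_countable[OF countable_rat, of "{b<..<b + \<delta>'}"] assms(5) by auto
  have "pt i u v \<in> irrational_points n"
    unfolding irrational_points_def
  proof (intro DiffI notI)
    show "pt i u v \<in> trop n"
      unfolding trop_iff using assms u v by (intro exI[of _ i]) (auto simp: pt_simps)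
    assume "pt i u v \<in> (\<Union>m\<in>trop_int n. ray_through m)"
    then obtain m r where "pt i u v = (\<lambda>j. r * re m j)"
      by (auto simp: ray_through_def)
    then have "u = r * real_of_int (m i)" "v = r * real_of_int (m (nxt i))"
      using pt_simps(1,2)[OF assms(1), of u v] by (simp_all add: re_def)
    then have "v = u * real_of_int (m (nxt i)) / real_of_int (m i)"
      using u(2) assms(2) by auto
    then show False using u(1) v(2) by auto
  qed
  then show ?thesis using u v by (intro exI[of _ u] exI[of _ v]) auto
qed

lemma irrational_point_near:
  assumes "i < n" "q \<in> trop_int n" "re q \<in> max_cone n i" "0 < \<epsilon>"
  shows "\<exists>z\<in>irrational_points n. z \<in> max_cone n i \<and> (\<forall>j. \<bar>z j - real_of_int (q j)\<bar> < \<epsilon>)"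
proof -
  have q: "0 \<le> real_of_int (q i)" "0 \<le> real_of_int (q (nxt i))" "\<And>j. j \<noteq> i \<Longrightarrow> j \<noteq> nxt i \<Longrightarrow> q j = 0"
    using assms(3) by (auto simp: max_cone_iff re_def)
  obtain u v :: real where uv: "q i < u" "u < q i + \<epsilon>" "q (nxt i) < v" "v < q (nxt i) + \<epsilon>"
    "pt i u v \<in> irrational_points n"
    using irrational_point_exists[OF assms(1) q(1,2) assms(4,4)] by blast
  have "\<bar>pt i u v j - real_of_int (q j)\<bar> < \<epsilon>" for j
    using uv q(3)[of j] assms(4) by (auto simp: pt_def)
  moreover have "pt i u v \<in> max_cone n i"
    using uv q(1,2) by (simp add: pt_simps[OF assms(1)])
  ultimately show ?thesis using uv(5) by blast
qed

lemma irrational_slope: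
  assumes "Q \<in> irrational_points n" "Q \<in> max_cone_int n i" "m \<in> walls_in G I i" "i < n"
  shows "slope n i Q \<noteq> slope n i (re m)"
proof
  assume eq: "slope n i Q = slope n i (re m)"
  note M = re_max_cone_int[OF walls_inD(3)[OF assms(3)]]
  have Q: "0 < Q i" "\<And>j. j \<noteq> i \<Longrightarrow> j \<noteq> nxt i \<Longrightarrow> Q j = 0"
    using assms(2) by (auto simp: max_cone_int_iff max_cone_iff)
  let ?r = "Q i / real_of_int (m i)"
  have "Q (nxt i) = ?r * real_of_int (m (nxt i))"
    using eq Q(1) M(1) by (simp add: slope_eq re_def field_simps)
  then have "Q j = ?r * re m j" for j
    using Q(2)[of j] M(1) M(3)[of j] by (cases "j = i"; cases "j = nxt i") (auto simp: re_def)
  then have "Q = (\<lambda>j. ?r * re m j)" by blast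
  moreover have "0 \<le> ?r" using Q(1) M(1) by simp
  ultimately have "Q \<in> ray_through m" unfolding ray_through_def by blast
  then show False
    using assms(1) walls_inD(1)[OF assms(3)] by (auto simp: irrational_points_def)
qed

lemma supp_slope:
  assumes "x \<in> supp G I" "x \<in> max_cone_int n i"
  shows "\<exists>m\<in>walls_in G I i. slope n i x = slope n i (re m)"
proof -
  obtain m f r where m: "(m, f) \<in> diag G" "\<not> trivial_mod I f" "x = (\<lambda>j. r * re m j)" "0 \<le> r"
    using assms(1) by (auto simp: supp_def ray_through_def)
  have r: "0 < r"
    using m(3,4) assms(2) by (cases "r = 0") (auto simp: max_cone_int_iff)
  have "re m \<in> max_cone_int n i"
    using assms(2) r unfolding m(3) max_cone_int_iff max_cone_iff by (simp add: zero_le_mult_iff zero_less_mult_iff)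
  then have "m \<in> walls_in G I i" using m by (auto simp: walls_in_def)
  moreover have "slope n i x = slope n i (re m)" using r by (simp add: m(3) slope_eq)
  ultimately show ?thesis by blast
qed

lemma wall_in_supp:
  assumes "m \<in> walls_in G I i" "x \<in> max_cone_int n i" "x (nxt i) = slope n i (re m) * x i"
  shows "x \<in> supp G I"
proof -
  note M = re_max_cone_int[OF walls_inD(3)[OF assms(1)]]
  have Q: "0 < x i" "\<And>j. j \<noteq> i \<Longrightarrow> j \<noteq> nxt i \<Longrightarrow> x j = 0"
    using assms(2) by (auto simp: max_cone_int_iff max_cone_iff)
  let ?r = "x i / real_of_int (m i)"
  have "x (nxt i) = ?r * real_of_int (m (nxt i))"
    using assms(3) M(1) by (simp add: slope_eq re_def field_simps)
  then have "x j = ?r * re m j" for j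
    using Q(2)[of j] M(1) M(3)[of j] by (cases "j = i"; cases "j = nxt i") (auto simp: re_def)
  then have "x = (\<lambda>j. ?r * re m j)" by blast
  moreover have "0 \<le> ?r" using Q(1) M(1) by simp
  ultimately have "x \<in> ray_through m" unfolding ray_through_def by blast
  then show ?thesis
    using assms(1) unfolding supp_def walls_in_def by blast
qed

lemma ray_through_unit: "ray_through (unit_vec i) = {pt i r 0 |r. 0 \<le> r}"
proof -
  have "(\<lambda>j. r * re (unit_vec i) j) = pt i r 0" for r
    by (rule ext) (simp add: re_unit_vec pt_def)
  then show ?thesis by (simp add: ray_through_def)
qed

lemma ray_through_unit_nxt:
  assumes "i < n"
  shows "ray_through (unit_vec (nxt i)) = {pt i 0 r |r. 0 \<le> r}"
proof -
  have "(\<lambda>j. r * re (unit_vec (nxt i)) j) = pt i 0 r" for r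
    using nxt_neq[OF assms] by (intro ext) (simp add: re_unit_vec pt_def)
  then show ?thesis by (simp add: ray_through_def)
qed

text \<open>The sector of positive slopes up to that of \<open>Q\<close> is connected, avoids every
  wall, and has the lower ray in its closure; it lies in the component of \<open>Q\<close>.\<close>

lemma next_to_ray_lower:
  assumes "i < n" "Q \<in> irrational_points n" "Q \<in> max_cone n i"
    and "\<And>m. m \<in> walls_in G I i \<Longrightarrow> slope n i Q < slope n i (re m)"
  shows "next_to_ray G I i i Q"
proof -
  have Q: "Q \<in> max_cone_int n i" by (rule irrational_interior[OF assms(2,3,1)])
  have Qpos: "0 < Q i" "0 < Q (nxt i)" using Q by (auto simp: max_cone_int_iff)
  define s where "s = slope n i Q"
  have s: "0 < s" using Qpos by (simp add: s_def slope_eq)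
  define S where "S = (\<lambda>x. pt i (fst x) (fst x * snd x)) ` ({0<..} \<times> {0<..s})"
  have S_conn: "connected S"
    unfolding S_def
    by (intro connected_continuous_image continuous_on_pt)
      (auto intro!: continuous_intros simp: connected_Times)
  have S_sub: "S \<subseteq> max_cone_int n i - supp G I"
  proof
    fix x assume "x \<in> S"
    then obtain a r where ab: "x = pt i a (a * r)" "0 < a" "0 < r" "r \<le> s" by (auto simp: S_def)
    then have x: "x \<in> max_cone_int n i" "slope n i x \<le> s"
      by (auto simp: pt_simps[OF assms(1)])
    then show "x \<in> max_cone_int n i - supp G I"
      using supp_slope[of x i] assms(4) by (force simp: s_def)
  qed
  have "Q = pt i (Q i) (Q (nxt i))" by (rule pt_eq[OF assms(1,3)])
  then have QS: "Q \<in> S"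
    unfolding S_def using Qpos by (intro image_eqI[of _ _ "(Q i, s)"]) (auto simp: s_def slope_eq)
  have comp: "S \<subseteq> connected_component_set (max_cone_int n i - supp G I) Q"
    by (rule connected_component_maximal[OF QS S_conn S_sub])
  have "pt i r 0 \<in> closure S" if r: "0 \<le> r" for r
  proof -
    \<comment> \<open>As \<open>t\<close> tends to \<open>0\<close>, this path runs inside the
      sector to the point \<open>pt i r 0\<close> of the ray.\<close>
    let ?g = "\<lambda>t. pt i (r + t) (s * t)"
    have "?g ` closure {0<..} \<subseteq> closure S"
    proof (rule image_closure_subset)
      show "continuous_on (closure {0<..}) ?g"
        by (intro continuous_on_pt continuous_intros)
      have gS: "?g t \<in> S" if t: "0 < t" for t
        unfolding S_def
      proof (rule image_eqI[of _ _ "(r + t, s * t / (r + t))"])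
        have rt: "0 < r + t" "0 < s * t" "s * t \<le> s * (r + t)" using t r s by simp_all
        then show "?g t = pt i (fst (r + t, s * t / (r + t))) (fst (r + t, s * t / (r + t)) * snd (r + t, s * t / (r + t)))"
          by simp
        have "s * t / (r + t) \<le> s" using rt by (simp only: pos_divide_le_eq)
        then show "(r + t, s * t / (r + t)) \<in> {0<..} \<times> {0<..s}" using rt by simp
      qed
      show "?g ` {0<..} \<subseteq> closure S"
        using closure_subset[of S] gS by blast
    qed simp
    moreover have "(0::real) \<in> closure {0<..}" by simp
    ultimately have "?g 0 \<in> closure S" by blast
    then show ?thesis by simp
  qed
  then have "ray_through (unit_vec i) \<subseteq> closure S"
    unfolding ray_through_unit by blast
  then show ?thesis
    unfolding next_to_ray_def using assms(2) Q closure_mono[OF comp] by blast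
qed

text \<open>The sector of slopes from that of \<open>Q\<close> upwards has the upper ray in its
  closure.\<close>

lemma next_to_ray_upper:
  assumes "i < n" "Q \<in> irrational_points n" "Q \<in> max_cone n i"
    and "\<And>m. m \<in> walls_in G I i \<Longrightarrow> slope n i (re m) < slope n i Q"
  shows "next_to_ray G I (nxt i) i Q"
proof -
  have Q: "Q \<in> max_cone_int n i" by (rule irrational_interior[OF assms(2,3,1)])
  have Qpos: "0 < Q i" "0 < Q (nxt i)" using Q by (auto simp: max_cone_int_iff)
  define s where "s = slope n i Q"
  have s: "0 < s" using Qpos by (simp add: s_def slope_eq)
  define S where "S = (\<lambda>x. pt i (fst x) (fst x * snd x)) ` ({0<..} \<times> {s..})"
  have S_conn: "connected S"
    unfolding S_def
    by (intro connected_continuous_image continuous_on_pt)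
      (auto intro!: continuous_intros simp: connected_Times)
  have S_sub: "S \<subseteq> max_cone_int n i - supp G I"
  proof
    fix x assume "x \<in> S"
    then obtain a r where ab: "x = pt i a (a * r)" "0 < a" "s \<le> r" by (auto simp: S_def)
    then have x: "x \<in> max_cone_int n i" "s \<le> slope n i x"
      using s by (auto simp: pt_simps[OF assms(1)])
    then show "x \<in> max_cone_int n i - supp G I"
      using supp_slope[of x i] assms(4) by (force simp: s_def)
  qed
  have "Q = pt i (Q i) (Q (nxt i))" by (rule pt_eq[OF assms(1,3)])
  then have QS: "Q \<in> S"
    unfolding S_def using Qpos by (intro image_eqI[of _ _ "(Q i, s)"]) (auto simp: s_def slope_eq)
  have comp: "S \<subseteq> connected_component_set (max_cone_int n i - supp G I) Q"
    by (rule connected_component_maximal[OF QS S_conn S_sub])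
  have "pt i 0 r \<in> closure S" if r: "0 \<le> r" for r
  proof -
    let ?g = "\<lambda>t. pt i t (r + s * t)"
    have "?g ` closure {0<..} \<subseteq> closure S"
    proof (rule image_closure_subset)
      show "continuous_on (closure {0<..}) ?g"
        by (intro continuous_on_pt continuous_intros)
      have gS: "?g t \<in> S" if t: "0 < t" for t
        unfolding S_def
      proof (rule image_eqI[of _ _ "(t, (r + s * t) / t)"])
        show "?g t = pt i (fst (t, (r + s * t) / t)) (fst (t, (r + s * t) / t) * snd (t, (r + s * t) / t))"
          using t by simp
        have "s * t \<le> r + s * t" using r by simp
        then have "s \<le> (r + s * t) / t" using t by (simp only: pos_le_divide_eq)
        then show "(t, (r + s * t) / t) \<in> {0<..} \<times> {s..}" using t by simp
      qed
      show "?g ` {0<..} \<subseteq> closure S"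
        using closure_subset[of S] gS by blast
    qed simp
    moreover have "(0::real) \<in> closure {0<..}" by simp
    ultimately have "?g 0 \<in> closure S" by blast
    then show ?thesis by simp
  qed
  then have "ray_through (unit_vec (nxt i)) \<subseteq> closure S"
    unfolding ray_through_unit_nxt[OF assms(1)] by blast
  then show ?thesis
    unfolding next_to_ray_def using assms(2) Q closure_mono[OF comp] by blast
qed

text \<open>The component of a point next to \<open>\<rho>\<^sub>j\<close> lies on one side of each wall, and so does \<open>\<rho>\<^sub>j\<close>, which is in its
  closure.\<close>

lemma next_to_ray_side:
  assumes "i < n" "next_to_ray G I j i Q" "m \<in> walls_in G I i"
  defines "h \<equiv> \<lambda>x. x (nxt i) - slope n i (re m) * x i"
  shows "0 < h Q \<and> 0 \<le> h (re (unit_vec j)) \<or> h Q < 0 \<and> h (re (unit_vec j)) \<le> 0"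
proof -
  let ?C = "connected_component_set (max_cone_int n i - supp G I) Q"
  have Q: "Q \<in> irrational_points n" "Q \<in> max_cone_int n i" and cl: "ray_through (unit_vec j) \<subseteq> closure ?C"
    using assms(2) by (auto simp: next_to_ray_def)
  have Qi: "0 < Q i" using Q(2) by (simp add: max_cone_int_iff)
  have sl: "slope n i Q \<noteq> slope n i (re m)"
    by (rule irrational_slope[OF Q assms(3,1)])
  have "Q \<notin> supp G I"
    using supp_slope[OF _ Q(2)] irrational_slope[OF Q _ assms(1)] by blast
  then have QC: "Q \<in> ?C" using Q(2) by (simp add: connected_component_refl)
  have cont: "continuous_on T h" for T
    unfolding h_def by (intro continuous_intros continuous_on_subset[OF continuous_on_product_coordinates]) auto
  have conn: "connected (h ` ?C)"
    by (rule connected_continuous_image[OF cont connected_connected_component])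
  have ne: "h x \<noteq> 0" if "x \<in> ?C" for x
  proof -
    have "x \<in> max_cone_int n i - supp G I"
      using that connected_component_in by fastforce
    then show ?thesis using wall_in_supp[OF assms(3), of x] by (auto simp: h_def)
  qed
  have unit: "re (unit_vec j) \<in> closure ?C"
    using cl by (force simp: ray_through_def intro: exI[of _ "1::real"])
  show ?thesis
  proof (cases "0 < h Q")
    case True
    \<comment> \<open>A change of sign would give a zero of \<open>h\<close> in the connected
      component, that is, a point of the support.\<close>
    have "0 < h x" if "x \<in> ?C" for x
    proof (rule ccontr)
      assume "\<not> 0 < h x"
      then have "0 \<in> h ` ?C"
        using connectedD_interval[OF conn, of "h x" "h Q" 0] that QC True by auto
      then show False using ne by auto
    qed
    then have "h ` closure ?C \<subseteq> {0..}"
      by (intro image_closure_subset cont) (auto intro: less_imp_le)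
    then show ?thesis using unit True by auto
  next
    case False
    then have neg: "h Q < 0" using ne[OF QC] by simp
    have "h x < 0" if "x \<in> ?C" for x
    proof (rule ccontr)
      assume "\<not> h x < 0"
      then have "0 \<in> h ` ?C"
        using connectedD_interval[OF conn, of "h Q" "h x" 0] that QC neg by auto
      then show False using ne by auto
    qed
    then have "h ` closure ?C \<subseteq> {..0}"
      by (intro image_closure_subset cont) (auto intro: less_imp_le)
    then show ?thesis using unit neg by auto
  qed
qed

text \<open>On the ray \<open>i\<close> the linear form of \<open>next_to_ray_side\<close> is
  negative for every wall inside the cone, so \<open>Q\<close> lies below all of them.\<close>

lemma next_to_ray_lowerD:
  assumes "i < n" "next_to_ray G I i i Q" "m \<in> walls_in G I i"
  shows "slope n i Q < slope n i (re m)"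
proof -
  note M = re_max_cone_int[OF walls_inD(3)[OF assms(3)]]
  have "0 < slope n i (re m)" using M by (simp add: slope_eq re_def)
  moreover have "0 < Q i" using assms(2) by (simp add: next_to_ray_def max_cone_int_iff)
  ultimately show ?thesis
    using next_to_ray_side[OF assms] nxt_neq[OF assms(1)]
    by (simp add: re_unit_vec slope_eq[of i Q] pos_divide_less_eq)
qed

lemma next_to_ray_upperD:
  assumes "i < n" "next_to_ray G I (nxt i) i Q" "m \<in> walls_in G I i"
  shows "slope n i (re m) < slope n i Q"
proof -
  have "0 < Q i" using assms(2) by (simp add: next_to_ray_def max_cone_int_iff)
  then show ?thesis
    using next_to_ray_side[OF assms] nxt_neq[OF assms(1)]
    by (simp add: re_unit_vec slope_eq[of i Q] pos_less_divide_eq)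
qed

lemma next_to_ray_lower_exists:
  assumes "i < n"
  shows "\<exists>Q. next_to_ray G I i i Q"
proof -
  \<comment> \<open>The \<open>1\<close> covers a cone without walls. A point with second coordinate
    below \<open>s\<close> and first coordinate above \<open>1\<close> then has slope below every
    wall.\<close>
  define s where "s = Min (insert 1 ((\<lambda>m. slope n i (re m)) ` walls_in G I i))"
  have fin: "finite (insert 1 ((\<lambda>m. slope n i (re m)) ` walls_in G I i))"
    using finite_walls_in by simp
  have "0 < slope n i (re m)" if "m \<in> walls_in G I i" for m
    using re_max_cone_int[OF walls_inD(3)[OF that]] by (simp add: slope_eq re_def)
  then have s: "0 < s" unfolding s_def using fin by (subst Min_gr_iff) auto
  obtain u v where uv: "1 < u" "u < 1 + 1" "0 < v" "v < 0 + s" "pt i u v \<in> irrational_points n"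
    using irrational_point_exists[OF assms, of 1 0 1 s] s by auto
  have "s * 1 \<le> s * u" using uv s by (intro mult_left_mono) auto
  then have "v < s * u" using uv(4) by linarith
  then have "v / u < s" using uv by (simp add: pos_divide_less_eq)
  then have "slope n i (pt i u v) < slope n i (re m)" if "m \<in> walls_in G I i" for m
    using that fin Min_le[OF fin, of "slope n i (re m)"] by (auto simp: pt_simps[OF assms] s_def[symmetric])
  then have "next_to_ray G I i i (pt i u v)"
    using uv by (intro next_to_ray_lower assms) (auto simp: pt_simps[OF assms])
  then show ?thesis by blast
qed

lemma next_to_ray_upper_exists:
  assumes "i < n"
  shows "\<exists>Q. next_to_ray G I (nxt i) i Q"
proof -
  define s where "s = Max (insert 1 ((\<lambda>m. slope n i (re m)) ` walls_in G I i))"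
  have fin: "finite (insert 1 ((\<lambda>m. slope n i (re m)) ` walls_in G I i))"
    using finite_walls_in by simp
  have s: "1 \<le> s" unfolding s_def using fin by (intro Max_ge) auto
  obtain u v where uv: "0 < u" "u < 0 + 1" "s < v" "v < s + 1" "pt i u v \<in> irrational_points n"
    using irrational_point_exists[OF assms, of 0 s 1 1] s by auto
  have "s * u < s * 1" using uv s by (intro mult_strict_left_mono) auto
  then have "s < v / u" using uv by (simp add: pos_less_divide_eq)
  then have "slope n i (re m) < slope n i (pt i u v)" if "m \<in> walls_in G I i" for m
    using that fin Max_ge[OF fin, of "slope n i (re m)"] by (auto simp: pt_simps[OF assms] s_def[symmetric])
  then have "next_to_ray G I (nxt i) i (pt i u v)"
    using uv s by (intro next_to_ray_upper assms) (auto simp: pt_simps[OF assms])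
  then show ?thesis by blast
qed


subsection \<open>Paths starting next to a ray\<close>

definition walls_below :: "nat \<Rightarrow> (nat \<Rightarrow> real) \<Rightarrow> (nat \<Rightarrow> int) set" where
  "walls_below i z = {m \<in> walls_in G I i. slope n i (re m) < slope n i z}"

text \<open>All walls lie above \<open>Q\<close>, so the lower bound in \<open>path_aut\<close>
  excludes nothing and the result does not depend on \<open>Q\<close>.\<close>

lemma path_aut_from_ray:
  assumes "i < n" "next_to_ray G I i i Q" "slope n i Q \<le> slope n i z"
  shows "path_aut G I i Q z = fold (wall_crossing G I i 1) (sort_walls G i (walls_below i z))"
proof -
  have "{m \<in> walls_in G I i. slope n i Q < slope n i (re m) \<and> slope n i (re m) < slope n i z} = walls_below i z"
    using next_to_ray_lowerD[OF assms(1,2)] by (auto simp: walls_below_def)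
  then show ?thesis using assms(3) by (simp add: path_aut_def Let_def)
qed

lemma path_aut_across:
  assumes "i < n" "next_to_ray G I i i Q" "next_to_ray G I (nxt i) i Q'" "slope n i Q \<le> slope n i Q'"
  shows "path_aut G I i Q Q' = cone_aut G I i"
proof -
  have "walls_below i Q' = walls_in G I i"
    using next_to_ray_upperD[OF assms(1,3)] by (auto simp: walls_below_def)
  then show ?thesis
    by (simp add: path_aut_from_ray[OF assms(1,2,4)] cone_aut_def)
qed

lemma path_aut_no_walls:
  assumes "\<And>m. m \<in> walls_in G I i \<Longrightarrow> \<not> (slope n i Q < slope n i (re m) \<and> slope n i (re m) < slope n i Q')"
    and "slope n i Q \<le> slope n i Q'"
  shows "path_aut G I i Q Q' = id"
proof -
  have "{m \<in> walls_in G I i. slope n i Q < slope n i (re m) \<and> slope n i (re m) < slope n i Q'} = {}"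
    using assms(1) by blast
  moreover have "sort_walls G i {} = []"
    using set_sort_walls[of "{}" i] by simp
  ultimately show ?thesis using assms(2) by (simp only: path_aut_def Let_def if_True fold_Nil)
qed

section \<open>Broken lines modulo \<open>I\<close>\<close>

context
  fixes q :: "nat \<Rightarrow> int" and Q :: "nat \<Rightarrow> real" and \<gamma> :: "real \<Rightarrow> nat \<Rightarrow> real" and ls :: "('k, 'p) piece list"
  assumes bl: "broken_line G q Q (\<gamma>, ls)"
begin

lemma broken_line_unfold:
  "\<gamma> \<in> extensional {..0}" "\<gamma> ` {..0} \<subseteq> trop n - {\<lambda>_. 0}" "\<gamma> 0 = Q"
  "ls \<noteq> []" "until (last ls) = 0" "sorted_wrt (\<lambda>L L'. until L < until L') ls"
  "\<forall>j<length ls. let L = ls ! j; i = pcone L in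
        i < n \<and>
        (\<forall>t \<le> until L. (0 < j \<longrightarrow> until (ls ! (j - 1)) \<le> t) \<longrightarrow>
           \<gamma> t \<in> max_cone n i \<and>
           \<gamma> t i = \<gamma> (until L) i + (until L - t) * fst (pdir L) \<and>
           \<gamma> t (Suc i mod n) = \<gamma> (until L) (Suc i mod n) + (until L - t) * snd (pdir L)) \<and>
        (\<forall>t < until L. (0 < j \<longrightarrow> until (ls ! (j - 1)) < t) \<longrightarrow> \<gamma> t \<in> max_cone_int n i)"
  "let L = hd ls in re q \<in> max_cone n (pcone L) \<and>
        pcoef L = 1 \<and> pexp L = 0 \<and> pdir L = coords n (pcone L) q"
  "\<forall>j. Suc j < length ls \<longrightarrow> passes G (\<gamma> (until (ls ! j))) (ls ! j) (ls ! Suc j)"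
  using bl unfolding broken_line_def Let_def prod.case by blast+

lemma pcone_less: "j < length ls \<Longrightarrow> pcone (ls ! j) < n"
  using broken_line_unfold(7) unfolding Let_def by blast

lemma piece_formula:
  assumes "j < length ls" "t \<le> until (ls ! j)" "0 < j \<Longrightarrow> until (ls ! (j - 1)) \<le> t"
  shows "\<gamma> t \<in> max_cone n (pcone (ls ! j))"
    "\<gamma> t (pcone (ls ! j)) = \<gamma> (until (ls ! j)) (pcone (ls ! j)) + (until (ls ! j) - t) * fst (pdir (ls ! j))"
    "\<gamma> t (nxt (pcone (ls ! j))) =
       \<gamma> (until (ls ! j)) (nxt (pcone (ls ! j))) + (until (ls ! j) - t) * snd (pdir (ls ! j))"
  using broken_line_unfold(7) assms unfolding Let_def nxt_def by blast+

lemma piece_interior: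
  assumes "j < length ls" "t < until (ls ! j)" "0 < j \<Longrightarrow> until (ls ! (j - 1)) < t"
  shows "\<gamma> t \<in> max_cone_int n (pcone (ls ! j))"
  using broken_line_unfold(7) assms unfolding Let_def by blast

lemma until_less: "i < j \<Longrightarrow> j < length ls \<Longrightarrow> until (ls ! i) < until (ls ! j)"
  using broken_line_unfold(6) by (simp add: sorted_wrt_iff_nth_less)

lemma until_nonpos:
  assumes "j < length ls"
  shows "until (ls ! j) \<le> 0"
proof -
  have l: "until (ls ! (length ls - 1)) = 0"
    using broken_line_unfold(4,5) by (simp add: last_conv_nth)
  have "j = length ls - 1 \<or> j < length ls - 1" using assms by linarith
  then show ?thesis
    using l until_less[of j "length ls - 1"] assms by (auto intro: less_imp_le)
qed

lemma pass_point:
  assumes "Suc j < length ls"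
  shows "\<gamma> (until (ls ! j)) \<in> max_cone n (pcone (ls ! j))"
    "\<gamma> (until (ls ! j)) \<in> max_cone n (pcone (ls ! Suc j))"
    "\<gamma> (until (ls ! j)) \<noteq> (\<lambda>_. 0)"
proof -
  have j: "j < length ls" using assms by simp
  show "\<gamma> (until (ls ! j)) \<in> max_cone n (pcone (ls ! j))"
    by (rule piece_formula(1)[OF j]) (use until_less[of "j - 1" j] j in auto)
  show "\<gamma> (until (ls ! j)) \<in> max_cone n (pcone (ls ! Suc j))"
    by (rule piece_formula(1)[OF assms]) (use until_less[of j "Suc j"] assms in auto)
  have "\<gamma> (until (ls ! j)) \<in> trop n - {\<lambda>_. 0}"
    using broken_line_unfold(2) until_nonpos[OF j] by blast
  then show "\<gamma> (until (ls ! j)) \<noteq> (\<lambda>_. 0)" by simp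
qed

text \<open>A line moves with velocity \<open>- pdir\<close>, so a point shortly before the passage
  is the point of passage plus a positive multiple of \<open>pdir\<close>. That it lies in the open
  cone restricts the signs of \<open>pdir\<close> at the boundary.\<close>

lemma pass_before:
  assumes "Suc j < length ls"
  defines "L \<equiv> ls ! j"
  defines "x \<equiv> \<gamma> (until L)"
  shows "\<exists>\<tau>::real. 0 < \<tau> \<and> 0 < x (pcone L) + \<tau> * fst (pdir L) \<and> 0 < x (nxt (pcone L)) + \<tau> * snd (pdir L)"
proof -
  have j: "j < length ls" using assms(1) by simp
  \<comment> \<open>The first piece extends to minus infinity, so any earlier time serves
    there.\<close>
  define t where "t = (if j = 0 then until L - 1 else (until (ls ! (j - 1)) + until L) / 2)"
  have t: "t < until L" "0 < j \<Longrightarrow> until (ls ! (j - 1)) < t"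
    using until_less[of "j - 1" j] j by (auto simp: t_def L_def)
  have "\<gamma> t \<in> max_cone_int n (pcone L)"
    using piece_interior[OF j] t by (simp add: L_def)
  moreover have "\<gamma> t (pcone L) = x (pcone L) + (until L - t) * fst (pdir L)"
    "\<gamma> t (nxt (pcone L)) = x (nxt (pcone L)) + (until L - t) * snd (pdir L)"
    using piece_formula(2,3)[OF j, of t] t less_imp_le by (simp_all add: L_def x_def, blast+)
  ultimately show ?thesis
    using t(1) by (intro exI[of _ "until L - t"]) (simp add: max_cone_int_iff)
qed

lemma pass_after:
  assumes "Suc j < length ls"
  defines "L \<equiv> ls ! Suc j"
  defines "x \<equiv> \<gamma> (until (ls ! j))"
  shows "\<exists>\<tau>::real. 0 < \<tau> \<and> 0 < x (pcone L) - \<tau> * fst (pdir L) \<and> 0 < x (nxt (pcone L)) - \<tau> * snd (pdir L)"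
proof -
  define t where "t = (until (ls ! j) + until L) / 2"
  have u: "until (ls ! j) < until L" using until_less[of j "Suc j"] assms(1) by (simp add: L_def)
  have t: "t < until L" "until (ls ! j) < t" using u by (auto simp: t_def)
  have "\<gamma> t \<in> max_cone_int n (pcone L)"
    using piece_interior[OF assms(1)] t by (simp add: L_def)
  moreover have "\<gamma> t (pcone L) = x (pcone L) - (t - until (ls ! j)) * fst (pdir L)"
    "\<gamma> t (nxt (pcone L)) = x (nxt (pcone L)) - (t - until (ls ! j)) * snd (pdir L)"
    using piece_formula(2,3)[OF assms(1), of t] piece_formula(2,3)[OF assms(1), of "until (ls ! j)"] t u
    by (simp_all add: L_def x_def algebra_simps)
  ultimately show ?thesis
    using t(2) by (intro exI[of _ "t - until (ls ! j)"]) (simp add: max_cone_int_iff)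
qed

end

text \<open>With at least three rays a cone is never both the next and the previous one, so the
  three cases exclude each other.\<close>

lemma transported_cases:
  assumes "transported G i p (a, b) j p' m'" "i < n" "j < n"
  shows "(j = i \<and> p' = p \<and> m' = (a, b)) \<or>
    (j = nxt i \<and> i \<noteq> nxt j \<and> i \<noteq> j \<and> p' = p - zmul (- a) (\<kappa> j) \<and> m' = (b - a * D j, - a)) \<or>
    (i = nxt j \<and> j \<noteq> nxt i \<and> i \<noteq> j \<and> p' = p - zmul (- b) (\<kappa> i) \<and> m' = (- b, a - b * D i))"
  using assms(1) nxt_neq[OF assms(2)] nxt_neq[OF assms(3)] nxt_nxt_neq[OF assms(2)] nxt_nxt_neq[OF assms(3)]
  unfolding transported_def Let_def prod.case nxt_def[symmetric] by metis

text \<open>A positive multiple of an element of \<open>J\<close> has one summand in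
  \<open>J\<close> and the others in \<open>P\<close>; the double negation is the form in which the
  transport rule produces it.\<close>

lemma zmul_J:
  assumes "0 < a" "c \<in> J"
  shows "- zmul (- a) c \<in> J"
proof -
  obtain k where k: "a = int (Suc k)" using assms(1) by (metis zero_less_imp_eq_int gr0_implies_Suc of_nat_0_less_iff)
  have "((+) c ^^ k) 0 \<in> P" using assms(2) J_subset by (auto intro: P_funpow)
  then have "((+) c ^^ Suc k) 0 \<in> J" using ideal_add'[OF J_ideal assms(2)] by simp
  then show ?thesis unfolding k by (simp only: zmul_uminus_of_nat minus_minus)
qed

text \<open>The rays at which a line that survives modulo \<open>I\<close> can end a piece: those
  carrying a nontrivial function, and the rays of the fan, where a piece also ends without
  bending.\<close>

definition Wset :: "(nat \<Rightarrow> int) set" where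
  "Wset = {m. \<exists>f. (m, f) \<in> diag G \<and> \<not> trivial_mod I f} \<union> unit_vec ` {..<n}"

lemma finite_Wset: "finite Wset"
proof -
  have "{m. \<exists>f. (m, f) \<in> diag G \<and> \<not> trivial_mod I f} \<subseteq> fst ` {(m, f) \<in> diag G. \<not> trivial_mod I f}"
    by force
  then show ?thesis
    unfolding Wset_def finite_Un
    using finite_subset[OF _ finite_imageI[OF finite_nontrivial[OF I_ideal I_radical]]] by simp
qed


text \<open>A piece without its end time: for these there are finitely many choices, independently
  of the endpoint of the line.\<close>

definition data :: "('k, 'p) piece \<Rightarrow> nat \<times> 'k \<times> 'p \<times> int \<times> int" where
  "data L = (pcone L, pcoef L, pexp L, pdir L)"

text \<open>All data that one passage can produce modulo \<open>I\<close>. Letting the term range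
  over the keys of a power of \<open>ray_fun G I m\<close> makes the set finite.\<close>

definition successors :: "nat \<times> 'k \<times> 'p \<times> int \<times> int \<Rightarrow> (nat \<times> 'k \<times> 'p \<times> int \<times> int) set" where
  "successors = (\<lambda>(i, c, p, d). \<Union>m\<in>Wset. \<Union>j\<in>{..<n}. \<Union>(p', a, b)\<in>{(p', d'). transported G i p d j p' d'}.
     (\<lambda>(s, k). (j, c * lookup (ray_fun G I m ^ nat \<bar>m j * b - m (nxt j) * a\<bar>) (s, k), p' + s,
        a + k * m j, b + k * m (nxt j))) ` keys (ray_fun G I m ^ nat \<bar>m j * b - m (nxt j) * a\<bar>))"

lemma finite_transported: "finite {(p', d'). transported G i p d j p' d'}"
proof -
  obtain a b where d: "d = (a, b)" by (cases d)
  have "{(p', d'). transported G i p d j p' d'} \<subseteq>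
      {(p, d), (p - zmul (- a) (\<kappa> j), b - a * D j, - a), (p - zmul (- b) (\<kappa> i), - b, a - b * D i)}"
    by (auto simp: d transported_def Let_def)
  then show ?thesis by (rule finite_subset) simp
qed

lemma finite_successors: "finite (successors X)"
proof -
  obtain i c p d where X: "X = (i, c, p, d)" by (cases X)
  show ?thesis
    unfolding successors_def X prod.case
  proof (intro finite_UN_I finite_Wset finite_lessThan finite_transported)
    fix y :: "'p \<times> int \<times> int" and m j
    obtain p' a b where "y = (p', a, b)" by (cases y)
    then show "finite (case y of (p', a, b) \<Rightarrow>
        (\<lambda>(s, k). (j, c * lookup (ray_fun G I m ^ nat \<bar>m j * b - m (nxt j) * a\<bar>) (s, k), p' + s,
          a + k * m j, b + k * m (nxt j))) ` keys (ray_fun G I m ^ nat \<bar>m j * b - m (nxt j) * a\<bar>))"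
      by simp
  qed
qed

lemma crossing_ray_unit:
  assumes "i < n" "Gcd (range m) = 1" "0 \<le> r" "x = (\<lambda>j. r * re m j)" "\<And>l. l \<noteq> i \<Longrightarrow> x l = 0" "0 < r"
    and "0 \<le> x i"
  shows "m = unit_vec i"
proof -
  have m0: "m l = 0" if "l \<noteq> i" for l
    using assms(5)[OF that] assms(6) by (simp add: assms(4) re_def)
  have "0 \<le> m i"
    using assms(6,7) by (simp add: assms(4) re_def zero_le_mult_iff)
  moreover have "coprime (m i) (m i)"
    by (rule primitive_coprime[OF assms(2)]) (simp add: m0)
  ultimately have "m i = 1" by simp
  then show ?thesis using m0 by (auto simp: unit_vec_def)
qed

context
  fixes q :: "nat \<Rightarrow> int" and Q :: "nat \<Rightarrow> real" and \<gamma> :: "real \<Rightarrow> nat \<Rightarrow> real" and ls :: "('k, 'p) piece list"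
  assumes bl: "broken_line G q Q (\<gamma>, ls)"
begin

text \<open>Crossing a ray of the fan adds a positive multiple of its bending parameter to the exponent; bending
  inside a cone adds an element of \<open>J\<close>. A line cannot turn back at a ray of the fan, because bending keeps the
  transversal component of its direction.\<close>

lemma pass_step:
  assumes j: "Suc j < length ls"
  defines "L \<equiv> ls ! j" and "L' \<equiv> ls ! Suc j"
  shows "\<exists>d\<in>J. pexp L' = pexp L + d"
    and "pexp L \<in> P \<Longrightarrow> pexp L' \<notin> I \<Longrightarrow> data L' \<in> successors (data L) \<and>
      (\<exists>m\<in>Wset. \<gamma> (until L) \<in> ray_through m \<and>
        m (pcone L') * snd (pdir L') - m (nxt (pcone L')) * fst (pdir L') \<noteq> 0)"
proof -
  define x where "x = \<gamma> (until L)"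
  define i where "i = pcone L"
  define i' where "i' = pcone L'"
  obtain a b where ab: "pdir L = (a, b)" by (cases "pdir L")
  have ii: "i < n" "i' < n"
    using pcone_less[OF bl] j by (auto simp: i_def i'_def L_def L'_def)
  have "passes G x L L'"
    using broken_line_unfold(9)[OF bl] j by (simp add: x_def L_def L'_def)
  then obtain m p a0 b0 c s k where m: "m \<in> trop_int n" "Gcd (range m) = 1" "x \<in> ray_through m"
    and tr: "transported G i (pexp L) (a, b) i' p (a0, b0)"
    and det: "m i' * b0 - m (nxt i') * a0 \<noteq> 0"
    and mt: "monomial_term G m (nat \<bar>m i' * b0 - m (nxt i') * a0\<bar>) c s k"
    and st: "i' = i \<longrightarrow> (s, k) \<noteq> (0, 0)"
    and L': "pcoef L' = pcoef L * c" "pexp L' = p + s" "pdir L' = (a0 + k * m i', b0 + k * m (nxt i'))"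
    unfolding passes_def ab i_def[symmetric] i'_def[symmetric] coords_eq prod.inject by blast
  let ?e = "nat \<bar>m i' * b0 - m (nxt i') * a0\<bar>"
  have sP: "s \<in> P" by (rule monomial_term_mod(1)[OF mt])
  have xc: "x \<in> max_cone n i" "x \<in> max_cone n i'" "x \<noteq> (\<lambda>_. 0)"
    using pass_point[OF bl j] by (auto simp: x_def i_def i'_def L_def L'_def)
  obtain r where r: "0 \<le> r" "x = (\<lambda>j. r * re m j)" using m(3) by (auto simp: ray_through_def)
  have "r \<noteq> 0" using xc(3) r(2) by auto
  then have rpos: "0 < r" using r(1) by simp
  obtain \<tau> :: real where \<tau>: "0 < \<tau>" "0 < x i + \<tau> * a" "0 < x (nxt i) + \<tau> * b"
    using pass_before[OF bl j] by (auto simp: x_def i_def L_def[symmetric] ab)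
  obtain \<tau>' :: real where \<tau>': "0 < \<tau>'" "0 < x i' - \<tau>' * (a0 + k * m i')" "0 < x (nxt i') - \<tau>' * (b0 + k * m (nxt i'))"
    using pass_after[OF bl j] by (auto simp: x_def i'_def L'_def[symmetric] L_def[symmetric] L')
  have main: "(\<exists>d\<in>P. p = pexp L + d \<and> d + s \<in> J) \<and> (s \<notin> I \<longrightarrow> m \<in> Wset)"
    using transported_cases[OF tr ii]
  proof (elim disjE conjE)
    assume same: "i' = i" "p = pexp L" "(a0, b0) = (a, b)"
    have mc: "0 \<le> m l" "l \<noteq> i \<Longrightarrow> l \<noteq> nxt i \<Longrightarrow> m l = 0" for l
      using xc(1) rpos unfolding r(2) max_cone_iff by (auto simp: re_def zero_le_mult_iff)
    \<comment> \<open>If \<open>m i = 0\<close>, bending leaves the coordinate \<open>i\<close> of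
      the direction unchanged, and positivity before and after the passage would give
      \<open>a\<close> both signs.\<close>
    have "m i \<noteq> 0"
    proof
      assume mi: "m i = 0"
      then have "x i = 0" by (simp add: r(2) re_def)
      then have "0 < \<tau> * real_of_int a" "0 < - \<tau>' * real_of_int a" using \<tau>(2) \<tau>'(2) mi same by simp_all
      then show False using \<tau>(1) \<tau>'(1) by (simp add: zero_less_mult_iff mult_less_0_iff)
    qed
    moreover have "m (nxt i) \<noteq> 0"
    proof
      assume mi: "m (nxt i) = 0"
      then have "x (nxt i) = 0" by (simp add: r(2) re_def)
      then have "0 < \<tau> * real_of_int b" "0 < - \<tau>' * real_of_int b" using \<tau>(3) \<tau>'(3) mi same by simp_all
      then show False using \<tau>(1) \<tau>'(1) by (simp add: zero_less_mult_iff mult_less_0_iff)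
    qed
    ultimately have mint: "0 < m i" "0 < m (nxt i)" using mc(1)[of i] mc(1)[of "nxt i"] by simp_all
    have triv: "trivial_mod J f" if "(m, f) \<in> diag G" for f
    proof (rule wallD(4)[OF that])
      fix l assume "l < n"
      show "m \<noteq> unit_vec l"
        using mint nxt_neq[OF ii(1)] by (auto simp: unit_vec_def split: if_splits)
    qed
    \<comment> \<open>Modulo \<open>J\<close> the function is \<open>1\<close>, and inside a cone
      the term \<open>1\<close> is excluded.\<close>
    have sJ: "s \<in> J"
    proof (cases "s \<in> I")
      case True
      then show ?thesis using I_subset_J by blast
    next
      case False
      interpret j: monoid_pair "P \<times> (UNIV :: int set)" "J \<times> UNIV" "TYPE('k)"
        by (rule monoid_pair_UNIV[OF J_ideal])
      have "ray_fun G I m ^ ?e - 1 ^ ?e \<in> {f. keys f \<subseteq> J \<times> UNIV}"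
        by (rule j.A_diff_power[OF _ _ j.S_one])
          (use ray_fun_trivial_mod[OF triv] keys_ray_fun[OF fine_ideal_I] in auto)
      then have sub: "keys (ray_fun G I m ^ ?e - 1) \<subseteq> J \<times> UNIV" by simp
      show ?thesis
      proof (rule ccontr)
        assume "s \<notin> J"
        then have "lookup (ray_fun G I m ^ ?e) (s, k) = lookup 1 (s, k)"
          by (intro lookup_eq_if_keys_diff[OF sub]) simp
        also have "\<dots> = 0"
          using st same(1) by (simp add: lookup_one zero_prod_def when_def)
        finally show False
          using monomial_term_mod(2)[OF mt False] mt by (simp add: monomial_term_def)
      qed
    qed
    have "m \<in> Wset" if s: "s \<notin> I"
    proof (rule ccontr)
      assume "m \<notin> Wset"
      then have "ray_fun G I m = 1" by (intro ray_fun_trivial) (auto simp: Wset_def)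
      then have "c = lookup 1 (s, k)" using monomial_term_mod(2)[OF mt s] by simp
      also have "\<dots> = 0"
        using st same(1) by (simp add: lookup_one zero_prod_def when_def)
      finally show False using mt by (simp add: monomial_term_def)
    qed
    then show ?thesis using same(2) sJ P_zero by (auto intro!: bexI[of _ 0])
  next
    assume cr: "i' = nxt i" "i \<noteq> nxt i'" "i \<noteq> i'" "p = pexp L - zmul (- a) (\<kappa> i')"
    \<comment> \<open>The point lies on the common ray, so the coordinate \<open>i\<close> vanishes
      there, while it is positive just before; this fixes the sign of \<open>a\<close>.\<close>
    have "x i = 0" using xc(2) cr(2,3) by (simp add: max_cone_iff)
    then have "0 < a" using \<tau>(1,2) by (simp add: zero_less_mult_iff)
    then have d: "- zmul (- a) (\<kappa> i') \<in> J" by (rule zmul_J[OF _ kappa_J[OF ii(2)]])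
    have x0: "x l = 0" if "l \<noteq> i'" for l
      using xc(1,2) that cr by (cases "l = i") (auto simp: max_cone_iff)
    have "m \<in> Wset"
      using crossing_ray_unit[OF ii(2) m(2) r x0 rpos] xc(2) by (auto simp: Wset_def ii(2) max_cone_iff)
    then show ?thesis
      using cr(4) d ideal_add'[OF J_ideal d sP] J_subset by (auto intro!: bexI[of _ "- zmul (- a) (\<kappa> i')"])
  next
    assume cr: "i = nxt i'" "i' \<noteq> nxt i" "i \<noteq> i'" "p = pexp L - zmul (- b) (\<kappa> i)"
    have "x (nxt i) = 0" using xc(2) cr(1,2) nxt_neq[OF ii(1)] by (simp add: max_cone_iff)
    then have "0 < b" using \<tau>(1,3) by (simp add: zero_less_mult_iff)
    then have d: "- zmul (- b) (\<kappa> i) \<in> J" by (rule zmul_J[OF _ kappa_J[OF ii(1)]])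
    have x0: "x l = 0" if "l \<noteq> i" for l
      using xc(1,2) that cr by (cases "l = nxt i") (auto simp: max_cone_iff)
    have "m \<in> Wset"
      using crossing_ray_unit[OF ii(1) m(2) r x0 rpos] xc(1) by (auto simp: Wset_def ii(1) max_cone_iff)
    then show ?thesis
      using cr(4) d ideal_add'[OF J_ideal d sP] J_subset by (auto intro!: bexI[of _ "- zmul (- b) (\<kappa> i)"])
  qed
  then obtain d where d: "d \<in> P" "p = pexp L + d" "d + s \<in> J" by blast
  then show "\<exists>d\<in>J. pexp L' = pexp L + d"
    by (intro bexI[of _ "d + s"]) (simp_all add: L' add.assoc)
  assume LP: "pexp L \<in> P" and nI: "pexp L' \<notin> I"
  have sI: "s \<notin> I"
    using nI ideal_add[OF I_ideal P_add[OF LP d(1)]] by (auto simp: L' d(2))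
  have mW: "m \<in> Wset" using main sI by blast
  have c: "c = lookup (ray_fun G I m ^ ?e) (s, k)" by (rule monomial_term_mod(2)[OF mt sI])
  have "c \<noteq> 0" using mt by (simp add: monomial_term_def)
  then have key: "(s, k) \<in> keys (ray_fun G I m ^ ?e)" using c by (simp add: in_keys_iff)
  have "data L' \<in> (\<lambda>(s, k). (i', pcoef L * lookup (ray_fun G I m ^ ?e) (s, k), p + s,
        a0 + k * m i', b0 + k * m (nxt i'))) ` keys (ray_fun G I m ^ ?e)"
    by (rule image_eqI[OF _ key]) (simp add: data_def L' c i'_def[symmetric])
  then have "data L' \<in> successors (data L)"
    unfolding successors_def data_def[of L] prod.case i_def[symmetric] ab
    using mW ii(2) tr by (intro UN_I[of m] UN_I[of i'] UN_I[of "(p, a0, b0)"]) auto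
  \<comment> \<open>Adding a multiple of \<open>m\<close> to the direction does not change its
    determinant with \<open>m\<close>.\<close>
  moreover have "m i' * snd (pdir L') - m (nxt i') * fst (pdir L') \<noteq> 0"
    using det by (simp add: L' algebra_simps)
  ultimately show "data L' \<in> successors (data L) \<and>
      (\<exists>m\<in>Wset. \<gamma> (until L) \<in> ray_through m \<and>
        m (pcone L') * snd (pdir L') - m (nxt (pcone L')) * fst (pdir L') \<noteq> 0)"
    using mW m(3) by (auto simp: x_def i'_def)
qed

end

subsection \<open>Finiteness\<close>

primrec data_after :: "(nat \<Rightarrow> int) \<Rightarrow> nat \<Rightarrow> (nat \<times> 'k \<times> 'p \<times> int \<times> int) set" where
  "data_after q 0 = (\<lambda>i. (i, 1, 0, coords n i q)) ` {..<n}"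
| "data_after q (Suc k) = (\<Union>X\<in>data_after q k. successors X)"

lemma finite_data_after: "finite (data_after q k)"
  by (induction k) (auto simp: finite_successors)

text \<open>More than \<open>nil\<close> passages would put the exponent into
  \<open>I\<close>.\<close>

definition all_data :: "(nat \<Rightarrow> int) \<Rightarrow> (nat \<times> 'k \<times> 'p \<times> int \<times> int) set" where
  "all_data q = (\<Union>k\<le>nil. data_after q k)"

lemma finite_all_data: "finite (all_data q)"
  by (auto simp: all_data_def finite_data_after)

text \<open>The point where the first piece of a final segment ends, reconstructed backwards from
  the endpoint \<open>Q\<close> of the line.\<close>

fun end_point :: "(nat \<Rightarrow> real) \<Rightarrow> ('k, 'p) piece list \<Rightarrow> nat \<Rightarrow> real" where
  "end_point Q [] = Q"
| "end_point Q [L] = Q"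
| "end_point Q (L # L' # r) = pt (pcone L')
     (end_point Q (L' # r) (pcone L') + (until L' - until L) * fst (pdir L'))
     (end_point Q (L' # r) (nxt (pcone L')) + (until L' - until L) * snd (pdir L'))"

context
  fixes q :: "nat \<Rightarrow> int" and Q :: "nat \<Rightarrow> real" and \<gamma> :: "real \<Rightarrow> nat \<Rightarrow> real" and ls :: "('k, 'p) piece list"
  assumes bl: "broken_line G q Q (\<gamma>, ls)"
begin

lemma pexp_Jpow: "j < length ls \<Longrightarrow> pexp (ls ! j) \<in> Jpow j"
proof (induction j)
  case 0
  then show ?case
    using broken_line_unfold(4,8)[OF bl] P_zero by (simp add: hd_conv_nth Let_def)
next
  case (Suc j)
  then obtain d where "d \<in> J" "pexp (ls ! Suc j) = pexp (ls ! j) + d" "pexp (ls ! j) \<in> Jpow j"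
    using pass_step(1)[OF bl, of j] by auto
  then show ?case by (force simp: add.commute)
qed

lemma pexp_P: "j < length ls \<Longrightarrow> pexp (ls ! j) \<in> P"
  using pexp_Jpow Jpow_ideal by (auto simp: monoid_ideal_def)

lemma pexp_I_mono:
  assumes "j \<le> j'" "j' < length ls" "pexp (ls ! j) \<in> I"
  shows "pexp (ls ! j') \<in> I"
  using assms(1,2)
proof (induction rule: dec_induct)
  case (step k)
  then obtain d where "d \<in> J" "pexp (ls ! Suc k) = pexp (ls ! k) + d" "pexp (ls ! k) \<in> I"
    using pass_step(1)[OF bl, of k] by auto
  then show ?case using ideal_add'[OF I_ideal] J_subset by auto
qed (rule assms(3))

lemma end_point_eq:
  assumes "j < length ls"
  shows "\<gamma> (until (ls ! j)) = end_point Q (drop j ls)"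
proof -
  have "j \<le> length ls - 1" using assms by simp
  then show ?thesis
  proof (induction rule: inc_induct)
    case base
    have "drop (length ls - 1) ls = [ls ! (length ls - 1)]"
      using broken_line_unfold(4)[OF bl] Cons_nth_drop_Suc[of "length ls - 1" ls] by simp
    moreover have "until (ls ! (length ls - 1)) = 0"
      using broken_line_unfold(4,5)[OF bl] by (simp add: last_conv_nth)
    ultimately show ?case using broken_line_unfold(3)[OF bl] by simp
  next
    case (step j)
    have j: "Suc j < length ls" using step.hyps by simp
    have u: "until (ls ! j) < until (ls ! Suc j)" by (rule until_less[OF bl _ j]) simp
    let ?x = "\<gamma> (until (ls ! j))" and ?L' = "ls ! Suc j"
    have d1: "drop j ls = ls ! j # drop (Suc j) ls"
      using j by (simp add: Cons_nth_drop_Suc)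
    have d2: "drop (Suc j) ls = ?L' # drop (Suc (Suc j)) ls"
      using j by (simp add: Cons_nth_drop_Suc)
    have d: "end_point Q (drop j ls) = pt (pcone ?L')
     (end_point Q (drop (Suc j) ls) (pcone ?L') + (until ?L' - until (ls ! j)) * fst (pdir ?L'))
     (end_point Q (drop (Suc j) ls) (nxt (pcone ?L')) + (until ?L' - until (ls ! j)) * snd (pdir ?L'))"
      unfolding d1 d2 by simp
    have "?x = pt (pcone ?L') (?x (pcone ?L')) (?x (nxt (pcone ?L')))"
      by (rule pt_eq[OF pcone_less[OF bl j] pass_point(2)[OF bl j]])
    also have "\<dots> = end_point Q (drop j ls)"
      unfolding d step.IH[symmetric]
      using piece_formula(2,3)[OF bl j, of "until (ls ! j)"] u by simp
    finally show ?case .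
  qed
qed

lemma data_invariant:
  assumes "pexp (last ls) \<notin> I" "j < length ls"
  shows "data (ls ! j) \<in> data_after q j" "j \<le> nil"
proof -
  have nI: "pexp (ls ! j) \<notin> I" if "j < length ls" for j
  proof
    assume "pexp (ls ! j) \<in> I"
    moreover have "j \<le> length ls - 1" "length ls - 1 < length ls" using that by auto
    ultimately have "pexp (ls ! (length ls - 1)) \<in> I" using pexp_I_mono by blast
    then show False using assms(1) broken_line_unfold(4)[OF bl] by (simp add: last_conv_nth)
  qed
  show "data (ls ! j) \<in> data_after q j"
    using assms(2)
  proof (induction j)
    case 0
    have "pcone (hd ls) < n" using pcone_less[OF bl 0] 0 by (simp add: hd_conv_nth)
    then show ?case
      using broken_line_unfold(4,8)[OF bl] by (simp add: data_def hd_conv_nth Let_def)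
  next
    case (Suc j)
    then show ?case
      using pass_step(2)[OF bl, of j] pexp_P[of j] nI[of "Suc j"] by auto
  qed
  show "j \<le> nil"
  proof (rule ccontr)
    assume "\<not> j \<le> nil"
    then have "Jpow j \<subseteq> Jpow nil" by (intro ideal_power_antimono[OF J_ideal]) simp
    then show False using pexp_Jpow[OF assms(2)] nI[OF assms(2)] Jpow_nil by blast
  qed
qed

lemma data_in_all: "pexp (last ls) \<notin> I \<Longrightarrow> j < length ls \<Longrightarrow> data (ls ! j) \<in> all_data q"
  using data_invariant unfolding all_data_def by blast

text \<open>Followed backwards from its end, the piece meets the ray of \<open>m\<close> at the
  previous break. This is a linear equation for the time, and transversality leaves it at most one
  solution.\<close>

lemma break_time:
  assumes "pexp (last ls) \<notin> I" "Suc j < length ls"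
  defines "L' \<equiv> ls ! Suc j"
  defines "y \<equiv> end_point Q (drop (Suc j) ls)" and "t \<equiv> until L' - until (ls ! j)"
  shows "\<exists>m\<in>Wset. m (pcone L') * snd (pdir L') - m (nxt (pcone L')) * fst (pdir L') \<noteq> 0 \<and>
    (y (pcone L') + t * fst (pdir L')) * m (nxt (pcone L')) = (y (nxt (pcone L')) + t * snd (pdir L')) * m (pcone L')"
proof -
  have j: "j < length ls" using assms(2) by simp
  have nI: "pexp (ls ! Suc j) \<notin> I"
  proof
    assume "pexp (ls ! Suc j) \<in> I"
    moreover have "Suc j \<le> length ls - 1" "length ls - 1 < length ls" using assms(2) by auto
    ultimately have "pexp (ls ! (length ls - 1)) \<in> I" using pexp_I_mono by blast
    then show False using assms(1) broken_line_unfold(4)[OF bl] by (simp add: last_conv_nth)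
  qed
  obtain m where m: "m \<in> Wset" "\<gamma> (until (ls ! j)) \<in> ray_through m"
    "m (pcone L') * snd (pdir L') - m (nxt (pcone L')) * fst (pdir L') \<noteq> 0"
    using pass_step(2)[OF bl assms(2) pexp_P[OF j] nI] by (auto simp: L'_def)
  obtain r where r: "\<gamma> (until (ls ! j)) = (\<lambda>l. r * re m l)"
    using m(2) by (auto simp: ray_through_def)
  have u: "until (ls ! j) < until (ls ! Suc j)" by (rule until_less[OF bl _ assms(2)]) simp
  have "y (pcone L') + t * fst (pdir L') = r * m (pcone L')"
    "y (nxt (pcone L')) + t * snd (pdir L') = r * m (nxt (pcone L'))"
    using piece_formula(2,3)[OF bl assms(2), of "until (ls ! j)"] u r end_point_eq[OF assms(2)]
    by (simp_all add: L'_def y_def t_def re_def)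
  then show ?thesis using m(1,3) by (intro bexI[of _ m]) simp_all
qed

end

definition make_piece :: "real \<Rightarrow> nat \<times> 'k \<times> 'p \<times> int \<times> int \<Rightarrow> ('k, 'p) piece" where
  "make_piece t = (\<lambda>(i, c, p, d). \<lparr>until = t, pcone = i, pcoef = c, pexp = p, pdir = d\<rparr>)"

lemma make_piece_data: "make_piece (until L) (data L) = L"
  by (simp add: make_piece_def data_def)

definition break_times :: "(nat \<Rightarrow> real) \<Rightarrow> ('k, 'p) piece list \<Rightarrow> real set" where
  "break_times Q r = (\<Union>m\<in>Wset. {u. let L = hd r; y = end_point Q r; t = until L - u in
     m (pcone L) * snd (pdir L) - m (nxt (pcone L)) * fst (pdir L) \<noteq> 0 \<and>
     (y (pcone L) + t * fst (pdir L)) * m (nxt (pcone L)) = (y (nxt (pcone L)) + t * snd (pdir L)) * m (pcone L)})"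

lemma finite_break_times: "finite (break_times Q r)"
  unfolding break_times_def
proof (rule finite_UN_I[OF finite_Wset])
  fix m :: "nat \<Rightarrow> int"
  define L where "L = hd r"
  define y where "y = end_point Q r"
  define a b c d :: real where "a = fst (pdir L)" and "b = snd (pdir L)"
    and "c = m (pcone L)" and "d = m (nxt (pcone L))"
  let ?S = "{u. let L = hd r; y = end_point Q r; t = until L - u in
     m (pcone L) * snd (pdir L) - m (nxt (pcone L)) * fst (pdir L) \<noteq> 0 \<and>
     (y (pcone L) + t * fst (pdir L)) * m (nxt (pcone L)) = (y (nxt (pcone L)) + t * snd (pdir L)) * m (pcone L)}"
  have "?S \<subseteq> {until L - (y (pcone L) * d - y (nxt (pcone L)) * c) / (c * b - d * a)}"
  proof
    fix u assume "u \<in> ?S"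
    then have u: "m (pcone L) * snd (pdir L) - m (nxt (pcone L)) * fst (pdir L) \<noteq> 0"
      "(y (pcone L) + (until L - u) * a) * d = (y (nxt (pcone L)) + (until L - u) * b) * c"
      unfolding Let_def L_def y_def a_def b_def c_def d_def by auto
    have "real_of_int (m (pcone L) * snd (pdir L) - m (nxt (pcone L)) * fst (pdir L)) \<noteq> 0"
      using u(1) by (simp only: of_int_eq_0_iff) simp
    then have ne: "c * b - d * a \<noteq> 0"
      by (simp add: a_def b_def c_def d_def)
    have "(until L - u) * (c * b - d * a) = y (pcone L) * d - y (nxt (pcone L)) * c"
      using u(2) by (simp add: algebra_simps)
    then have "until L - u = (y (pcone L) * d - y (nxt (pcone L)) * c) / (c * b - d * a)"
      using ne by (simp add: nonzero_eq_divide_eq)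
    then show "u \<in> {until L - (y (pcone L) * d - y (nxt (pcone L)) * c) / (c * b - d * a)}" by simp
  qed
  then show "finite ?S" by (rule finite_subset) simp
qed

definition suffixes :: "(nat \<Rightarrow> int) \<Rightarrow> (nat \<Rightarrow> real) \<Rightarrow> nat \<Rightarrow> ('k, 'p) piece list set" where
  "suffixes q Q r = {drop j ls |\<gamma> ls j. broken_line G q Q (\<gamma>, ls) \<and> pexp (last ls) \<notin> I \<and> j < length ls \<and>
     length ls - j = Suc r}"

text \<open>Induction from the endpoint backwards: a final segment leaves finitely many times for
  the end of the piece before it, and the datum of that piece has finitely many values.\<close>

lemma finite_suffixes: "finite (suffixes q Q r)"
proof (induction r)
  case 0
  have "suffixes q Q 0 \<subseteq> (\<lambda>X. [make_piece 0 X]) ` all_data q"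
  proof
    fix s assume "s \<in> suffixes q Q 0"
    then obtain \<gamma> ls j where s: "s = drop j ls" "broken_line G q Q (\<gamma>, ls)" "pexp (last ls) \<notin> I"
      "j < length ls" "length ls - j = Suc 0"
      by (auto simp: suffixes_def)
    have "s = ls ! j # drop (Suc j) ls" unfolding s(1) using s(4) by (simp add: Cons_nth_drop_Suc)
    moreover have "drop (Suc j) ls = []" using s(5) by simp
    moreover have "until (ls ! j) = 0"
    proof -
      have "j = length ls - 1" using s(4,5) by simp
      then show ?thesis using broken_line_unfold(4,5)[OF s(2)] by (simp add: last_conv_nth)
    qed
    ultimately have "s = [make_piece 0 (data (ls ! j))]"
      using make_piece_data[of "ls ! j"] by simp
    then show "s \<in> (\<lambda>X. [make_piece 0 X]) ` all_data q"
      using data_in_all[OF s(2,3,4)] by blast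
  qed
  then show ?case by (rule finite_subset) (simp add: finite_all_data)
next
  case (Suc r)
  have "suffixes q Q (Suc r) \<subseteq> (\<Union>s\<in>suffixes q Q r. \<Union>t\<in>break_times Q s. (\<lambda>X. make_piece t X # s) ` all_data q)"
  proof
    fix s assume "s \<in> suffixes q Q (Suc r)"
    then obtain \<gamma> ls j where s: "s = drop j ls" "broken_line G q Q (\<gamma>, ls)" "pexp (last ls) \<notin> I"
      "j < length ls" "length ls - j = Suc (Suc r)"
      by (auto simp: suffixes_def)
    have j: "Suc j < length ls" "length ls - Suc j = Suc r" using s(5) by auto
    have "drop (Suc j) ls \<in> suffixes q Q r"
      unfolding suffixes_def using s(2,3) j by blast
    moreover have "hd (drop (Suc j) ls) = ls ! Suc j" using j(1) by (simp add: hd_drop_conv_nth)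
    then have "until (ls ! j) \<in> break_times Q (drop (Suc j) ls)"
      using break_time[OF s(2,3) j(1)] unfolding break_times_def Let_def by auto
    moreover have "s = make_piece (until (ls ! j)) (data (ls ! j)) # drop (Suc j) ls"
      unfolding s(1) make_piece_data using s(4) by (simp add: Cons_nth_drop_Suc)
    ultimately show "s \<in> (\<Union>s\<in>suffixes q Q r. \<Union>t\<in>break_times Q s. (\<lambda>X. make_piece t X # s) ` all_data q)"
      using data_in_all[OF s(2,3,4)] by blast
  qed
  then show ?case
    by (rule finite_subset) (auto intro!: finite_UN_I Suc finite_break_times finite_imageI finite_all_data)
qed

text \<open>The pieces and the endpoint determine the positions at all breaks, and on each piece the
  motion is affine. Hence counting lists of pieces counts lines.\<close>

lemma broken_line_unique:
  assumes "broken_line G q Q (\<gamma>, ls)" "broken_line G q' Q (\<gamma>', ls)"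
  shows "\<gamma> = \<gamma>'"
proof
  fix t
  show "\<gamma> t = \<gamma>' t"
  proof (cases "t \<le> 0")
    case False
    then show ?thesis
      using broken_line_unfold(1)[OF assms(1)] broken_line_unfold(1)[OF assms(2)] by (simp add: extensional_def)
  next
    case True
    define j where "j = (LEAST j. j < length ls \<and> t \<le> until (ls ! j))"
    have "length ls - 1 < length ls \<and> t \<le> until (ls ! (length ls - 1))"
      using broken_line_unfold(4,5)[OF assms(1)] True by (simp add: last_conv_nth)
    then have j: "j < length ls \<and> t \<le> until (ls ! j)"
      unfolding j_def by (rule LeastI)
    have prev: "until (ls ! (j - 1)) \<le> t" if "0 < j"
    proof (rule ccontr)
      assume "\<not> until (ls ! (j - 1)) \<le> t"
      moreover have "j - 1 < length ls" using j by linarith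
      ultimately have "j - 1 < length ls \<and> t \<le> until (ls ! (j - 1))" by simp
      then have "j \<le> j - 1" unfolding j_def by (rule Least_le)
      then show False using that by simp
    qed
    note f = piece_formula[OF assms(1), of j t] piece_formula[OF assms(2), of j t]
    have pn: "pcone (ls ! j) < n" using pcone_less[OF assms(1)] j by blast
    have e: "\<gamma> (until (ls ! j)) = \<gamma>' (until (ls ! j))"
      using end_point_eq[OF assms(1)] end_point_eq[OF assms(2)] j by simp
    have "\<gamma> t = pt (pcone (ls ! j)) (\<gamma> t (pcone (ls ! j))) (\<gamma> t (nxt (pcone (ls ! j))))"
      using f(1) j prev by (intro pt_eq[OF pn]) blast
    also have "\<dots> = pt (pcone (ls ! j)) (\<gamma>' t (pcone (ls ! j))) (\<gamma>' t (nxt (pcone (ls ! j))))"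
      using f(2,3,5,6) j prev e by simp
    also have "\<dots> = \<gamma>' t"
      using f(4) j prev by (intro pt_eq[OF pn, symmetric]) blast
    finally show ?thesis .
  qed
qed

definition lines :: "(nat \<Rightarrow> real) \<Rightarrow> (nat \<Rightarrow> int) \<Rightarrow> ('k, 'p) broken set" where
  "lines Q q = {\<beta> \<in> broken_lines G q Q. pexp (last (snd \<beta>)) \<notin> I}"

lemma finite_lines: "finite (lines Q q)"
proof (cases "q = (\<lambda>_. 0)")
  case True
  then show ?thesis by (simp add: lines_def broken_lines_def)
next
  case False
  have sub: "snd ` lines Q q \<subseteq> (\<Union>r\<le>nil. suffixes q Q r)"
  proof
    fix ls assume "ls \<in> snd ` lines Q q"
    then obtain \<gamma> where b: "broken_line G q Q (\<gamma>, ls)" "pexp (last ls) \<notin> I"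
      using False by (auto simp: lines_def broken_lines_def)
    have ne: "0 < length ls" using broken_line_unfold(4)[OF b(1)] by simp
    then obtain r where r: "length ls = Suc r" by (cases "length ls") auto
    have "r \<le> nil" using data_invariant(2)[OF b, of r] r by simp
    moreover have "ls = drop 0 ls" by simp
    then have "ls \<in> suffixes q Q r"
      unfolding suffixes_def using b ne r by (metis (mono_tags, lifting) diff_zero mem_Collect_eq)
    ultimately show "ls \<in> (\<Union>r\<le>nil. suffixes q Q r)" by blast
  qed
  have "inj_on snd (lines Q q)"
  proof (rule inj_onI)
    fix \<beta> \<beta>' assume "\<beta> \<in> lines Q q" "\<beta>' \<in> lines Q q" "snd \<beta> = snd \<beta>'"
    then show "\<beta> = \<beta>'"
      using False broken_line_unique[of q Q "fst \<beta>" "snd \<beta>" q "fst \<beta>'"]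
      by (cases \<beta>; cases \<beta>') (auto simp: lines_def broken_lines_def)
  qed
  moreover have "finite (snd ` lines Q q)"
    by (rule finite_subset[OF sub]) (simp add: finite_suffixes)
  ultimately show ?thesis by (rule finite_imageD[rotated])
qed

lemma broken_lines_P:
  assumes "\<beta> \<in> broken_lines G q Q"
  shows "pexp (last (snd \<beta>)) \<in> P"
proof (cases "q = (\<lambda>_. 0)")
  case True
  then show ?thesis using assms P_zero by (auto simp: broken_lines_def)
next
  case False
  obtain \<gamma> ls where \<beta>: "\<beta> = (\<gamma>, ls)" by (cases \<beta>)
  have b: "broken_line G q Q (\<gamma>, ls)"
    using assms False by (auto simp: broken_lines_def \<beta>)
  have "ls \<noteq> []" by (rule broken_line_unfold(4)[OF b])
  then show ?thesis
    using pexp_P[OF b, of "length ls - 1"] by (simp add: \<beta> last_conv_nth)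
qed


subsection \<open>Broken lines ending near an integral point\<close>

text \<open>General and very close to \<open>q\<close>, made precise: in the coordinates of the
  cone, \<open>z\<close> lies strictly on the same side of the line through \<open>m\<close> as
  \<open>q\<close>, for all \<open>m\<close> in \<open>Wset\<close> whose line misses
  \<open>q\<close>.\<close>

definition near :: "(nat \<Rightarrow> int) \<Rightarrow> nat \<Rightarrow> (nat \<Rightarrow> real) \<Rightarrow> bool" where
  "near q i z \<longleftrightarrow> z \<in> irrational_points n \<and> z \<in> max_cone n i \<and> re q \<in> max_cone n i \<and>
     (\<forall>m\<in>Wset. m i * q (nxt i) - m (nxt i) * q i \<noteq> 0 \<longrightarrow>
        0 < real_of_int (m i * q (nxt i) - m (nxt i) * q i) * (real_of_int (m i) * z (nxt i) - real_of_int (m (nxt i)) * z i))"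

lemma nearD:
  assumes "i < n" "near q i z"
  shows "z \<in> irrational_points n" "z \<in> max_cone n i" "z \<in> max_cone_int n i" "re q \<in> max_cone n i"
  using assms(2) irrational_interior[OF _ _ assms(1), of z] unfolding near_def by blast+

lemma near_exists:
  assumes "q \<in> trop_int n"
  shows "\<exists>\<epsilon>>0. \<forall>i<n. \<forall>z\<in>max_cone n i.
    z \<in> irrational_points n \<and> (\<forall>j. \<bar>z j - real_of_int (q j)\<bar> < \<epsilon>) \<longrightarrow> near q i z"
proof -
  \<comment> \<open>The determinant of \<open>m\<close> and \<open>q\<close> is an integer, so at
    least \<open>1\<close> in absolute value if nonzero; within distance \<open>1 / S\<close> of
    \<open>q\<close> it changes by less than \<open>1\<close>. The summand \<open>1\<close> makes
    \<open>S\<close> positive and the bound \<open>(S - 1) / S\<close> less than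
    \<open>1\<close>.\<close>
  define S :: real where "S = 1 + (\<Sum>m\<in>Wset. \<Sum>i<n. \<bar>real_of_int (m i)\<bar> + \<bar>real_of_int (m (nxt i))\<bar>)"
  have le: "\<bar>real_of_int (m i)\<bar> + \<bar>real_of_int (m (nxt i))\<bar> \<le> S - 1" if "m \<in> Wset" "i < n" for m i
  proof -
    have "\<bar>real_of_int (m i)\<bar> + \<bar>real_of_int (m (nxt i))\<bar> \<le> (\<Sum>i<n. \<bar>real_of_int (m i)\<bar> + \<bar>real_of_int (m (nxt i))\<bar>)"
      using that(2) by (intro member_le_sum) auto
    also have "\<dots> \<le> (\<Sum>m\<in>Wset. \<Sum>i<n. \<bar>real_of_int (m i)\<bar> + \<bar>real_of_int (m (nxt i))\<bar>)"
      using that(1) finite_Wset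
      by (intro member_le_sum[of m Wset "\<lambda>m. \<Sum>i<n. \<bar>real_of_int (m i)\<bar> + \<bar>real_of_int (m (nxt i))\<bar>"])
        (auto intro: sum_nonneg)
    finally show ?thesis by (simp add: S_def)
  qed
  have S: "1 \<le> S" unfolding S_def by (simp add: sum_nonneg)
  show ?thesis
  proof (intro exI[of _ "1 / S"] conjI allI impI ballI)
    show "0 < 1 / S" using S by simp
    fix i z assume i: "i < n" and zc: "z \<in> max_cone n i"
      and zi: "z \<in> irrational_points n \<and> (\<forall>j. \<bar>z j - real_of_int (q j)\<bar> < 1 / S)"
    then have z: "z \<in> max_cone n i" "z \<in> irrational_points n"
      and close: "\<forall>j. \<bar>z j - real_of_int (q j)\<bar> < 1 / S" by auto
    obtain l where "re q \<in> max_cone n l" using assms by (auto simp: trop_int_def trop_iff)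
    then have q0: "0 \<le> q j" for j by (auto simp: max_cone_iff re_def)
    \<comment> \<open>Since \<open>1 / S \<le> 1\<close>, integrality forces the coordinates of
      \<open>q\<close> outside the cone of \<open>z\<close> to vanish.\<close>
    have "q j = 0" if "j \<noteq> i" "j \<noteq> nxt i" for j
    proof -
      have "\<bar>real_of_int (q j)\<bar> < 1 / S"
        using close[rule_format, of j] z(1) that by (simp add: max_cone_iff)
      also have "\<dots> \<le> 1" using S by simp
      finally show ?thesis by simp
    qed
    then have qc: "re q \<in> max_cone n i"
      using q0 by (simp add: max_cone_iff re_def)
    have "0 < real_of_int (m i * q (nxt i) - m (nxt i) * q i) * (real_of_int (m i) * z (nxt i) - real_of_int (m (nxt i)) * z i)"
      if m: "m \<in> Wset" "m i * q (nxt i) - m (nxt i) * q i \<noteq> 0" for m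
    proof -
      define a b :: real where "a = m i" and "b = m (nxt i)"
      define dq dz :: real where "dq = real_of_int (m i * q (nxt i) - m (nxt i) * q i)"
        and "dz = a * z (nxt i) - b * z i"
      have dq1: "1 \<le> \<bar>dq\<bar>" unfolding dq_def using m(2) by linarith
      have "dz - dq = a * (z (nxt i) - q (nxt i)) - b * (z i - q i)"
        by (simp add: dz_def dq_def a_def b_def algebra_simps)
      also have "\<bar>\<dots>\<bar> \<le> \<bar>a\<bar> * \<bar>z (nxt i) - q (nxt i)\<bar> + \<bar>b\<bar> * \<bar>z i - q i\<bar>"
        by (metis abs_mult abs_triangle_ineq4)
      also have "\<dots> \<le> \<bar>a\<bar> * (1 / S) + \<bar>b\<bar> * (1 / S)"
        by (intro add_mono mult_left_mono) (use close in \<open>auto intro: less_imp_le\<close>)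
      also have "\<dots> = (\<bar>a\<bar> + \<bar>b\<bar>) / S" by (simp add: add_divide_distrib)
      also have "\<dots> \<le> (S - 1) / S"
        using le[OF m(1) i] S by (intro divide_right_mono) (auto simp: a_def b_def)
      also have "\<dots> < 1" using S by simp
      finally have "\<bar>dz - dq\<bar> < \<bar>dq\<bar>" using dq1 by linarith
      then have "0 < dq * dz"
        by (cases "0 < dq") (auto simp: zero_less_mult_iff)
      then show ?thesis by (simp add: dq_def dz_def a_def b_def)
    qed
    then show "near q i z" using z qc by (simp add: near_def)
  qed
qed

definition straight :: "(nat \<Rightarrow> int) \<Rightarrow> nat \<Rightarrow> (nat \<Rightarrow> real) \<Rightarrow> ('k, 'p) broken" where
  "straight q i z = (\<lambda>t\<in>{..0::real}. pt i (z i - t * q i) (z (nxt i) - t * q (nxt i)),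
     [\<lparr>until = 0, pcone = i, pcoef = 1, pexp = 0, pdir = coords n i q\<rparr>])"

text \<open>The constant line for \<open>0\<close> is a degenerate straight line, so
  \<open>q = 0\<close> fits the same formulas.\<close>

lemma straight_zero:
  assumes "i < n" "near (\<lambda>_. 0) i z"
  shows "broken_lines G (\<lambda>_. 0) z = {straight (\<lambda>_. 0) i z}"
proof -
  note z = nearD[OF assms]
  have "(THE j. j < comps G \<and> z \<in> max_cone_int (comps G) j) = i"
  proof (rule the_equality)
    fix j assume "j < n \<and> z \<in> max_cone_int n j"
    then show "j = i"
      using interior_unique[OF z(3) _ assms(1), of j] by (simp add: max_cone_int_iff)
  qed (simp add: assms(1) z(3))
  moreover have "pt i (z i) (z (nxt i)) = z"
    by (rule pt_eq[OF assms(1) z(2), symmetric])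
  ultimately show ?thesis
    by (simp add: broken_lines_def straight_def coords_def)
qed

text \<open>Backwards in time the coordinates of \<open>z - t * q\<close> never decrease, so the
  line stays in the open cone.\<close>

lemma straight_broken_line:
  assumes "i < n" "near q i z" "q \<noteq> (\<lambda>_. 0)"
  shows "broken_line G q z (straight q i z)"
proof -
  note z = nearD(2,3)[OF assms(1,2)] and q = nearD(4)[OF assms(1,2)]
  have pos: "0 < z i" "0 < z (nxt i)" "0 \<le> q i" "0 \<le> q (nxt i)"
    using z(2) q by (auto simp: max_cone_int_iff max_cone_iff re_def)
  let ?\<gamma> = "\<lambda>t\<in>{..0::real}. pt i (z i - t * q i) (z (nxt i) - t * q (nxt i))"
  have int: "?\<gamma> t \<in> max_cone_int n i" if "t \<le> 0" for t :: real
  proof -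
    have "t * q i \<le> 0" "t * q (nxt i) \<le> 0"
      using that pos by (auto intro: mult_nonpos_nonneg)
    then show ?thesis using that pos by (simp add: pt_simps[OF assms(1)])
  qed
  then have cone: "?\<gamma> t \<in> max_cone n i" if "t \<le> 0" for t :: real
    using that by (simp add: max_cone_int_iff)
  have "continuous_on {..0} (\<lambda>t::real. pt i (z i - t * q i) (z (nxt i) - t * q (nxt i)))"
    by (intro continuous_on_pt continuous_intros)
  then have cont: "continuous_on {..0} ?\<gamma>"
    by (rule continuous_on_eq) simp
  have im: "?\<gamma> ` {..0} \<subseteq> trop n - {\<lambda>_. 0}"
  proof
    fix x assume "x \<in> ?\<gamma> ` {..0}"
    then obtain t where t: "t \<le> 0" "x = ?\<gamma> t" by auto
    have "x \<in> trop n" unfolding trop_iff t(2) using cone[OF t(1)] assms(1) by blast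
    moreover have "0 < x i" using int[OF t(1)] t(2) by (simp add: max_cone_int_iff)
    ultimately show "x \<in> trop n - {\<lambda>_. 0}" by auto
  qed
  have zero: "?\<gamma> 0 = z" using pt_eq[OF assms(1) z(1)] by simp
  have vals: "?\<gamma> t i = z i - t * q i" "?\<gamma> t (nxt i) = z (nxt i) - t * q (nxt i)" if "t \<le> 0" for t :: real
    using that by (simp_all add: pt_simps[OF assms(1)])
  show ?thesis
    unfolding straight_def broken_line_def Let_def prod.case nxt_def[symmetric]
    using cont im zero int cone assms(1) q vals
    by (simp add: coords_eq del: restrict_apply)
qed

lemma near_line:
  assumes "i < n" "near q i z" "\<beta> \<in> lines z q'" "pdir (last (snd \<beta>)) = coords n i q" "q' \<in> trop_int n"
  shows "q' = q \<and> \<beta> = straight q i z"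
proof -
  note z = nearD(1-3)[OF assms(1,2)] and q = nearD(4)[OF assms(1,2)]
  have qeq: "q' = q" if "re q' \<in> max_cone n i" "coords n i q' = coords n i q"
  proof
    fix j show "q' j = q j"
      using that q by (cases "j = i"; cases "j = nxt i") (auto simp: coords_eq max_cone_iff re_def)
  qed
  show ?thesis
  proof (cases "q' = (\<lambda>_. 0)")
    case True
    have "re (\<lambda>_. 0) \<in> max_cone n i" by (simp add: re_def max_cone_iff)
    moreover have "pdir (last (snd \<beta>)) = (0, 0)"
      using assms(3) True by (auto simp: lines_def broken_lines_def)
    ultimately have "q' = q" using qeq True assms(4) by (simp add: coords_def)
    moreover have "\<beta> = straight q i z"
      using assms(3) straight_zero[OF assms(1), of z] assms(2) calculation True by (auto simp: lines_def)
    ultimately show ?thesis by blast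
  next
    case False
    obtain \<gamma> ls where \<beta>: "\<beta> = (\<gamma>, ls)" by (cases \<beta>)
    have b: "broken_line G q' z (\<gamma>, ls)" and nI: "pexp (last ls) \<notin> I"
      using assms(3) False by (auto simp: lines_def broken_lines_def \<beta>)
    have ne: "ls \<noteq> []" by (rule broken_line_unfold(4)[OF b])
    define L where "L = last ls"
    have Ln: "L = ls ! (length ls - 1)" using ne by (simp add: L_def last_conv_nth)
    have l: "length ls - 1 < length ls" using ne by simp
    have L0: "until L = 0" using broken_line_unfold(5)[OF b] by (simp add: L_def)
    have "\<gamma> 0 \<in> max_cone n (pcone L)"
    proof -
      have "until (ls ! (length ls - 1 - 1)) \<le> 0" if "0 < length ls - 1"
        by (rule until_nonpos[OF b]) (use that in linarith)
      then show ?thesis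
        using piece_formula(1)[OF b l, of 0] unfolding Ln[symmetric] L0 by (meson order_refl)
    qed
    then have pc: "pcone L = i"
      using interior_unique[OF z(3) _ assms(1) pcone_less[OF b l, folded Ln]] broken_line_unfold(3)[OF b]
      by simp
    have pd: "pdir L = (q i, q (nxt i))"
      using assms(4) by (simp add: \<beta> L_def coords_eq)
    have "length ls = 1"
    proof (rule ccontr)
      assume "length ls \<noteq> 1"
      then obtain j where j: "length ls = Suc (Suc j)" using ne by (cases ls rule: list.exhaust; cases "tl ls") auto
      then have j': "Suc j < length ls" "ls ! Suc j = L" by (simp_all add: Ln)
      have "drop (Suc j) ls = [L]" using j Cons_nth_drop_Suc[of "Suc j" ls] j'(2) by simp
      then have ep: "end_point z (drop (Suc j) ls) = z" by simp
      define t where "t = until L - until (ls ! j)"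
      have t: "0 < t" using until_less[OF b, of j "Suc j"] j' by (simp add: t_def)
      \<comment> \<open>At the previous break the line is at \<open>z + t * q\<close> on the ray of
        \<open>m\<close>. So the determinant of \<open>m\<close> with \<open>z\<close> is
        \<open>- t\<close> times that with \<open>q\<close>, of the opposite sign, against
        \<open>near\<close>.\<close>
      obtain m where m: "m \<in> Wset" "m i * q (nxt i) - m (nxt i) * q i \<noteq> 0"
        "(z i + t * q i) * m (nxt i) = (z (nxt i) + t * q (nxt i)) * m i"
        using break_time[OF b nI j'(1)] unfolding ep j'(2) pc pd t_def[symmetric] by auto
      let ?dq = "real_of_int (m i * q (nxt i) - m (nxt i) * q i)"
      have "?dq * (real_of_int (m i) * z (nxt i) - real_of_int (m (nxt i)) * z i) = - t * (?dq * ?dq)"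
      proof -
        have "real_of_int (m i) * z (nxt i) - real_of_int (m (nxt i)) * z i = - t * ?dq"
          using m(3) by (simp add: algebra_simps)
        then show ?thesis by (simp only: mult_ac)
      qed
      moreover have "0 < ?dq * (real_of_int (m i) * z (nxt i) - real_of_int (m (nxt i)) * z i)"
        using assms(2) m(1,2) by (auto simp: near_def)
      moreover have "0 \<le> t * (?dq * ?dq)" using t by (intro mult_nonneg_nonneg zero_le_square) simp
      ultimately show False by simp
    qed
    then have ls: "ls = [L]" using ne by (cases ls) (auto simp: L_def)
    have h: "re q' \<in> max_cone n i" "pcoef L = 1" "pexp L = 0" "pdir L = coords n i q'"
      using broken_line_unfold(8)[OF b] pc by (simp_all add: ls Let_def)
    have qq: "q' = q" using qeq[OF h(1)] h(4) pd by (simp add: coords_eq)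
    have "L = \<lparr>until = 0, pcone = i, pcoef = 1, pexp = 0, pdir = coords n i q\<rparr>"
      using L0 pc h qq by (cases L) simp
    then have ls': "ls = snd (straight q i z)" by (simp add: straight_def ls)
    have "\<gamma> = fst (straight q i z)"
      by (rule broken_line_unique[OF b, of q])
        (use straight_broken_line[OF assms(1,2)] False qq in \<open>simp add: ls'\<close>)
    then show ?thesis using qq ls' by (simp add: \<beta>)
  qed
qed

definition Lsum :: "(nat \<Rightarrow> real) \<Rightarrow> (nat \<Rightarrow> int) \<Rightarrow> ('p \<times> int \<times> int) \<Rightarrow>\<^sub>0 'k" where
  "Lsum Q q = (\<Sum>\<beta>\<in>lines Q q. bl_mono \<beta>)"

lemma lift_at_eq: "lift_at G I Q q = sig.cls (Lsum Q q)"
  by (simp add: lift_at_def cls_sigma_eq Lsum_def lines_def)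

lemma keys_Lsum: "keys (Lsum Q q) \<subseteq> P \<times> UNIV"
proof -
  have "Lsum Q q \<in> {f. keys f \<subseteq> P \<times> UNIV}"
    unfolding Lsum_def by (intro sig.S_sum) (use broken_lines_P in \<open>auto simp: lines_def bl_mono_def Let_def split: if_splits\<close>)
  then show ?thesis by simp
qed

text \<open>Reading the coefficient of X^q at \<open>z\<close> is dual to the family of all lifts at
  \<open>z\<close>; this isolates a single theta function in an expansion.\<close>

lemma lookup_Lsum_near:
  assumes "i < n" "near q i z" "q' \<in> trop_int n" "p \<notin> I"
  shows "lookup (Lsum z q') (p, coords n i q) = (if q' = q \<and> p = 0 then 1 else 0)"
proof -
  have "lookup (Lsum z q') (p, coords n i q) = (\<Sum>\<beta>\<in>lines z q'. lookup (bl_mono \<beta>) (p, coords n i q))"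
    by (simp add: Lsum_def lookup_sum)
  also have "\<dots> = (\<Sum>\<beta>\<in>lines z q'. if \<beta> = straight q i z then (if q' = q \<and> p = 0 then 1 else 0) else 0)"
  proof (rule sum.cong[OF refl])
    fix \<beta> assume \<beta>: "\<beta> \<in> lines z q'"
    show "lookup (bl_mono \<beta>) (p, coords n i q) =
        (if \<beta> = straight q i z then (if q' = q \<and> p = 0 then 1 else 0) else 0)"
    proof (cases "pdir (last (snd \<beta>)) = coords n i q")
      case True
      then show ?thesis
        using near_line[OF assms(1,2) \<beta> True assms(3)]
        by (auto simp: bl_mono_def straight_def Let_def lookup_single when_def)
    next
      case False
      then have "\<beta> \<noteq> straight q i z" by (auto simp: straight_def)
      then show ?thesis using False by (simp add: bl_mono_def Let_def lookup_single when_def)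
    qed
  qed
  also have "\<dots> = (if straight q i z \<in> lines z q' then (if q' = q \<and> p = 0 then 1 else 0) else 0)"
    by (simp add: sum.delta finite_lines)
  also have "\<dots> = (if q' = q \<and> p = 0 then 1 else 0)"
  proof -
    \<comment> \<open>\<open>p = 0\<close> and \<open>p \<notin> I\<close> give
      \<open>0 \<notin> I\<close>, so the straight line is counted.\<close>
    have "straight q i z \<in> lines z q" if "p = 0"
      using straight_zero[OF assms(1), of z] straight_broken_line[OF assms(1,2)] assms(2,4) that
      by (cases "q = (\<lambda>_. 0)") (auto simp: lines_def broken_lines_def straight_def)
    then show ?thesis by auto
  qed
  finally show ?thesis .
qed

section \<open>Theta functions\<close>

lemma consistent_path:
  assumes "q \<in> trop_int n" "q \<noteq> (\<lambda>_. 0)" "i < n" "Q \<in> irrational_points n" "Q' \<in> irrational_points n"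
    "Q \<in> max_cone n i" "Q' \<in> max_cone n i"
  shows "sig.cls (Lsum Q' q) = path_aut G I i Q Q' (sig.cls (Lsum Q q))"
  using consistent I_ideal I_radical assms unfolding consistent_def Let_def lift_at_eq[symmetric] by blast

lemma consistent_ray:
  assumes "q \<in> trop_int n" "q \<noteq> (\<lambda>_. 0)" "i < n" "next_to_ray G I i (prv n i) Qm" "next_to_ray G I i i Qp"
  shows "\<exists>l\<in>carrier (ring_rho G I i). psi_minus G I i l = sig.cls (Lsum Qm q) \<and> psi_plus G I i l = sig.cls (Lsum Qp q)"
  using consistent I_ideal I_radical assms unfolding consistent_def Let_def lift_at_eq[symmetric] by blast

lemma next_to_rayD: "next_to_ray G I i j Q \<Longrightarrow> Q \<in> irrational_points n \<and> Q \<in> max_cone n j"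
  by (auto simp: next_to_ray_def max_cone_int_iff)

text \<open>No wall lies between two points next to the same ray. \<open>consistent\<close> provides
  a lift for each pair of points separately; this makes one lift serve all pairs.\<close>

lemma lift_lower_const:
  assumes "q \<in> trop_int n" "q \<noteq> (\<lambda>_. 0)" "i < n" "next_to_ray G I i i Q" "next_to_ray G I i i Q'"
  shows "sig.cls (Lsum Q' q) = sig.cls (Lsum Q q)"
proof -
  have *: "sig.cls (Lsum Q' q) = sig.cls (Lsum Q q)"
    if "next_to_ray G I i i Q" "next_to_ray G I i i Q'" "slope n i Q \<le> slope n i Q'" for Q Q'
  proof -
    have "path_aut G I i Q Q' = id"
      by (rule path_aut_no_walls[OF _ that(3)]) (use next_to_ray_lowerD[OF assms(3) that(2)] in fastforce)
    then show ?thesis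
      using consistent_path[OF assms(1-3), of Q Q'] next_to_rayD[OF that(1)] next_to_rayD[OF that(2)] by simp
  qed
  show ?thesis
    using *[OF assms(4,5)] *[OF assms(5,4)] by (cases "slope n i Q \<le> slope n i Q'") simp_all
qed

lemma lift_upper_const:
  assumes "q \<in> trop_int n" "q \<noteq> (\<lambda>_. 0)" "i < n" "next_to_ray G I (nxt i) i Q" "next_to_ray G I (nxt i) i Q'"
  shows "sig.cls (Lsum Q' q) = sig.cls (Lsum Q q)"
proof -
  have *: "sig.cls (Lsum Q' q) = sig.cls (Lsum Q q)"
    if "next_to_ray G I (nxt i) i Q" "next_to_ray G I (nxt i) i Q'" "slope n i Q \<le> slope n i Q'" for Q Q'
  proof -
    have "path_aut G I i Q Q' = id"
      by (rule path_aut_no_walls[OF _ that(3)]) (use next_to_ray_upperD[OF assms(3) that(1)] in fastforce)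
    then show ?thesis
      using consistent_path[OF assms(1-3), of Q Q'] next_to_rayD[OF that(1)] next_to_rayD[OF that(2)] by simp
  qed
  show ?thesis
    using *[OF assms(4,5)] *[OF assms(5,4)] by (cases "slope n i Q \<le> slope n i Q'") simp_all
qed

definition theta_rep_at :: "(nat \<Rightarrow> int) \<Rightarrow> nat \<Rightarrow> (('p \<times> int \<times> int \<times> int) \<Rightarrow>\<^sub>0 'k) \<Rightarrow> bool" where
  "theta_rep_at q i f \<longleftrightarrow> keys f \<subseteq> P \<times> rho_exponents \<and> lift_ray G I i q = rcls i f \<and>
     (\<forall>Q. next_to_ray G I i (prv n i) Q \<longrightarrow> sig.cls (Psim i f) = sig.cls (Lsum Q q)) \<and>
     (\<forall>Q. next_to_ray G I i i Q \<longrightarrow> sig.cls (Psip i f) = sig.cls (Lsum Q q))"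

text \<open>Existence is the second consistency condition, uniqueness is
  \<open>Psi_injective\<close>; together they evaluate the \<open>THE\<close> in
  \<open>lift_ray\<close>.\<close>

lemma theta_rep_exists:
  assumes "q \<in> trop_int n" "q \<noteq> (\<lambda>_. 0)" "i < n"
  shows "\<exists>f. theta_rep_at q i f"
proof -
  interpret R: pm_quotient "{f :: ('p \<times> int \<times> int \<times> int) \<Rightarrow>\<^sub>0 'k. keys f \<subseteq> P \<times> rho_exponents}" "ideal_rho G I i"
    by (rule pm_quotient_rho[OF assms(3)])
  have pi: "prv n i < n" "nxt (prv n i) = i"
    using prv_less nxt_prv[OF assms(3)] by auto
  obtain Qp where Qp: "next_to_ray G I i i Qp"
    using next_to_ray_lower_exists[OF assms(3)] by blast
  obtain Qm where Qm: "next_to_ray G I i (prv n i) Qm"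
    using next_to_ray_upper_exists[OF pi(1)] pi(2) by auto
  have rep: "\<exists>f. keys f \<subseteq> P \<times> rho_exponents \<and> l = rcls i f" if "l \<in> carrier (ring_rho G I i)" for l
    using that by (auto simp: ring_rho_eq R.carrier_Q rcls_eq[OF assms(3)])
  obtain l where l: "l \<in> carrier (ring_rho G I i)"
    "psi_minus G I i l = sig.cls (Lsum Qm q)" "psi_plus G I i l = sig.cls (Lsum Qp q)"
    using consistent_ray[OF assms Qm Qp] by blast
  obtain f where f: "keys f \<subseteq> P \<times> rho_exponents" "l = rcls i f" using rep[OF l(1)] by blast
  have m: "sig.cls (Psim i f) = sig.cls (Lsum Q q)" if "next_to_ray G I i (prv n i) Q" for Q
    using l(2) lift_upper_const[OF assms(1,2) pi(1), of Qm Q] Qm that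
    by (simp add: f(2) psi_minus_rcls[OF assms(3) f(1)] pi(2))
  have p: "sig.cls (Psip i f) = sig.cls (Lsum Q q)" if "next_to_ray G I i i Q" for Q
    using l(3) lift_lower_const[OF assms Qp that] by (simp add: f(2) psi_plus_rcls[OF assms(3) f(1)])
  have "lift_ray G I i q = l"
    unfolding lift_ray_def lift_at_eq
  proof (rule the_equality)
    show "l \<in> carrier (ring_rho G I i) \<and> (\<forall>Qm Qp. next_to_ray G I i (prv (comps G) i) Qm \<and> next_to_ray G I i i Qp \<longrightarrow>
        psi_minus G I i l = sig.cls (Lsum Qm q) \<and> psi_plus G I i l = sig.cls (Lsum Qp q))"
      using l(1) m p by (simp add: f(2) psi_minus_rcls[OF assms(3) f(1)] psi_plus_rcls[OF assms(3) f(1)])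
  next
    fix l' assume l': "l' \<in> carrier (ring_rho G I i) \<and> (\<forall>Qm Qp. next_to_ray G I i (prv (comps G) i) Qm \<and> next_to_ray G I i i Qp \<longrightarrow>
        psi_minus G I i l' = sig.cls (Lsum Qm q) \<and> psi_plus G I i l' = sig.cls (Lsum Qp q))"
    then obtain f' where f': "keys f' \<subseteq> P \<times> rho_exponents" "l' = rcls i f'" using rep by blast
    have "sig.cls (Psim i f') = sig.cls (Psim i f)" "sig.cls (Psip i f') = sig.cls (Psip i f)"
      using l' Qm Qp m[OF Qm] p[OF Qp]
      by (simp_all add: f'(2) psi_minus_rcls[OF assms(3) f'(1)] psi_plus_rcls[OF assms(3) f'(1)])
    then have "f' - f \<in> ideal_rho G I i"
      using R.S_diff[of f' f] f(1) f'(1)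
      by (intro Psi_injective[OF assms(3)]) (simp_all add: Psim_diff Psip_diff sig.cls_eq_iff)
    then show "l' = l"
      unfolding f(2) f'(2) rcls_eq[OF assms(3)] by (rule R.cls_eqI)
  qed
  then show ?thesis
    using f m p unfolding theta_rep_at_def by blast
qed

section \<open>Restriction of theta functions to chambers\<close>

definition Th :: "(nat \<Rightarrow> int) \<Rightarrow> nat \<Rightarrow> ('p \<times> int \<times> int \<times> int) \<Rightarrow>\<^sub>0 'k" where
  "Th q i = (if q = (\<lambda>_. 0) then 1 else (SOME f. theta_rep_at q i f))"

lemma Th_rep:
  assumes "q \<in> trop_int n" "q \<noteq> (\<lambda>_. 0)" "i < n"
  shows "theta_rep_at q i (Th q i)"
  using someI_ex[OF theta_rep_exists[OF assms]] assms(2) by (simp add: Th_def)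

lemma keys_Th: "q \<in> trop_int n \<Longrightarrow> i < n \<Longrightarrow> keys (Th q i) \<subseteq> P \<times> rho_exponents"
  using Th_rep[of q i] prho.S_one by (cases "q = (\<lambda>_. 0)") (auto simp: theta_rep_at_def Th_def)

lemma push_const_one: "push (\<lambda>p. (p, 0, 0)) 1 = (1 :: ('p \<times> int \<times> int) \<Rightarrow>\<^sub>0 'k)"
  "push (\<lambda>p. (p, 0, 0, 0)) 1 = (1 :: ('p \<times> int \<times> int \<times> int) \<Rightarrow>\<^sub>0 'k)"
proof -
  have "push (\<lambda>p. (p, 0, 0)) (single 0 1) = (1 :: ('p \<times> int \<times> int) \<Rightarrow>\<^sub>0 'k)"
    "push (\<lambda>p. (p, 0, 0, 0)) (single 0 1) = (1 :: ('p \<times> int \<times> int \<times> int) \<Rightarrow>\<^sub>0 'k)"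
    by (simp_all only: push_single single_zero3 single_zero4)
  then show "push (\<lambda>p. (p, 0, 0)) 1 = (1 :: ('p \<times> int \<times> int) \<Rightarrow>\<^sub>0 'k)"
    "push (\<lambda>p. (p, 0, 0, 0)) 1 = (1 :: ('p \<times> int \<times> int \<times> int) \<Rightarrow>\<^sub>0 'k)"
    by (simp_all only: single_one)
qed

lemma Wf_one: "Wf i ms 1 = 1"
  using Wf_const[of i ms 1] by (simp only: push_const_one)

definition chain :: "nat \<Rightarrow> (nat \<Rightarrow> real) \<Rightarrow> (nat \<Rightarrow> int) list" where
  "chain i z = sort_walls G i (walls_below i z)"

definition full_chain :: "nat \<Rightarrow> (nat \<Rightarrow> int) list" where
  "full_chain i = sort_walls G i (walls_in G I i)"

lemma set_chain: "set (chain i z) \<subseteq> walls_in G I i"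
  unfolding chain_def by (subst set_sort_walls) (auto simp: walls_below_def)

lemma set_full_chain: "set (full_chain i) \<subseteq> walls_in G I i"
  unfolding full_chain_def by (subst set_sort_walls) auto

text \<open>Restriction of a global function to the chamber of \<open>z\<close> in the cone
  \<open>i\<close>: pass from the ray \<open>i\<close> into the cone and cross the walls below
  \<open>z\<close>.\<close>

definition ev :: "nat \<Rightarrow> (nat \<Rightarrow> real) \<Rightarrow> (nat \<Rightarrow> ('p \<times> int \<times> int \<times> int) \<Rightarrow>\<^sub>0 'k) \<Rightarrow> ('p \<times> int \<times> int) \<Rightarrow>\<^sub>0 'k" where
  "ev i z F = Wf i (chain i z) (Psip i (F i))"

lemma keys_ev: "i < n \<Longrightarrow> keys (F i) \<subseteq> P \<times> rho_exponents \<Longrightarrow> keys (ev i z F) \<subseteq> P \<times> UNIV"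
  unfolding ev_def by (intro keys_Wf[OF set_chain _ P_ideal] keys_Psip[OF _ P_ideal])

text \<open>If \<open>0 \<in> I\<close>, the quotient is zero and the constant line is not counted;
  otherwise it contributes \<open>1\<close>.\<close>

lemma cls_Lsum_zero:
  assumes "i < n" "z \<in> irrational_points n" "z \<in> max_cone n i"
  shows "sig.cls (Lsum z (\<lambda>_. 0)) = sig.cls 1"
proof (cases "0 \<in> I")
  case True
  then have "lines z (\<lambda>_. 0) = {}" by (auto simp: lines_def broken_lines_def)
  then have "keys (Lsum z (\<lambda>_. 0) - 1) \<subseteq> I \<times> UNIV"
    using True by (simp add: Lsum_def zero_prod_def)
  then show ?thesis by (intro sig.cls_eqI) simp
next
  case False
  obtain \<beta> :: "('k, 'p) broken" where \<beta>: "broken_lines G (\<lambda>_. 0) z = {\<beta>}"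
    "last (snd \<beta>) = \<lparr>until = 0, pcone = (THE i. i < n \<and> z \<in> max_cone_int n i), pcoef = 1, pexp = 0, pdir = (0, 0)\<rparr>"
    by (simp add: broken_lines_def)
  then have "lines z (\<lambda>_. 0) = {\<beta>}" using False by (auto simp: lines_def)
  then have "Lsum z (\<lambda>_. 0) = single (0, 0, 0) 1"
    by (simp add: Lsum_def bl_mono_def \<beta>(2))
  then show ?thesis by (simp add: single_zero3)
qed

text \<open>The first consistency condition, along a path from a point next to the ray
  \<open>i\<close> to \<open>z\<close>.\<close>

lemma cls_ev_Th:
  assumes "q \<in> trop_int n" "i < n" "z \<in> irrational_points n" "z \<in> max_cone n i"
  shows "sig.cls (ev i z (Th q)) = sig.cls (Lsum z q)"
proof (cases "q = (\<lambda>_. 0)")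
  case True
  have "ev i z (Th q) = 1" by (simp add: ev_def Th_def True Psip_one Wf_one)
  then show ?thesis using cls_Lsum_zero[OF assms(2-4)] True by simp
next
  case False
  obtain Q where Q: "next_to_ray G I i i Q" using next_to_ray_lower_exists[OF assms(2)] by blast
  note Q' = next_to_rayD[OF Q]
  have Th: "sig.cls (Psip i (Th q i)) = sig.cls (Lsum Q q)"
    using Th_rep[OF assms(1) False assms(2)] Q by (simp add: theta_rep_at_def)
  have kp: "keys (Psip i (Th q i)) \<subseteq> P \<times> UNIV"
    by (rule keys_Psip[OF assms(2) P_ideal keys_Th[OF assms(1,2)]])
  show ?thesis
  proof (cases "slope n i Q \<le> slope n i z")
    case True
    have "sig.cls (Lsum z q) = path_aut G I i Q z (sig.cls (Lsum Q q))"
      using consistent_path[OF assms(1) False assms(2) _ assms(3) _ assms(4)] Q' by blast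
    also have "\<dots> = sig.cls (ev i z (Th q))"
      unfolding path_aut_from_ray[OF assms(2) Q True] Th[symmetric] chain_def[symmetric] ev_def
      by (rule fold_wall_crossing[OF set_chain assms(2) kp])
    finally show ?thesis by simp
  next
    case F: False
    \<comment> \<open>The chosen point next to the ray may lie above \<open>z\<close>. Then no wall
      is below either of them, and the path from \<open>z\<close> to \<open>Q\<close> crosses
      nothing.\<close>
    then have le: "slope n i z \<le> slope n i Q" by simp
    have "walls_below i z = {}"
      using next_to_ray_lowerD[OF assms(2) Q] F by (fastforce simp: walls_below_def)
    then have "chain i z = []"
      using set_sort_walls[of "{}" i] by (simp add: chain_def)
    then have 1: "ev i z (Th q) = Psip i (Th q i)" by (simp add: ev_def Wf_def)
    have "path_aut G I i z Q = id"
      by (rule path_aut_no_walls[OF _ le]) (use next_to_ray_lowerD[OF assms(2) Q] in fastforce)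
    then have "sig.cls (Lsum Q q) = sig.cls (Lsum z q)"
      using consistent_path[OF assms(1) False assms(2,3) _ assms(4)] Q' by simp
    then show ?thesis using 1 Th by simp
  qed
qed


section \<open>The algebra of global functions\<close>

text \<open>Polynomial representatives of global functions. The gluing condition is a congruence, so
  the set is closed under products although wall crossings are multiplicative only modulo
  \<open>I\<close>.\<close>

definition families :: "(nat \<Rightarrow> ('p \<times> int \<times> int \<times> int) \<Rightarrow>\<^sub>0 'k) set" where
  "families = {F. (\<forall>i<n. keys (F i) \<subseteq> P \<times> rho_exponents) \<and>
     (\<forall>i<n. keys (Psim (nxt i) (F (nxt i)) - Wf i (full_chain i) (Psip i (F i))) \<subseteq> I \<times> UNIV)}"

lemma families_keys: "F \<in> families \<Longrightarrow> i < n \<Longrightarrow> keys (F i) \<subseteq> P \<times> rho_exponents"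
  by (simp add: families_def)

lemma families_glue: "F \<in> families \<Longrightarrow> i < n \<Longrightarrow>
    keys (Psim (nxt i) (F (nxt i)) - Wf i (full_chain i) (Psip i (F i))) \<subseteq> I \<times> UNIV"
  by (simp add: families_def)

lemma keys_add_subset: "keys f \<subseteq> T \<Longrightarrow> keys g \<subseteq> T \<Longrightarrow> keys (f + g) \<subseteq> T"
  using Poly_Mapping.keys_add[of f g] by blast

lemma families_add:
  assumes "F \<in> families" "F' \<in> families"
  shows "(\<lambda>i. F i + F' i) \<in> families"
proof -
  have "Psim (nxt i) (F (nxt i) + F' (nxt i)) - Wf i (full_chain i) (Psip i (F i + F' i)) =
      (Psim (nxt i) (F (nxt i)) - Wf i (full_chain i) (Psip i (F i))) +
      (Psim (nxt i) (F' (nxt i)) - Wf i (full_chain i) (Psip i (F' i)))" for i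
    by (simp add: Psim_add Psip_add Wf_add)
  moreover have "keys (F i + F' i) \<subseteq> P \<times> rho_exponents" if "i < n" for i
    by (intro keys_add_subset families_keys[OF assms(1) that] families_keys[OF assms(2) that])
  moreover have "keys ((Psim (nxt i) (F (nxt i)) - Wf i (full_chain i) (Psip i (F i))) +
      (Psim (nxt i) (F' (nxt i)) - Wf i (full_chain i) (Psip i (F' i)))) \<subseteq> I \<times> UNIV" if "i < n" for i
    by (intro keys_add_subset families_glue[OF assms(1) that] families_glue[OF assms(2) that])
  ultimately show ?thesis by (simp add: families_def)
qed

lemma families_zero: "(\<lambda>_. 0) \<in> families"
proof -
  have "Psim j 0 = 0" "Psip j 0 = 0" "Wf j ms 0 = 0" for j ms
    using Psim_diff[of j 0 0] Psip_diff[of j 0 0] Wf_diff[of j ms 0 0] by simp_all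
  then show ?thesis by (simp add: families_def)
qed

lemma families_uminus:
  assumes "F \<in> families"
  shows "(\<lambda>i. - F i) \<in> families"
proof -
  have "Psim (nxt i) (- F (nxt i)) - Wf i (full_chain i) (Psip i (- F i)) =
      - (Psim (nxt i) (F (nxt i)) - Wf i (full_chain i) (Psip i (F i)))" for i
  proof -
    have "Psim j 0 = 0" "Psip j 0 = 0" "Wf j ms 0 = 0" for j ms
      using Psim_diff[of j 0 0] Psip_diff[of j 0 0] Wf_diff[of j ms 0 0] by simp_all
    then show ?thesis
      using Psim_diff[of "nxt i" 0 "F (nxt i)"] Psip_diff[of i 0 "F i"]
        Wf_diff[of i "full_chain i" 0 "Psip i (F i)"] by simp
  qed
  then show ?thesis
    using families_keys[OF assms] families_glue[OF assms] by (simp only: families_def mem_Collect_eq keys_uminus) simp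
qed

lemma families_sum: "(\<And>x. x \<in> X \<Longrightarrow> F x \<in> families) \<Longrightarrow> (\<lambda>i. \<Sum>x\<in>X. F x i) \<in> families"
  by (induction X rule: infinite_finite_induct) (auto simp: families_zero families_add)

lemma families_mult:
  assumes "F \<in> families" "F' \<in> families"
  shows "(\<lambda>i. F i * F' i) \<in> families"
proof -
  have "keys (F i * F' i) \<subseteq> P \<times> rho_exponents" if "i < n" for i
    using prho.S_mult[of "F i" "F' i"] assms that by (simp add: families_keys)
  moreover have "keys (Psim (nxt i) (F (nxt i) * F' (nxt i)) - Wf i (full_chain i) (Psip i (F i * F' i))) \<subseteq> I \<times> UNIV"
    if i: "i < n" for i
  proof -
    let ?W = "\<lambda>F. Wf i (full_chain i) (Psip i (F i))" and ?M = "\<lambda>F. Psim (nxt i) (F (nxt i))"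
    have kp: "keys (Psip i (F i)) \<subseteq> P \<times> UNIV" "keys (Psip i (F' i)) \<subseteq> P \<times> UNIV"
      by (rule keys_Psip[OF i P_ideal families_keys[OF assms(1) i]], rule keys_Psip[OF i P_ideal families_keys[OF assms(2) i]])
    have "?M F * ?M F' - ?W F * ?W F' \<in> {f. keys f \<subseteq> I \<times> UNIV}"
    proof (rule sig.A_diff_mult)
      show "?M F \<in> {f. keys f \<subseteq> P \<times> UNIV}"
        using keys_Psim[OF nxt_less P_ideal families_keys[OF assms(1) nxt_less]] by simp
      show "?W F' \<in> {f. keys f \<subseteq> P \<times> UNIV}"
        using keys_Wf[OF set_full_chain i P_ideal kp(2)] by simp
    qed (use families_glue[OF assms(1) i] families_glue[OF assms(2) i] in simp_all)
    moreover have "?W F * ?W F' - Wf i (full_chain i) (Psip i (F i) * Psip i (F' i)) \<in> {f. keys f \<subseteq> I \<times> UNIV}"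
      by (rule sig.A_diff_swap) (use Wf_mult[OF set_full_chain i kp] in simp)
    ultimately have "?M F * ?M F' - Wf i (full_chain i) (Psip i (F i) * Psip i (F' i)) \<in> {f. keys f \<subseteq> I \<times> UNIV}"
      by (rule sig.A_diff_trans)
    then show ?thesis
      using families_keys[OF assms(1)] families_keys[OF assms(2)] i nxt_less by (simp add: Psim_mult Psip_mult)
  qed
  ultimately show ?thesis by (simp add: families_def)
qed

definition const_rho :: "('p \<Rightarrow>\<^sub>0 'k) \<Rightarrow> ('p \<times> int \<times> int \<times> int) \<Rightarrow>\<^sub>0 'k" where
  "const_rho a = push (\<lambda>p. (p, 0, 0, 0)) a"

definition const_sigma :: "('p \<Rightarrow>\<^sub>0 'k) \<Rightarrow> ('p \<times> int \<times> int) \<Rightarrow>\<^sub>0 'k" where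
  "const_sigma a = push (\<lambda>p. (p, 0, 0)) a"

lemma keys_const_rho: "keys a \<subseteq> K \<Longrightarrow> keys (const_rho a) \<subseteq> K \<times> rho_exponents"
  unfolding const_rho_def by (rule keys_push_subset) (auto simp: rho_exponents_def)

lemma keys_const_sigma: "keys a \<subseteq> K \<Longrightarrow> keys (const_sigma a) \<subseteq> K \<times> UNIV"
  unfolding const_sigma_def by (rule keys_push_subset) auto

lemma families_const: "keys a \<subseteq> P \<Longrightarrow> (\<lambda>_. const_rho a) \<in> families"
  using keys_const_rho[of a P] by (simp add: families_def const_rho_def Psim_const Psip_const Wf_const)

text \<open>Gluing is the first consistency condition for a path through the cone from one boundary
  ray to the other.\<close>

lemma families_Th:
  assumes "q \<in> trop_int n"
  shows "Th q \<in> families"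
proof (cases "q = (\<lambda>_. 0)")
  case True
  then show ?thesis
    using families_const[of 1] P_zero by (simp add: const_rho_def push_const_one Th_def fun_eq_iff[symmetric] del: single_one)
      (simp add: Th_def[abs_def])
next
  case False
  have "keys (Psim (nxt i) (Th q (nxt i)) - Wf i (full_chain i) (Psip i (Th q i))) \<subseteq> I \<times> UNIV" if i: "i < n" for i
  proof -
    obtain Q where Q: "next_to_ray G I i i Q" using next_to_ray_lower_exists[OF i] by blast
    obtain Q'' where Q'': "next_to_ray G I (nxt i) i Q''" using next_to_ray_upper_exists[OF i] by blast
    \<comment> \<open>\<open>path_aut\<close> agrees with \<open>cone_aut\<close> only towards
      larger slopes. Without walls a single point is next to both rays.\<close>
    have "\<exists>Q'. next_to_ray G I (nxt i) i Q' \<and> slope n i Q \<le> slope n i Q'"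
    proof (cases "walls_in G I i = {}")
      case True
      then have "next_to_ray G I (nxt i) i Q"
        using next_to_rayD[OF Q] by (intro next_to_ray_upper i) auto
      then show ?thesis by blast
    next
      case False
      then obtain m where "m \<in> walls_in G I i" by blast
      then have "slope n i Q < slope n i Q''"
        using next_to_ray_lowerD[OF i Q] next_to_ray_upperD[OF i Q''] less_trans by blast
      then show ?thesis using Q'' less_imp_le by blast
    qed
    then obtain Q' where Q': "next_to_ray G I (nxt i) i Q'" "slope n i Q \<le> slope n i Q'" by blast
    have kp: "keys (Psip i (Th q i)) \<subseteq> P \<times> UNIV"
      by (rule keys_Psip[OF i P_ideal keys_Th[OF assms i]])
    have "sig.cls (Psim (nxt i) (Th q (nxt i))) = sig.cls (Lsum Q' q)"
      using Th_rep[OF assms False nxt_less] Q'(1) by (simp add: theta_rep_at_def prv_nxt[OF i])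
    also have "\<dots> = cone_aut G I i (sig.cls (Lsum Q q))"
      using consistent_path[OF assms False i, of Q Q'] next_to_rayD[OF Q] next_to_rayD[OF Q'(1)]
      by (simp add: path_aut_across[OF i Q Q'])
    also have "sig.cls (Lsum Q q) = sig.cls (Psip i (Th q i))"
      using Th_rep[OF assms False i] Q by (simp add: theta_rep_at_def)
    also have "cone_aut G I i \<dots> = sig.cls (Wf i (full_chain i) (Psip i (Th q i)))"
      unfolding cone_aut_def full_chain_def[symmetric]
      by (rule fold_wall_crossing[OF set_full_chain i kp])
    finally show ?thesis by (simp add: sig.cls_eq_iff)
  qed
  then show ?thesis using keys_Th[OF assms] by (simp add: families_def)
qed

lemma ev_diff: "ev i z (\<lambda>i. F i - F' i) = ev i z F - ev i z F'"
  and ev_sum: "ev i z (\<lambda>i. \<Sum>x\<in>X. H x i) = (\<Sum>x\<in>X. ev i z (H x))"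
  and ev_const: "ev i z (\<lambda>_. const_rho a) = const_sigma a"
  by (simp_all add: ev_def Psip_diff Psip_sum Wf_diff Wf_sum const_rho_def const_sigma_def
      Psip_const Wf_const)

lemma ev_mult:
  assumes "i < n" "keys (F i) \<subseteq> P \<times> rho_exponents" "keys (F' i) \<subseteq> P \<times> rho_exponents"
  shows "keys (ev i z (\<lambda>i. F i * F' i) - ev i z F * ev i z F') \<subseteq> I \<times> UNIV"
  unfolding ev_def Psip_mult[OF assms(2,3)]
  by (rule Wf_mult[OF set_chain assms(1)]) (rule keys_Psip[OF assms(1) P_ideal], rule assms)+

lemma ev_cong:
  assumes "i < n" "F i - F' i \<in> ideal_rho G I i"
  shows "keys (ev i z F - ev i z F') \<subseteq> I \<times> UNIV"
  unfolding ev_def using Psip_ideal[OF assms] by (intro Wf_cong set_chain assms(1)) (simp add: Psip_diff)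


subsection \<open>Vanishing of functions without theta coefficients\<close>

text \<open>A point on a ray of the fan lies in two cones; \<open>0 < q i\<close> selects the one
  whose first ray carries it. The origin is assigned to the cone \<open>0\<close>.\<close>

definition home :: "(nat \<Rightarrow> int) \<Rightarrow> nat" where
  "home q = (if q = (\<lambda>_. 0) then 0 else (SOME i. i < n \<and> re q \<in> max_cone n i \<and> 0 < q i))"

lemma home_exists:
  assumes "q \<in> trop_int n" "q \<noteq> (\<lambda>_. 0)"
  shows "\<exists>i. i < n \<and> re q \<in> max_cone n i \<and> 0 < q i"
proof -
  obtain j where j: "j < n" "re q \<in> max_cone n j" using assms(1) by (auto simp: trop_int_def trop_iff)
  then have q: "0 \<le> q l" "l \<noteq> j \<Longrightarrow> l \<noteq> nxt j \<Longrightarrow> q l = 0" for l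
    by (auto simp: max_cone_iff re_def)
  show ?thesis
  proof (cases "0 < q j")
    case True
    then show ?thesis using j by blast
  next
    case False
    then have qj: "q j = 0" using q(1)[of j] by simp
    have "0 < q (nxt j)"
    proof (rule ccontr)
      assume "\<not> 0 < q (nxt j)"
      then have "q (nxt j) = 0" using q(1)[of "nxt j"] by simp
      then have "q l = 0" for l using qj q(2)[of l] by (cases "l = j"; cases "l = nxt j") auto
      then show False using assms(2) by auto
    qed
    moreover have "re q \<in> max_cone n (nxt j)"
    proof -
      have "q l = 0" if "l \<noteq> nxt j" for l using q(2)[of l] qj that by (cases "l = j") auto
      then show ?thesis using q(1) by (auto simp: max_cone_iff re_def)
    qed
    ultimately show ?thesis using nxt_less by blast
  qed
qed

lemma home_props:
  assumes "q \<in> trop_int n"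
  shows "home q < n" "re q \<in> max_cone n (home q)" "q \<noteq> (\<lambda>_. 0) \<Longrightarrow> 0 < q (home q)"
proof -
  have "home q < n \<and> re q \<in> max_cone n (home q) \<and> (q \<noteq> (\<lambda>_. 0) \<longrightarrow> 0 < q (home q))"
  proof (cases "q = (\<lambda>_. 0)")
    case True
    then show ?thesis using three by (simp add: home_def re_def max_cone_iff)
  next
    case False
    then show ?thesis using someI_ex[OF home_exists[OF assms False]] by (simp add: home_def)
  qed
  then show "home q < n" "re q \<in> max_cone n (home q)" "q \<noteq> (\<lambda>_. 0) \<Longrightarrow> 0 < q (home q)" by auto
qed

lemma home_eq:
  assumes "q \<in> trop_int n" "i < n" "re q \<in> max_cone n i" "0 < q i"
  shows "home q = i"
proof (rule ccontr)
  let ?j = "home q"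
  assume ne: "?j \<noteq> i"
  have "q \<noteq> (\<lambda>_. 0)" using assms(4) by auto
  note j = home_props(1,2)[OF assms(1)] home_props(3)[OF assms(1) this]
  have "?j = nxt i" using assms(3) j(3) ne by (force simp: max_cone_iff re_def)
  moreover have "i = nxt ?j" using assms(4) j(2) ne by (force simp: max_cone_iff re_def)
  ultimately show False using nxt_nxt_neq[OF assms(2)] by simp
qed

definition witness :: "(nat \<Rightarrow> int) \<Rightarrow> nat \<Rightarrow> real" where
  "witness q = (SOME z. near q (home q) z)"

lemma near_witness:
  assumes "q \<in> trop_int n"
  shows "near q (home q) (witness q)"
proof -
  obtain \<epsilon> where \<epsilon>: "\<epsilon> > 0" "\<forall>i<n. \<forall>z\<in>max_cone n i.
    z \<in> irrational_points n \<and> (\<forall>j. \<bar>z j - real_of_int (q j)\<bar> < \<epsilon>) \<longrightarrow> near q i z"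
    using near_exists[OF assms] by blast
  obtain z where "z \<in> irrational_points n" "z \<in> max_cone n (home q)" "\<forall>j. \<bar>z j - real_of_int (q j)\<bar> < \<epsilon>"
    using irrational_point_near[OF home_props(1)[OF assms] assms home_props(2)[OF assms] \<epsilon>(1)] by blast
  then have "near q (home q) z" using \<epsilon>(2) home_props(1)[OF assms] by blast
  then show ?thesis unfolding witness_def by (rule someI[where P = "near q (home q)"])
qed

text \<open>One test per integral point is enough because neighbouring cones agree modulo the next
  layer: exponents on the second ray of a cone move to the next cone, and the constant coefficient
  travels around the cycle from the cone \<open>0\<close>.\<close>

lemma vanishing:
  assumes H: "H \<in> families"
    and coeff: "\<And>q p. q \<in> trop_int n \<Longrightarrow> p \<notin> I \<Longrightarrow>
      lookup (ev (home q) (witness q) H) (p, coords n (home q) q) = 0"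
    and i: "i < n"
  shows "H i \<in> ideal_rho G I i"
proof -
  define N where "N i = nf i (H i)" for i
  have normal: "normal (N i)" if "i < n" for i
    unfolding N_def by (rule normal_nf[OF that families_keys[OF H that]])
  have HN: "H i - N i \<in> ideal_rho G I i" if "i < n" for i
    unfolding N_def by (rule nf_cong[OF that families_keys[OF H that]])
  define Mp where "Mp i = Psip i (N i)" for i
  define Mm where "Mm i = Psim i (N i)" for i
  have glue: "keys (Mm (nxt i) - Wf i (full_chain i) (Mp i)) \<subseteq> I \<times> UNIV" if i: "i < n" for i
  proof -
    have "keys (Psim (nxt i) (H (nxt i) - N (nxt i))) \<subseteq> I \<times> UNIV"
      by (rule Psim_ideal[OF nxt_less HN[OF nxt_less]])
    then have "Psim (nxt i) (H (nxt i)) - Mm (nxt i) \<in> {f. keys f \<subseteq> I \<times> UNIV}"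
      by (simp add: Mm_def Psim_diff)
    then have 1: "Mm (nxt i) - Psim (nxt i) (H (nxt i)) \<in> {f. keys f \<subseteq> I \<times> UNIV}"
      by (rule sig.A_diff_swap)
    have 2: "Psim (nxt i) (H (nxt i)) - Wf i (full_chain i) (Psip i (H i)) \<in> {f. keys f \<subseteq> I \<times> UNIV}"
      using families_glue[OF H i] by simp
    have "keys (Psip i (H i) - Mp i) \<subseteq> I \<times> UNIV"
      using Psip_ideal[OF i HN[OF i]] by (simp add: Mp_def Psip_diff)
    then have 3: "Wf i (full_chain i) (Psip i (H i)) - Wf i (full_chain i) (Mp i) \<in> {f. keys f \<subseteq> I \<times> UNIV}"
      using Wf_cong[OF set_full_chain i] by simp
    show ?thesis using sig.A_diff_trans[OF sig.A_diff_trans[OF 1 2] 3] by simp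
  qed
  \<comment> \<open>\<open>I\<close> is added to each power of \<open>J\<close>, because the gluing
    and the vanishing of the coefficients hold only modulo \<open>I\<close>.\<close>
  have layer: "\<forall>i<n. keys (N i) \<subseteq> (Jpow k \<union> I) \<times> UNIV" for k
  proof (induction k)
    case 0
    show ?case using normal by (auto simp: normal_def)
  next
    case (Suc k)
    let ?K = "Jpow k \<union> I" and ?K' = "Jpow (Suc k) \<union> I"
    have K: "monoid_ideal P ?K" "monoid_ideal P ?K'"
      by (intro Un_ideal Jpow_ideal I_ideal)+
    interpret K': monoid_pair "P \<times> (UNIV :: (int \<times> int) set)" "?K' \<times> UNIV" "TYPE('k)"
      by (rule monoid_pair_UNIV[OF K(2)])
    have KJ: "a + j \<in> ?K'" if "a \<in> ?K" "j \<in> J" for a j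
    proof (cases "a \<in> I")
      case True
      then show ?thesis using ideal_add'[OF I_ideal] that(2) J_subset by blast
    next
      case False
      then have "j + a \<in> Jpow (Suc k)" using that by auto
      then show ?thesis by (simp add: add.commute)
    qed
    have NK: "keys (N i) \<subseteq> ?K \<times> rho_exponents" if "i < n" for i
      using Suc that normal_keys[OF normal[OF that]] by fastforce
    have MpK: "keys (Mp i) \<subseteq> ?K \<times> UNIV" if "i < n" for i
      unfolding Mp_def by (rule keys_Psip[OF that K(1) NK[OF that]])
    have W: "keys (Wf i ms (Mp i) - Mp i) \<subseteq> ?K' \<times> UNIV" if "i < n" "set ms \<subseteq> walls_in G I i" for i ms
      by (rule Wf_layer[OF that(2,1) K MpK[OF that(1)] KJ])
    \<comment> \<open>Modulo the next layer the crossings disappear, so the restrictions to the cone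
      \<open>i\<close> from its two boundary rays have the same coefficients.\<close>
    have e1: "lookup (Mp i) (p, a, b) = lookup (Mm (nxt i)) (p, a, b)" if "i < n" "p \<notin> ?K'" for i p a b
    proof -
      have "Mm (nxt i) - Wf i (full_chain i) (Mp i) \<in> {f. keys f \<subseteq> ?K' \<times> UNIV}"
        using glue[OF that(1)] by auto
      moreover have "Wf i (full_chain i) (Mp i) - Mp i \<in> {f. keys f \<subseteq> ?K' \<times> UNIV}"
        using W[OF that(1) set_full_chain] by simp
      ultimately have "Mm (nxt i) - Mp i \<in> {f. keys f \<subseteq> ?K' \<times> UNIV}"
        by (rule K'.A_diff_trans)
      then show ?thesis
        using lookup_eq_if_keys_diff[of "Mm (nxt i)" "Mp i" "?K' \<times> UNIV" "(p, a, b)"] that(2) by simp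
    qed
    have NU: "keys (N i) \<subseteq> ?K \<times> UNIV" if "i < n" for i using Suc that by blast
    have neg_m: "lookup (Mm i) (p, a, b) = 0" if "i < n" "p \<notin> ?K'" "a < 0" for i p a b
      unfolding Mm_def by (rule Psim_negative[OF that(1) normal[OF that(1)] NU[OF that(1)] KJ that(2,3)])
    have neg_p: "lookup (Mp i) (p, a, b) = 0" if "i < n" "p \<notin> ?K'" "b < 0" for i p a b
      unfolding Mp_def by (rule Psip_negative[OF that(1) normal[OF that(1)] NU[OF that(1)] KJ that(2,3)])
    have val_m: "lookup (Mm i) (p, a, b) = lookup (N i) (p, a, b, 0)" if "i < n" "0 \<le> a" for i p a b
      unfolding Mm_def by (rule lookup_Psim_normal[OF that(1) normal[OF that(1)] that(2)])
    have val_p: "lookup (Mp i) (p, a, b) = lookup (N i) (p, 0, a, b)" if "i < n" "0 \<le> b" for i p a b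
      unfolding Mp_def by (rule lookup_Psip_normal[OF that(1) normal[OF that(1)] that(2)])
    have at_home: "lookup (Mp (home q)) (p, coords n (home q) q) = 0" if q: "q \<in> trop_int n" and p: "p \<notin> ?K'" for q p
    proof -
      let ?i = "home q" and ?z = "witness q"
      have hi: "?i < n" by (rule home_props(1)[OF q])
      have "keys (ev ?i ?z H - ev ?i ?z N) \<subseteq> I \<times> UNIV"
        by (rule ev_cong[where F = H and F' = N, OF hi HN[OF hi]])
      then have "lookup (ev ?i ?z N) (p, coords n ?i q) = 0"
        using lookup_eq_if_keys_diff[of "ev ?i ?z H" "ev ?i ?z N" "I \<times> UNIV" "(p, coords n ?i q)"]
          coeff[OF q, of p] p by simp
      moreover have "keys (ev ?i ?z N - Mp ?i) \<subseteq> ?K' \<times> UNIV"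
        unfolding ev_def Mp_def[symmetric] by (rule W[OF hi set_chain])
      ultimately show ?thesis
        using lookup_eq_if_keys_diff[of "ev ?i ?z N" "Mp ?i" "?K' \<times> UNIV" "(p, coords n ?i q)"] p by simp
    qed
    have pos: "lookup (Mp i) (p, a, b) = 0" if i: "i < n" and p: "p \<notin> ?K'" and ab: "0 < a" "0 \<le> b" for i p a b
    proof -
      define q where "q j = (if j = i then a else if j = nxt i then b else 0)" for j
      have qi: "q i = a" "q (nxt i) = b" using nxt_neq[OF i] by (auto simp: q_def)
      have qc: "re q \<in> max_cone n i" using ab by (auto simp: max_cone_iff re_def q_def)
      then have q: "q \<in> trop_int n" using i by (auto simp: trop_int_def trop_iff)
      have "home q = i" by (rule home_eq[OF q i qc]) (simp add: qi ab)
      then show ?thesis using at_home[OF q p] by (simp add: coords_eq qi)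
    qed
    \<comment> \<open>A multiple of the second generator of the cone \<open>i\<close> is read on
      both sides of the ray \<open>nxt i\<close> and becomes a multiple of the first generator of
      the next cone.\<close>
    have pos': "lookup (Mp i) (p, 0, b) = 0" if i: "i < n" and p: "p \<notin> ?K'" and b: "0 < b" for i p b
      using e1[OF i p, of 0 b] val_m[OF nxt_less, of 0 i p b] val_p[OF nxt_less, of 0 i p b]
        pos[OF nxt_less p b, of 0 i] by simp
    have shift: "lookup (Mp i) (p, 0, 0) = lookup (Mp (nxt i)) (p, 0, 0)" if i: "i < n" and p: "p \<notin> ?K'" for i p
      using e1[OF i p, of 0 0] val_m[OF nxt_less, of 0 i p 0] val_p[OF nxt_less, of 0 i p 0] by simp
    have zero: "lookup (Mp i) (p, 0, 0) = 0" if i: "i < n" and p: "p \<notin> ?K'" for i p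
      using i
    proof (induction i)
      case 0
      have "(\<lambda>_. 0) \<in> trop_int n"
        using three by (auto simp: trop_int_def trop_iff max_cone_iff re_def intro!: exI[of _ 0])
      from at_home[OF this p] show ?case by (simp add: home_def coords_eq)
    next
      case (Suc i)
      then have "nxt i = Suc i" by (simp add: nxt_cases)
      then show ?case using shift[of i p] Suc p by simp
    qed
    \<comment> \<open>A negative second exponent is excluded at the ray \<open>i\<close>, a negative
      first one at the ray \<open>nxt i\<close>.\<close>
    have all_p: "lookup (Mp i) (p, a, b) = 0" if i: "i < n" and p: "p \<notin> ?K'" for i p a b
    proof -
      consider "b < 0" | "a < 0" | "0 < a" "0 \<le> b" | "a = 0" "0 < b" | "a = 0" "b = 0" by linarith
      then show ?thesis
      proof cases
        case 2
        then show ?thesis using e1[OF i p, of a b] neg_m[OF nxt_less p, of a i b] by simp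
      qed (use neg_p[OF i p] pos[OF i p] pos'[OF i p] zero[OF i p] in simp_all)
    qed
    have all_m: "lookup (Mm i) (p, a, b) = 0" if i: "i < n" and p: "p \<notin> ?K'" for i p a b
      using e1[OF prv_less p, of i a b] all_p[OF prv_less p, of i a b] nxt_prv[OF i] by simp
    show ?case
    proof (intro allI impI subsetI)
      fix i x assume i: "i < n" and x: "x \<in> keys (N i)"
      obtain p a b c where pabc: "x = (p, a, b, c)" by (cases x)
      have ac: "0 \<le> a" "0 \<le> c" "a = 0 \<or> c = 0" using x normal[OF i] by (auto simp: normal_def pabc)
      have "p \<in> ?K'"
      proof (rule ccontr)
        assume p: "p \<notin> ?K'"
        have "lookup (N i) x = 0"
          using ac(3) val_m[OF i ac(1), of p b] val_p[OF i ac(2), of p b] all_m[OF i p] all_p[OF i p]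
          by (auto simp: pabc)
        then show False using x by (simp add: in_keys_iff)
      qed
      then show "x \<in> ?K' \<times> UNIV" by (simp add: pabc)
    qed
  qed
  interpret R: pm_quotient "{f :: ('p \<times> int \<times> int \<times> int) \<Rightarrow>\<^sub>0 'k. keys f \<subseteq> P \<times> rho_exponents}" "ideal_rho G I i"
    by (rule pm_quotient_rho[OF i])
  have "keys (N i) \<subseteq> I \<times> rho_exponents"
    using layer[of nil] Jpow_nil i normal_keys[OF normal[OF i]] by fastforce
  then have "N i \<in> ideal_rho G I i" by (rule ideal_rho_generators(1)[OF i])
  then show ?thesis using R.A_add[OF HN[OF i], of "N i"] by simp
qed

subsection \<open>Glued functions\<close>

definition glued :: "(nat \<Rightarrow> ('p \<times> int \<times> int \<times> int) \<Rightarrow>\<^sub>0 'k) \<Rightarrow> nat \<Rightarrow> (('p \<times> int \<times> int \<times> int) \<Rightarrow>\<^sub>0 'k) set" where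
  "glued F = (\<lambda>i\<in>{..<n}. rcls i (F i))"

lemma glued_eq_iff: "glued F = glued F' \<longleftrightarrow> (\<forall>i<n. F i - F' i \<in> ideal_rho G I i)"
proof -
  have "rcls i (F i) = rcls i (F' i) \<longleftrightarrow> F i - F' i \<in> ideal_rho G I i" if "i < n" for i
    using quotient_on.cls_eq_iff[OF pm_quotient.axioms(1)[OF pm_quotient_rho[OF that]]]
    by (simp add: rcls_eq[OF that])
  moreover have "glued F = glued F' \<longleftrightarrow> (\<forall>i<n. rcls i (F i) = rcls i (F' i))"
    by (auto simp: glued_def fun_eq_iff restrict_def)
  ultimately show ?thesis by auto
qed

text \<open>The gluing condition of \<open>ring_AI\<close> compares classes; through the polynomial
  models of the maps it becomes the congruence in \<open>families\<close>.\<close>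

lemma carrier_AI: "carrier (ring_AI G I) = glued ` families"
proof (intro equalityI subsetI)
  fix g assume "g \<in> carrier (ring_AI G I)"
  then have g: "g \<in> (\<Pi>\<^sub>E i\<in>{..<n}. carrier (ring_rho G I i))"
    "\<And>i. i < n \<Longrightarrow> psi_minus G I (nxt i) (g (nxt i)) = cone_aut G I i (psi_plus G I i (g i))"
    by (auto simp: ring_AI_def Let_def nxt_def)
  have "\<exists>f. keys f \<subseteq> P \<times> rho_exponents \<and> g i = rcls i f" if "i < n" for i
  proof -
    have "g i \<in> carrier (ring_rho G I i)" using g(1) that by auto
    then show ?thesis
      using quotient_on.carrier_Q[OF pm_quotient.axioms(1)[OF pm_quotient_rho[OF that]]]
      by (auto simp: ring_rho_eq rcls_eq[OF that])
  qed
  then obtain F where F: "\<And>i. i < n \<Longrightarrow> keys (F i) \<subseteq> P \<times> rho_exponents \<and> g i = rcls i (F i)" by metis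
  have "keys (Psim (nxt i) (F (nxt i)) - Wf i (full_chain i) (Psip i (F i))) \<subseteq> I \<times> UNIV" if i: "i < n" for i
  proof -
    have "sig.cls (Psim (nxt i) (F (nxt i))) = cone_aut G I i (sig.cls (Psip i (F i)))"
      using g(2)[OF i] F[OF i] F[OF nxt_less] by (simp add: psi_minus_rcls[OF nxt_less] psi_plus_rcls[OF i])
    also have "\<dots> = sig.cls (Wf i (full_chain i) (Psip i (F i)))"
      unfolding cone_aut_def full_chain_def[symmetric]
      by (rule fold_wall_crossing[OF set_full_chain i keys_Psip[OF i P_ideal]]) (use F[OF i] in blast)
    finally show ?thesis by (simp add: sig.cls_eq_iff)
  qed
  then have "F \<in> families" using F by (simp add: families_def)
  moreover have "g = glued F"
    using g(1) F by (auto simp: glued_def fun_eq_iff PiE_def extensional_def)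
  ultimately show "g \<in> glued ` families" by blast
next
  fix g assume "g \<in> glued ` families"
  then obtain F where F: "F \<in> families" "g = glued F" by blast
  have "rcls i (F i) \<in> carrier (ring_rho G I i)" if "i < n" for i
    using quotient_on.cls_in_carrier[OF pm_quotient.axioms(1)[OF pm_quotient_rho[OF that]]] families_keys[OF F(1) that]
    by (simp add: ring_rho_eq rcls_eq[OF that])
  moreover have "psi_minus G I (nxt i) (rcls (nxt i) (F (nxt i))) = cone_aut G I i (psi_plus G I i (rcls i (F i)))"
    if i: "i < n" for i
  proof -
    have "sig.cls (Psim (nxt i) (F (nxt i))) = sig.cls (Wf i (full_chain i) (Psip i (F i)))"
      using families_glue[OF F(1) i] by (simp add: sig.cls_eq_iff)
    also have "\<dots> = cone_aut G I i (sig.cls (Psip i (F i)))"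
      unfolding cone_aut_def full_chain_def[symmetric]
      by (rule fold_wall_crossing[OF set_full_chain i keys_Psip[OF i P_ideal families_keys[OF F(1) i]], symmetric])
    finally show ?thesis
      by (simp add: psi_minus_rcls[OF nxt_less families_keys[OF F(1) nxt_less]] psi_plus_rcls[OF i families_keys[OF F(1) i]])
  qed
  ultimately show "g \<in> carrier (ring_AI G I)"
    using nxt_less by (auto simp: F(2) ring_AI_def Let_def glued_def nxt_def[symmetric])
qed

lemma glued_add: "F \<in> families \<Longrightarrow> F' \<in> families \<Longrightarrow> glued F \<oplus>\<^bsub>ring_AI G I\<^esub> glued F' = glued (\<lambda>i. F i + F' i)"
proof -
  assume F: "F \<in> families" "F' \<in> families"
  have "rcls i (F i) \<oplus>\<^bsub>ring_rho G I i\<^esub> rcls i (F' i) = rcls i (F i + F' i)" if "i < n" for i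
    using quotient_on.cls_add[OF pm_quotient.axioms(1)[OF pm_quotient_rho[OF that]]]
      families_keys[OF F(1) that] families_keys[OF F(2) that]
    by (simp add: ring_rho_eq rcls_eq[OF that])
  then show ?thesis by (auto simp: ring_AI_def Let_def glued_def restrict_def fun_eq_iff)
qed

lemma glued_mult: "F \<in> families \<Longrightarrow> F' \<in> families \<Longrightarrow> glued F \<otimes>\<^bsub>ring_AI G I\<^esub> glued F' = glued (\<lambda>i. F i * F' i)"
proof -
  assume F: "F \<in> families" "F' \<in> families"
  have "rcls i (F i) \<otimes>\<^bsub>ring_rho G I i\<^esub> rcls i (F' i) = rcls i (F i * F' i)" if "i < n" for i
    using quotient_on.cls_mult[OF pm_quotient.axioms(1)[OF pm_quotient_rho[OF that]]]
      families_keys[OF F(1) that] families_keys[OF F(2) that]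
    by (simp add: ring_rho_eq rcls_eq[OF that])
  then show ?thesis by (auto simp: ring_AI_def Let_def glued_def restrict_def fun_eq_iff)
qed

lemma glued_zero: "\<zero>\<^bsub>ring_AI G I\<^esub> = glued (\<lambda>_. 0)"
proof -
  have "\<zero>\<^bsub>ring_rho G I i\<^esub> = rcls i 0" if "i < n" for i
    using quotient_on.zero_Q[OF pm_quotient.axioms(1)[OF pm_quotient_rho[OF that]]]
    by (simp add: ring_rho_eq rcls_eq[OF that])
  then show ?thesis by (auto simp: ring_AI_def Let_def glued_def restrict_def fun_eq_iff)
qed

lemma glued_one: "\<one>\<^bsub>ring_AI G I\<^esub> = glued (\<lambda>_. 1)"
proof -
  have "\<one>\<^bsub>ring_rho G I i\<^esub> = rcls i 1" if "i < n" for i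
    using quotient_on.one_Q[OF pm_quotient.axioms(1)[OF pm_quotient_rho[OF that]]]
    by (simp add: ring_rho_eq rcls_eq[OF that])
  then show ?thesis by (auto simp: ring_AI_def Let_def glued_def restrict_def fun_eq_iff)
qed

lemma const_rho_diff: "const_rho (a - b) = const_rho a - const_rho b"
  by (simp add: const_rho_def push_diff)

lemma families_scaled: "keys a \<subseteq> P \<Longrightarrow> F \<in> families \<Longrightarrow> (\<lambda>i. const_rho a * F i) \<in> families"
  using families_mult[OF families_const] by simp

text \<open>The scalar action picks a representative of the class; another pick changes the product
  only within \<open>ideal_rho\<close>.\<close>

lemma glued_smult:
  assumes "keys a \<subseteq> P" "F \<in> families"
  shows "RI.cls a \<odot>\<^bsub>ring_AI G I\<^esub> glued F = glued (\<lambda>i. const_rho a * F i)"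
proof -
  define b where "b = (SOME f. f \<in> RI.cls a)"
  have b: "keys b \<subseteq> P" "keys (b - a) \<subseteq> I"
    using RI.some_rep[of a] assms(1) by (auto simp: b_def)
  have "rcls i (const_rho b) \<otimes>\<^bsub>ring_rho G I i\<^esub> rcls i (F i) = rcls i (const_rho a * F i)" if i: "i < n" for i
  proof -
    interpret R: pm_quotient "{f :: ('p \<times> int \<times> int \<times> int) \<Rightarrow>\<^sub>0 'k. keys f \<subseteq> P \<times> rho_exponents}" "ideal_rho G I i"
      by (rule pm_quotient_rho[OF i])
    have S: "const_rho b \<in> {f. keys f \<subseteq> P \<times> rho_exponents}" "F i \<in> {f. keys f \<subseteq> P \<times> rho_exponents}"
      using keys_const_rho[OF b(1)] families_keys[OF assms(2) i] by simp_all
    have "const_rho b - const_rho a \<in> ideal_rho G I i"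
      using ideal_rho_generators(1)[OF i keys_const_rho[OF b(2)]] by (simp add: const_rho_diff)
    then have "const_rho b * F i - const_rho a * F i \<in> ideal_rho G I i"
      using R.A_mult_right[OF _ S(2)] by (simp only: left_diff_distrib[symmetric])
    then have "R.cls (const_rho b * F i) = R.cls (const_rho a * F i)" by (rule R.cls_eqI)
    then show ?thesis
      using R.cls_mult[OF S] by (simp add: ring_rho_eq rcls_eq[OF i])
  qed
  then show ?thesis
    by (auto simp: ring_AI_def Let_def glued_def restrict_def fun_eq_iff b_def const_rho_def)
qed

lemma theta_eq:
  assumes "q \<in> trop_int n"
  shows "theta G I q = glued (Th q)"
proof (cases "q = (\<lambda>_. 0)")
  case True
  then show ?thesis by (simp add: theta_def glued_one glued_def Th_def)
next
  case False
  then show ?thesis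
    using Th_rep[OF assms False] by (auto simp: theta_def glued_def theta_rep_at_def restrict_def fun_eq_iff)
qed

lemma abelian_monoid_AI: "abelian_monoid (ring_AI G I)"
proof (rule abelian_monoidI)
  fix x y z assume "x \<in> carrier (ring_AI G I)" "y \<in> carrier (ring_AI G I)" "z \<in> carrier (ring_AI G I)"
  then obtain F F' F'' where F: "F \<in> families" "F' \<in> families" "F'' \<in> families" "x = glued F" "y = glued F'" "z = glued F''"
    by (auto simp: carrier_AI)
  show "(x \<oplus>\<^bsub>ring_AI G I\<^esub> y) \<oplus>\<^bsub>ring_AI G I\<^esub> z = x \<oplus>\<^bsub>ring_AI G I\<^esub> (y \<oplus>\<^bsub>ring_AI G I\<^esub> z)"
    using F by (simp add: glued_add families_add add.assoc)
next
  fix x y assume "x \<in> carrier (ring_AI G I)" "y \<in> carrier (ring_AI G I)"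
  then obtain F F' where F: "F \<in> families" "F' \<in> families" "x = glued F" "y = glued F'"
    by (auto simp: carrier_AI)
  show "x \<oplus>\<^bsub>ring_AI G I\<^esub> y \<in> carrier (ring_AI G I)"
    using F by (simp add: glued_add families_add carrier_AI)
  show "x \<oplus>\<^bsub>ring_AI G I\<^esub> y = y \<oplus>\<^bsub>ring_AI G I\<^esub> x"
    using F by (simp add: glued_add add.commute)
next
  fix x assume "x \<in> carrier (ring_AI G I)"
  then obtain F where F: "F \<in> families" "x = glued F" by (auto simp: carrier_AI)
  show "\<zero>\<^bsub>ring_AI G I\<^esub> \<oplus>\<^bsub>ring_AI G I\<^esub> x = x"
    using F by (simp add: glued_zero glued_add families_zero)
qed (simp add: glued_zero carrier_AI families_zero)

lemma finsum_glued:
  assumes "finite T" "\<And>q. q \<in> T \<Longrightarrow> F q \<in> families"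
  shows "finsum (ring_AI G I) (\<lambda>q. glued (F q)) T = glued (\<lambda>i. \<Sum>q\<in>T. F q i)"
proof -
  interpret A: abelian_monoid "ring_AI G I" by (rule abelian_monoid_AI)
  show ?thesis
    using assms
  proof (induction T rule: finite_induct)
    case empty
    then show ?case by (simp add: glued_zero)
  next
    case (insert q T)
    have "finsum (ring_AI G I) (\<lambda>q. glued (F q)) (insert q T) =
        glued (F q) \<oplus>\<^bsub>ring_AI G I\<^esub> finsum (ring_AI G I) (\<lambda>q. glued (F q)) T"
      by (rule A.finsum_insert) (use insert in \<open>auto simp: carrier_AI\<close>)
    also have "\<dots> = glued (\<lambda>i. F q i + (\<Sum>q\<in>T. F q i))"
      using insert by (simp add: glued_add families_sum)
    finally show ?case using insert by simp
  qed
qed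


section \<open>Expansions in theta functions\<close>

text \<open>The coefficient of X^m, as an element of the monoid algebra of \<open>P\<close>.\<close>

definition slice :: "int \<times> int \<Rightarrow> (('p \<times> int \<times> int) \<Rightarrow>\<^sub>0 'k) \<Rightarrow> 'p \<Rightarrow>\<^sub>0 'k" where
  "slice m f = (\<Sum>x\<in>keys f. if snd x = m then single (fst x) (lookup f x) else 0)"

lemma lookup_slice: "lookup (slice m f) p = lookup f (p, m)"
proof -
  have "lookup (slice m f) p = (\<Sum>x\<in>keys f. if x = (p, m) then lookup f x else 0)"
    unfolding slice_def lookup_sum
    by (rule sum.cong[OF refl]) (auto simp: lookup_single when_def)
  also have "\<dots> = lookup f (p, m)" by (simp add: sum.delta in_keys_iff)
  finally show ?thesis .
qed

lemma slice_diff: "slice m (f - g) = slice m f - slice m g"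
  and slice_sum: "slice m (sum h X) = (\<Sum>x\<in>X. slice m (h x))"
  by (rule poly_mapping_eqI, simp add: lookup_slice lookup_minus lookup_sum)+

lemma slice_single: "slice m (single (p, m') c) = (if m' = m then single p c else 0)"
  by (rule poly_mapping_eqI) (auto simp: lookup_slice lookup_single when_def)

lemma keys_slice: "keys f \<subseteq> K \<times> UNIV \<Longrightarrow> keys (slice m f) \<subseteq> K"
  by (auto simp: in_keys_iff lookup_slice)

lemma slice_const_mult: "slice m (const_sigma a * f) = a * slice m f"
proof -
  have 1: "const_sigma a * single x c = (\<Sum>y\<in>keys a. single (y + fst x, snd x) (lookup a y * c))" for x and c :: 'k
    by (simp add: const_sigma_def push_def sum_distrib_right mult_single plus_prod_def)
  have 2: "a * single p c = (\<Sum>y\<in>keys a. single (y + p) (lookup a y * c))" for p and c :: 'k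
    by (subst sum_single_lookup[of a, symmetric]) (simp add: sum_distrib_right mult_single)
  have 3: "slice m (const_sigma a * single x c) = a * slice m (single x c)" for x and c :: 'k
    by (cases x) (simp add: 1 slice_sum slice_single 2)
  have "slice m (const_sigma a * f) = slice m (const_sigma a * (\<Sum>x\<in>keys f. single x (lookup f x)))"
    by (simp add: sum_single_lookup)
  also have "\<dots> = (\<Sum>x\<in>keys f. a * slice m (single x (lookup f x)))"
    by (simp only: sum_distrib_left slice_sum 3)
  also have "\<dots> = a * slice m (\<Sum>x\<in>keys f. single x (lookup f x))"
    by (simp only: sum_distrib_left slice_sum)
  finally show ?thesis by (simp only: sum_single_lookup)
qed

text \<open>Reading the coefficient of X^q near \<open>q\<close> is linear over R_I and dual to the
  theta functions. As this holds at every near point and for every finite expansion, it yields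
  uniqueness, independence of \<open>z\<close>, and the coefficients of the candidate in
  \<open>theta_spanning\<close>.\<close>

lemma expansion_coefficient:
  assumes F: "F \<in> families" and T: "finite T" "T \<subseteq> trop_int n" and b: "\<And>q. q \<in> T \<Longrightarrow> keys (b q) \<subseteq> P"
    and exp: "\<And>i. i < n \<Longrightarrow> F i - (\<Sum>q\<in>T. const_rho (b q) * Th q i) \<in> ideal_rho G I i"
    and q: "q \<in> trop_int n" and i: "i < n" and z: "near q i z"
  shows "RI.cls (slice (coords n i q) (ev i z F)) = RI.cls (if q \<in> T then b q else 0)"
proof -
  note zc = nearD[OF i z]
  let ?m = "coords n i q"
  have 1: "ev i z F - (\<Sum>q\<in>T. ev i z (\<lambda>i. const_rho (b q) * Th q i)) \<in> {f. keys f \<subseteq> I \<times> UNIV}"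
    using ev_cong[where F = F and F' = "\<lambda>i. \<Sum>q\<in>T. const_rho (b q) * Th q i", OF i exp[OF i], of z]
    by (simp add: ev_sum)
  have 2: "ev i z (\<lambda>i. const_rho (b q') * Th q' i) - const_sigma (b q') * Lsum z q' \<in> {f. keys f \<subseteq> I \<times> UNIV}"
    if q': "q' \<in> T" for q'
  proof -
    have t: "q' \<in> trop_int n" using T(2) q' by blast
    have "ev i z (\<lambda>i. const_rho (b q') * Th q' i) - const_sigma (b q') * ev i z (Th q') \<in> {f. keys f \<subseteq> I \<times> UNIV}"
      using ev_mult[where F = "\<lambda>_. const_rho (b q')" and F' = "Th q'",
          OF i keys_const_rho[OF b[OF q']] keys_Th[OF t i], of z]
      by (simp add: ev_const)
    moreover have "const_sigma (b q') * ev i z (Th q') - const_sigma (b q') * Lsum z q' \<in> {f. keys f \<subseteq> I \<times> UNIV}"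
    proof (rule sig.A_diff_mult)
      show "ev i z (Th q') - Lsum z q' \<in> {f. keys f \<subseteq> I \<times> UNIV}"
        using cls_ev_Th[OF t i zc(1,2)] by (simp only: sig.cls_eq_iff)
    qed (use keys_const_sigma[OF b[OF q']] keys_Lsum in simp_all)
    ultimately show ?thesis by (rule sig.A_diff_trans)
  qed
  have "(\<Sum>q'\<in>T. ev i z (\<lambda>i. const_rho (b q') * Th q' i)) - (\<Sum>q'\<in>T. const_sigma (b q') * Lsum z q')
      \<in> {f. keys f \<subseteq> I \<times> UNIV}"
    unfolding sum_subtractf[symmetric] by (rule sig.A_sum) (rule 2)
  with 1 have "ev i z F - (\<Sum>q'\<in>T. const_sigma (b q') * Lsum z q') \<in> {f. keys f \<subseteq> I \<times> UNIV}"
    by (rule sig.A_diff_trans)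
  then have "keys (slice ?m (ev i z F - (\<Sum>q'\<in>T. const_sigma (b q') * Lsum z q'))) \<subseteq> I"
    by (intro keys_slice) simp
  then have 3: "slice ?m (ev i z F) - (\<Sum>q'\<in>T. b q' * slice ?m (Lsum z q')) \<in> {f. keys f \<subseteq> I}"
    by (simp add: slice_diff slice_sum slice_const_mult)
  have 4: "b q' * slice ?m (Lsum z q') - b q' * (if q' = q then 1 else 0) \<in> {f. keys f \<subseteq> I}" if q': "q' \<in> T" for q'
  proof -
    have "keys (slice ?m (Lsum z q') - (if q' = q then 1 else 0)) \<subseteq> I"
    proof (rule keys_diff_subsetI)
      fix p assume "p \<notin> I"
      then show "lookup (slice ?m (Lsum z q')) p = lookup (if q' = q then 1 else 0) p"
        using lookup_Lsum_near[OF i z _ \<open>p \<notin> I\<close>, of q'] T(2) q'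
        by (auto simp: lookup_slice lookup_one when_def)
    qed
    then have "b q' * (slice ?m (Lsum z q') - (if q' = q then 1 else 0)) \<in> {f. keys f \<subseteq> I}"
      by (intro RI.A_mult) (use b[OF q'] in simp_all)
    then show ?thesis by (simp only: right_diff_distrib)
  qed
  have "(\<Sum>q'\<in>T. b q' * slice ?m (Lsum z q')) - (\<Sum>q'\<in>T. b q' * (if q' = q then 1 else 0)) \<in> {f. keys f \<subseteq> I}"
    unfolding sum_subtractf[symmetric] by (rule RI.A_sum) (rule 4)
  with 3 have "slice ?m (ev i z F) - (\<Sum>q'\<in>T. b q' * (if q' = q then 1 else 0)) \<in> {f. keys f \<subseteq> I}"
    by (rule RI.A_diff_trans)
  moreover have "(\<Sum>q'\<in>T. b q' * (if q' = q then 1 else 0)) = (if q \<in> T then b q else 0)"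
  proof -
    have "(\<Sum>q'\<in>T. b q' * (if q' = q then 1 else 0)) = (\<Sum>q'\<in>T. if q' = q then b q' else 0)"
      by (rule sum.cong) auto
    then show ?thesis using T(1) by (simp add: sum.delta)
  qed
  ultimately show ?thesis by (intro RI.cls_eqI) simp
qed

definition coefficient :: "(nat \<Rightarrow> ('p \<times> int \<times> int \<times> int) \<Rightarrow>\<^sub>0 'k) \<Rightarrow> (nat \<Rightarrow> int) \<Rightarrow> 'p \<Rightarrow>\<^sub>0 'k" where
  "coefficient F q = slice (coords n (home q) q) (ev (home q) (witness q) F)"

definition theta_support :: "(nat \<Rightarrow> ('p \<times> int \<times> int \<times> int) \<Rightarrow>\<^sub>0 'k) \<Rightarrow> (nat \<Rightarrow> int) set" where
  "theta_support F = {q \<in> trop_int n. \<not> keys (coefficient F q) \<subseteq> I}"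

lemma keys_coefficient: "F \<in> families \<Longrightarrow> q \<in> trop_int n \<Longrightarrow> keys (coefficient F q) \<subseteq> P"
  unfolding coefficient_def using home_props(1) by (intro keys_slice keys_ev families_keys)

lemma inj_on_coords: "inj_on (coords n i) {q. re q \<in> max_cone n i}"
proof (rule inj_onI, rule ext)
  fix q q' j assume "q \<in> {q. re q \<in> max_cone n i}" "q' \<in> {q. re q \<in> max_cone n i}" "coords n i q = coords n i q'"
  then show "q j = q' j"
    by (cases "j = i"; cases "j = nxt i") (auto simp: coords_eq max_cone_iff re_def)
qed

text \<open>The witnesses vary over infinitely many points, but the restriction to a chamber depends
  only on the cone and the set of walls below. So finitely many polynomials occur, each with
  finitely many exponents, and in one cone the exponent determines \<open>q\<close>.\<close>

lemma finite_theta_support: "finite (theta_support F)"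
proof -
  let ?E = "\<lambda>i W. Wf i (sort_walls G i W) (Psip i (F i))"
  have "theta_support F \<subseteq> (\<Union>i<n. \<Union>W\<in>Pow (walls_in G I i). {q. re q \<in> max_cone n i \<and> coords n i q \<in> snd ` keys (?E i W)})"
  proof
    fix q assume "q \<in> theta_support F"
    then have q: "q \<in> trop_int n" "keys (coefficient F q) \<noteq> {}" by (auto simp: theta_support_def)
    then obtain p where "p \<in> keys (coefficient F q)" by blast
    then have "(p, coords n (home q) q) \<in> keys (ev (home q) (witness q) F)"
      by (simp add: coefficient_def lookup_slice in_keys_iff)
    then have "coords n (home q) q \<in> snd ` keys (?E (home q) (walls_below (home q) (witness q)))"
      unfolding ev_def chain_def by force
    moreover have "walls_below (home q) (witness q) \<subseteq> walls_in G I (home q)" by (auto simp: walls_below_def)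
    ultimately show "q \<in> (\<Union>i<n. \<Union>W\<in>Pow (walls_in G I i). {q. re q \<in> max_cone n i \<and> coords n i q \<in> snd ` keys (?E i W)})"
      using home_props(1,2)[OF q(1)] by blast
  qed
  moreover have fin: "finite {q. re q \<in> max_cone n i \<and> coords n i q \<in> snd ` keys (?E i W)}" for i W
    by (rule inj_on_finite[OF inj_on_subset[OF inj_on_coords[of i]], where B = "snd ` keys (?E i W)"])
      (blast, blast, simp)
  moreover have "finite (\<Union>i<n. \<Union>W\<in>Pow (walls_in G I i). {q. re q \<in> max_cone n i \<and> coords n i q \<in> snd ` keys (?E i W)})"
    by (intro finite_UN_I finite_lessThan finite_Pow_iff[THEN iffD2] finite_walls_in fin)
  ultimately show ?thesis by (blast intro: finite_subset)
qed

lemma theta_spanning: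
  assumes F: "F \<in> families" and i: "i < n"
  shows "F i - (\<Sum>q\<in>theta_support F. const_rho (coefficient F q) * Th q i) \<in> ideal_rho G I i"
proof -
  let ?T = "theta_support F"
  let ?S = "\<lambda>i. \<Sum>q\<in>?T. const_rho (coefficient F q) * Th q i"
  have T: "?T \<subseteq> trop_int n" by (auto simp: theta_support_def)
  have kb: "keys (coefficient F q) \<subseteq> P" if "q \<in> ?T" for q
    using keys_coefficient[OF F] T that by blast
  have S: "?S \<in> families"
    using T kb by (intro families_sum families_scaled families_Th) auto
  have H: "(\<lambda>i. F i - ?S i) \<in> families"
    using families_add[OF F families_uminus[OF S]] by simp
  have "(\<lambda>i. F i - ?S i) i \<in> ideal_rho G I i"
  proof (rule vanishing[OF H _ i])
    fix q p assume q: "q \<in> trop_int n" and p: "p \<notin> I"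
    let ?i = "home q" and ?z = "witness q"
    let ?m = "coords n ?i q"
    have zero: "?S i - ?S i \<in> ideal_rho G I i" if "i < n" for i
      using quotient_on.A_zero[OF pm_quotient.axioms(1)[OF pm_quotient_rho[OF that]]] by simp
    \<comment> \<open>The candidate sum is an expansion of itself, so its coefficients are known;
      those it omits lie in \<open>I\<close>.\<close>
    have "RI.cls (slice ?m (ev ?i ?z ?S)) = RI.cls (if q \<in> ?T then coefficient F q else 0)"
      by (rule expansion_coefficient[OF S finite_theta_support T kb zero q home_props(1)[OF q] near_witness[OF q]])
    moreover have "RI.cls (if q \<in> ?T then coefficient F q else 0) = RI.cls (coefficient F q)"
      using q by (auto simp: theta_support_def RI.cls_eq_iff)
    ultimately have "keys (coefficient F q - slice ?m (ev ?i ?z ?S)) \<subseteq> I"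
      by (simp add: RI.cls_eq_iff RI.A_diff_swap[unfolded mem_Collect_eq])
    then have "lookup (coefficient F q) p = lookup (slice ?m (ev ?i ?z ?S)) p"
      using p by (rule lookup_eq_if_keys_diff)
    then show "lookup (ev ?i ?z (\<lambda>i. F i - ?S i)) (p, ?m) = 0"
      by (simp add: ev_diff lookup_minus coefficient_def lookup_slice)
  qed
  then show ?thesis by simp
qed

section \<open>The product of two theta functions\<close>

lemma keys_bl_coef: "\<beta> \<in> broken_lines G q Q \<Longrightarrow> keys (bl_coef \<beta>) \<subseteq> P"
  using broken_lines_P[of \<beta> q Q] by (simp add: bl_coef_def Let_def)

text \<open>Pairs are filtered in two ways: lifts use lines whose own exponents are outside
  \<open>I\<close>, \<open>product_pairs\<close> uses pairs whose product is nonzero in R_I. The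
  first condition is weaker, and the pairs that satisfy only it contribute elements of the
  ideal.\<close>

lemma product_formula:
  assumes "q1 \<in> trop_int n" "q2 \<in> trop_int n" "i < n" "near q i z"
  defines "PP \<equiv> product_pairs G I q1 q2 z (coords n i q)"
  shows "finite PP"
    and "RI.cls (slice (coords n i q) (ev i z (\<lambda>i. Th q1 i * Th q2 i))) =
      finsum RI.Q (\<lambda>(\<beta>1, \<beta>2). RI.cls (bl_coef \<beta>1) \<otimes>\<^bsub>RI.Q\<^esub> RI.cls (bl_coef \<beta>2)) PP"
proof -
  interpret Q: cring RI.Q by (rule RI.cring_Q)
  note zc = nearD[OF assms(3,4)]
  let ?m = "coords n i q"
  define PP0 where "PP0 = {(\<beta>1, \<beta>2) \<in> lines z q1 \<times> lines z q2. bl_dir \<beta>1 + bl_dir \<beta>2 = ?m}"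
  have fin0: "finite PP0"
    by (rule finite_subset[of _ "lines z q1 \<times> lines z q2"]) (auto simp: PP0_def finite_lines)
  have I0: "keys (bl_coef \<beta>1 * bl_coef \<beta>2) \<subseteq> I"
    if "\<beta>1 \<in> broken_lines G q1 z" "\<beta>2 \<in> broken_lines G q2 z" "\<beta>1 \<notin> lines z q1 \<or> \<beta>2 \<notin> lines z q2" for \<beta>1 \<beta>2
  proof -
    have "pexp (last (snd \<beta>1)) \<in> I \<or> pexp (last (snd \<beta>2)) \<in> I" using that by (auto simp: lines_def)
    then have "pexp (last (snd \<beta>1)) + pexp (last (snd \<beta>2)) \<in> I"
      using broken_lines_P[OF that(1)] broken_lines_P[OF that(2)] ideal_add[OF I_ideal] ideal_add'[OF I_ideal] by blast
    then show ?thesis by (simp add: bl_coef_def Let_def mult_single)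
  qed
  have PP_eq: "PP = {x \<in> PP0. \<not> keys (bl_coef (fst x) * bl_coef (snd x)) \<subseteq> I}"
  proof (intro equalityI subsetI)
    fix x assume "x \<in> PP"
    moreover obtain \<beta>1 \<beta>2 where x0: "x = (\<beta>1, \<beta>2)" by (cases x)
    ultimately have x: "\<beta>1 \<in> broken_lines G q1 z" "\<beta>2 \<in> broken_lines G q2 z"
      "bl_dir \<beta>1 + bl_dir \<beta>2 = ?m" "\<not> keys (bl_coef \<beta>1 * bl_coef \<beta>2) \<subseteq> I"
      by (simp_all add: PP_def product_pairs_def cls_RI_eq ring_RI_eq RI.cls_eq_zero_iff)
    then show "x \<in> {x \<in> PP0. \<not> keys (bl_coef (fst x) * bl_coef (snd x)) \<subseteq> I}"
      using I0[OF x(1,2)] by (simp add: PP0_def x0) blast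
  next
    fix x assume "x \<in> {x \<in> PP0. \<not> keys (bl_coef (fst x) * bl_coef (snd x)) \<subseteq> I}"
    moreover obtain \<beta>1 \<beta>2 where "x = (\<beta>1, \<beta>2)" by (cases x)
    ultimately show "x \<in> PP"
      by (simp add: PP0_def PP_def product_pairs_def cls_RI_eq ring_RI_eq RI.cls_eq_zero_iff lines_def)
  qed
  then show fin: "finite PP" using fin0 by simp
  let ?f = "\<lambda>x. bl_coef (fst x) * bl_coef (snd x)"
  have kL: "keys (bl_coef (fst x)) \<subseteq> P" "keys (bl_coef (snd x)) \<subseteq> P" if "x \<in> PP" for x
    using that keys_bl_coef unfolding PP_eq PP0_def lines_def by fastforce+
  have "ev i z (\<lambda>i. Th q1 i * Th q2 i) - ev i z (Th q1) * ev i z (Th q2) \<in> {f. keys f \<subseteq> I \<times> UNIV}"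
    using ev_mult[where F = "Th q1" and F' = "Th q2",
        OF assms(3) keys_Th[OF assms(1,3)] keys_Th[OF assms(2,3)], of z] by simp
  moreover have "ev i z (Th q1) * ev i z (Th q2) - Lsum z q1 * Lsum z q2 \<in> {f. keys f \<subseteq> I \<times> UNIV}"
  proof (rule sig.A_diff_mult)
    show "ev i z (Th q1) - Lsum z q1 \<in> {f. keys f \<subseteq> I \<times> UNIV}"
      using cls_ev_Th[OF assms(1,3) zc(1,2)] by (simp only: sig.cls_eq_iff)
    show "ev i z (Th q2) - Lsum z q2 \<in> {f. keys f \<subseteq> I \<times> UNIV}"
      using cls_ev_Th[OF assms(2,3) zc(1,2)] by (simp only: sig.cls_eq_iff)
  qed (use keys_ev[where F = "Th q1", OF assms(3) keys_Th[OF assms(1,3)]] keys_Lsum in simp_all)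
  ultimately have "ev i z (\<lambda>i. Th q1 i * Th q2 i) - Lsum z q1 * Lsum z q2 \<in> {f. keys f \<subseteq> I \<times> UNIV}"
    by (rule sig.A_diff_trans)
  then have "keys (slice ?m (ev i z (\<lambda>i. Th q1 i * Th q2 i) - Lsum z q1 * Lsum z q2)) \<subseteq> I"
    by (intro keys_slice) simp
  then have 1: "RI.cls (slice ?m (ev i z (\<lambda>i. Th q1 i * Th q2 i))) = RI.cls (slice ?m (Lsum z q1 * Lsum z q2))"
    by (intro RI.cls_eqI) (simp add: slice_diff)
  have prod: "slice ?m (bl_mono \<beta>1 * bl_mono \<beta>2) = (if bl_dir \<beta>1 + bl_dir \<beta>2 = ?m then bl_coef \<beta>1 * bl_coef \<beta>2 else 0)"
    for \<beta>1 \<beta>2 :: "('k, 'p) broken"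
    by (simp add: bl_mono_def bl_coef_def bl_dir_def Let_def mult_single slice_single)
  have "slice ?m (Lsum z q1 * Lsum z q2) =
      (\<Sum>x\<in>lines z q1 \<times> lines z q2. slice ?m (bl_mono (fst x) * bl_mono (snd x)))"
    unfolding Lsum_def sum_product by (simp add: slice_sum sum.cartesian_product case_prod_beta)
  also have "\<dots> = sum ?f PP0"
    by (rule sum.mono_neutral_cong_right)
      (auto simp: PP0_def finite_lines prod split: if_splits)
  finally have 2: "slice ?m (Lsum z q1 * Lsum z q2) = sum ?f PP0" .
  have "sum ?f PP0 = sum ?f PP + sum ?f (PP0 - PP)"
    using sum.subset_diff[of PP PP0 ?f] fin0 PP_eq by (simp add: add.commute)
  moreover have "sum ?f (PP0 - PP) \<in> {f. keys f \<subseteq> I}"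
    by (rule RI.A_sum) (auto simp: PP_eq)
  ultimately have 3: "RI.cls (sum ?f PP0) = RI.cls (sum ?f PP)"
    by (intro RI.cls_eqI) simp
  have S: "?f x \<in> {f. keys f \<subseteq> P}" if "x \<in> PP" for x
    using kL[OF that] by (intro RI.S_mult) simp_all
  have "finsum RI.Q (\<lambda>x. RI.cls (?f x)) PP = RI.cls (sum ?f PP)"
    by (rule RI.finsum_cls[OF fin S])
  moreover have "finsum RI.Q (\<lambda>(\<beta>1, \<beta>2). RI.cls (bl_coef \<beta>1) \<otimes>\<^bsub>RI.Q\<^esub> RI.cls (bl_coef \<beta>2)) PP =
      finsum RI.Q (\<lambda>x. RI.cls (?f x)) PP"
  proof (rule Q.finsum_cong'[OF refl])
    show "(\<lambda>x. RI.cls (?f x)) \<in> PP \<rightarrow> carrier RI.Q"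
      using S RI.cls_in_carrier by blast
    fix x assume "x \<in> PP"
    from kL[OF this] show "(case x of (\<beta>1, \<beta>2) \<Rightarrow> RI.cls (bl_coef \<beta>1) \<otimes>\<^bsub>RI.Q\<^esub> RI.cls (bl_coef \<beta>2)) = RI.cls (?f x)"
      by (simp add: case_prod_beta RI.cls_mult)
  qed
  ultimately show "RI.cls (slice (coords n i q) (ev i z (\<lambda>i. Th q1 i * Th q2 i))) =
      finsum RI.Q (\<lambda>(\<beta>1, \<beta>2). RI.cls (bl_coef \<beta>1) \<otimes>\<^bsub>RI.Q\<^esub> RI.cls (bl_coef \<beta>2)) PP"
    using 1 2 3 by simp
qed

lemma finsum_scaled_theta:
  assumes "finite T" "T \<subseteq> trop_int n" "\<And>q. q \<in> T \<Longrightarrow> keys (b q) \<subseteq> P" "\<And>q. q \<in> T \<Longrightarrow> \<beta> q = RI.cls (b q)"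
  shows "(\<Oplus>\<^bsub>ring_AI G I\<^esub> q\<in>T. \<beta> q \<odot>\<^bsub>ring_AI G I\<^esub> theta G I q) = glued (\<lambda>i. \<Sum>q\<in>T. const_rho (b q) * Th q i)"
proof -
  interpret A: abelian_monoid "ring_AI G I" by (rule abelian_monoid_AI)
  have families: "(\<lambda>i. const_rho (b q) * Th q i) \<in> families" if "q \<in> T" for q
    using assms that by (intro families_scaled families_Th) auto
  have "(\<Oplus>\<^bsub>ring_AI G I\<^esub> q\<in>T. \<beta> q \<odot>\<^bsub>ring_AI G I\<^esub> theta G I q) =
      (\<Oplus>\<^bsub>ring_AI G I\<^esub> q\<in>T. glued (\<lambda>i. const_rho (b q) * Th q i))"
  proof (rule A.finsum_cong'[OF refl])
    show "(\<lambda>q. glued (\<lambda>i. const_rho (b q) * Th q i)) \<in> T \<rightarrow> carrier (ring_AI G I)"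
      using families by (auto simp: carrier_AI)
    fix q assume q: "q \<in> T"
    then have "q \<in> trop_int n" using assms(2) by blast
    then show "\<beta> q \<odot>\<^bsub>ring_AI G I\<^esub> theta G I q = glued (\<lambda>i. const_rho (b q) * Th q i)"
      by (simp add: assms(4)[OF q] theta_eq glued_smult[OF assms(3)[OF q]] families_Th)
  qed
  also have "\<dots> = glued (\<lambda>i. \<Sum>q\<in>T. const_rho (b q) * Th q i)"
    by (rule finsum_glued[OF assms(1) families])
  finally show ?thesis .
qed

text \<open>Polynomial representatives of the coefficients turn an expansion in
  \<open>ring_AI\<close> into the congruences of \<open>expansion_coefficient\<close>.\<close>

lemma theta_expansion_coefficient:
  assumes F: "F \<in> families" and exp: "theta_expansion G I (glued F) \<beta>"
    and q: "q \<in> trop_int n" and i: "i < n" and z: "near q i z"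
  shows "RI.cls (slice (coords n i q) (ev i z F)) = \<beta> q"
proof -
  define T where "T = {q \<in> trop_int n. \<beta> q \<noteq> \<zero>\<^bsub>RI.Q\<^esub>}"
  define b where "b q = (SOME f. f \<in> \<beta> q)" for q
  have \<beta>: "\<beta> \<in> trop_int n \<rightarrow>\<^sub>E carrier RI.Q" "finite T"
    "glued F = (\<Oplus>\<^bsub>ring_AI G I\<^esub> q\<in>T. \<beta> q \<odot>\<^bsub>ring_AI G I\<^esub> theta G I q)"
    using exp by (simp_all add: theta_expansion_def ring_RI_eq T_def)
  have b: "\<beta> q = RI.cls (b q)" "keys (b q) \<subseteq> P" if "q \<in> trop_int n" for q
  proof -
    have c: "\<beta> q \<in> carrier RI.Q" using \<beta>(1) that by auto
    then show "\<beta> q = RI.cls (b q)" unfolding b_def by (rule RI.cls_some_rep[symmetric])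
    obtain x where "\<beta> q = RI.cls x" "keys x \<subseteq> P" using c by (auto simp: RI.carrier_Q)
    then show "keys (b q) \<subseteq> P"
      using RI.some_rep(1)[of x] by (simp add: b_def)
  qed
  have T: "T \<subseteq> trop_int n" by (auto simp: T_def)
  have "glued F = glued (\<lambda>i. \<Sum>q\<in>T. const_rho (b q) * Th q i)"
    unfolding \<beta>(3) by (rule finsum_scaled_theta[OF \<beta>(2) T]) (use b T in auto)
  then have exp: "F i - (\<Sum>q\<in>T. const_rho (b q) * Th q i) \<in> ideal_rho G I i" if "i < n" for i
    using that by (simp add: glued_eq_iff)
  have kb: "keys (b q) \<subseteq> P" if "q \<in> T" for q using b(2) T that by blast
  have "RI.cls (slice (coords n i q) (ev i z F)) = RI.cls (if q \<in> T then b q else 0)"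
    by (rule expansion_coefficient[OF F \<beta>(2) T kb exp q i z])
  also have "\<dots> = \<beta> q"
    using b(1)[OF q] q by (auto simp: T_def RI.zero_Q)
  finally show ?thesis .
qed

lemma theta_expansion_exists:
  assumes F: "F \<in> families"
  shows "theta_expansion G I (glued F) (\<lambda>q\<in>trop_int n. RI.cls (coefficient F q))"
proof -
  let ?\<alpha> = "\<lambda>q\<in>trop_int n. RI.cls (coefficient F q)"
  have T: "{q \<in> trop_int n. ?\<alpha> q \<noteq> \<zero>\<^bsub>RI.Q\<^esub>} = theta_support F"
    by (auto simp: theta_support_def RI.cls_eq_zero_iff)
  have sub: "theta_support F \<subseteq> trop_int n" by (auto simp: theta_support_def)
  have "glued F = glued (\<lambda>i. \<Sum>q\<in>theta_support F. const_rho (coefficient F q) * Th q i)"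
    using theta_spanning[OF F] by (simp add: glued_eq_iff)
  also have "\<dots> = (\<Oplus>\<^bsub>ring_AI G I\<^esub> q\<in>theta_support F. ?\<alpha> q \<odot>\<^bsub>ring_AI G I\<^esub> theta G I q)"
    using keys_coefficient[OF F] sub by (intro finsum_scaled_theta[symmetric] finite_theta_support) auto
  finally show ?thesis
    unfolding theta_expansion_def ring_RI_eq T
    using finite_theta_support keys_coefficient[OF F] by (auto intro!: RI.cls_in_carrier)
qed

lemma theta_product:
  assumes "q1 \<in> trop_int n" "q2 \<in> trop_int n"
  shows "\<exists>\<alpha>. theta_expansion G I (theta G I q1 \<otimes>\<^bsub>ring_AI G I\<^esub> theta G I q2) \<alpha> \<and>
    (\<forall>\<beta>. theta_expansion G I (theta G I q1 \<otimes>\<^bsub>ring_AI G I\<^esub> theta G I q2) \<beta> \<longrightarrow> \<beta> = \<alpha>) \<and>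
    (\<forall>q\<in>trop_int n. \<exists>\<epsilon>>0. \<forall>i<n. \<forall>z\<in>max_cone n i.
       z \<in> irrational_points n \<and> (\<forall>j. \<bar>z j - real_of_int (q j)\<bar> < \<epsilon>) \<longrightarrow>
       finite (product_pairs G I q1 q2 z (coords n i q)) \<and>
       \<alpha> q = finsum (ring_RI G I)
         (\<lambda>(\<beta>1, \<beta>2). cls_RI G I (bl_coef \<beta>1) \<otimes>\<^bsub>ring_RI G I\<^esub> cls_RI G I (bl_coef \<beta>2))
         (product_pairs G I q1 q2 z (coords n i q)))"
proof -
  define F where "F i = Th q1 i * Th q2 i" for i
  have F: "F \<in> families" unfolding F_def by (intro families_mult families_Th assms)
  have prod: "theta G I q1 \<otimes>\<^bsub>ring_AI G I\<^esub> theta G I q2 = glued F"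
    unfolding F_def using assms by (simp add: theta_eq glued_mult families_Th)
  let ?\<alpha> = "\<lambda>q\<in>trop_int n. RI.cls (coefficient F q)"
  have ex: "theta_expansion G I (glued F) ?\<alpha>" by (rule theta_expansion_exists[OF F])
  show ?thesis
    unfolding prod
  proof (intro exI[of _ ?\<alpha>] conjI allI impI ballI)
    show "theta_expansion G I (glued F) ?\<alpha>" by (rule ex)
  next
    fix \<beta> assume \<beta>: "theta_expansion G I (glued F) \<beta>"
    \<comment> \<open>Any expansion has at \<open>q\<close> the coefficient read at the witness,
      which is how \<open>?\<alpha>\<close> is defined; off the integral points both are
      \<open>undefined\<close>.\<close>
    have "\<beta> q = ?\<alpha> q" for q
    proof (cases "q \<in> trop_int n")
      case True
      then show ?thesis
        using theta_expansion_coefficient[OF F \<beta> True home_props(1)[OF True] near_witness[OF True]]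
        by (simp add: coefficient_def)
    next
      case False
      then show ?thesis using \<beta> by (auto simp: theta_expansion_def PiE_def extensional_def)
    qed
    then show "\<beta> = ?\<alpha>" by (rule ext)
  next
    fix q assume q: "q \<in> trop_int n"
    obtain \<epsilon> where \<epsilon>: "\<epsilon> > 0" "\<forall>i<n. \<forall>z\<in>max_cone n i.
      z \<in> irrational_points n \<and> (\<forall>j. \<bar>z j - real_of_int (q j)\<bar> < \<epsilon>) \<longrightarrow> near q i z"
      using near_exists[OF q] by blast
    \<comment> \<open>\<open>?\<alpha>\<close> was read at one witness, but any near
      \<open>z\<close>, in any cone containing \<open>q\<close>, gives the same value.\<close>
    have "finite (product_pairs G I q1 q2 z (coords n i q)) \<and>
       ?\<alpha> q = finsum (ring_RI G I)
         (\<lambda>(\<beta>1, \<beta>2). cls_RI G I (bl_coef \<beta>1) \<otimes>\<^bsub>ring_RI G I\<^esub> cls_RI G I (bl_coef \<beta>2))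
         (product_pairs G I q1 q2 z (coords n i q))" if "i < n" "near q i z" for i z
      using product_formula[OF assms that, folded F_def] theta_expansion_coefficient[OF F ex q that]
      by (simp add: ring_RI_eq cls_RI_eq)
    then show "\<exists>\<epsilon>>0. \<forall>i<n. \<forall>z\<in>max_cone n i.
       z \<in> irrational_points n \<and> (\<forall>j. \<bar>z j - real_of_int (q j)\<bar> < \<epsilon>) \<longrightarrow>
       finite (product_pairs G I q1 q2 z (coords n i q)) \<and>
       ?\<alpha> q = finsum (ring_RI G I)
         (\<lambda>(\<beta>1, \<beta>2). cls_RI G I (bl_coef \<beta>1) \<otimes>\<^bsub>ring_RI G I\<^esub> cls_RI G I (bl_coef \<beta>2))
         (product_pairs G I q1 q2 z (coords n i q))"
      using \<epsilon> by (intro exI[of _ \<epsilon>]) blast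
  qed
qed

end

theorem theorem2p34:
  fixes y :: "nat \<Rightarrow> 'k::{alg_closed_field, field_char_0} ratfun"
    and D :: "nat \<Rightarrow> 'k ratfun set"
    and N n :: nat
    and P J I :: "'p::ab_group_add set"
    and \<kappa> :: "nat \<Rightarrow> 'p"
    and DD :: "((nat \<Rightarrow> int) \<times> ('p \<times> int \<Rightarrow> 'k)) set"
    and G :: "('k, 'p) scatter_data"
    and q1 q2 :: "nat \<Rightarrow> int"
  assumes "looijenga_pair N y n D" and "3 \<le> n" and "cyclically_ordered N y n D"
    and "toric_monoid P"
    and "monoid_ideal P J" and "monoid_radical P J = J"
    and "\<forall>i<n. \<kappa> i \<in> J"
    and "G = \<lparr>comps = n, selfint = (\<lambda>i. self_intersection N y (D i)),
              monoidP = P, idealJ = J, kappa = \<kappa>, diag = DD\<rparr>"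
    and "scattering_diagram G" and "consistent G"
    and "monoid_ideal P I" and "monoid_radical P I = J"
    and "q1 \<in> trop_int n" and "q2 \<in> trop_int n"
  shows "\<exists>\<alpha>. theta_expansion G I (theta G I q1 \<otimes>\<^bsub>ring_AI G I\<^esub> theta G I q2) \<alpha> \<and>
    (\<forall>\<beta>. theta_expansion G I (theta G I q1 \<otimes>\<^bsub>ring_AI G I\<^esub> theta G I q2) \<beta> \<longrightarrow> \<beta> = \<alpha>) \<and>
    (\<forall>q\<in>trop_int n. \<exists>\<epsilon>>0. \<forall>i<n. \<forall>z\<in>max_cone n i.
       z \<in> irrational_points n \<and> (\<forall>j. \<bar>z j - real_of_int (q j)\<bar> < \<epsilon>) \<longrightarrow>
       finite (product_pairs G I q1 q2 z (coords n i q)) \<and>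
       \<alpha> q = finsum (ring_RI G I)
         (\<lambda>(\<beta>1, \<beta>2). cls_RI G I (bl_coef \<beta>1) \<otimes>\<^bsub>ring_RI G I\<^esub> cls_RI G I (bl_coef \<beta>2))
         (product_pairs G I q1 q2 z (coords n i q)))"
proof -
  have sel: "comps G = n" "monoidP G = P" "idealJ G = J" "kappa G = \<kappa>"
    using assms(8) by simp_all
  interpret gs_setup G I
    by unfold_locales (use assms in \<open>simp_all add: sel\<close>)
  show ?thesis
    using theta_product[of q1 q2] assms(13,14) unfolding sel by blast
qed

end
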